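(* Let $h\geq 1$ be an integer and let $\alpha\in\bigl(0,1/(2h)\bigr)$ be a real number. Then $t(n)=n^{-(2h-1)/h^2}$ is a threshold function for the property of containing a perfect $K_{h,h}$-tiling in the randomly perturbed bipartite graph $G_{n;\alpha}\cup G_{n,n,p}$; that is, there exist real constants $c,C>0$ such that: (1) if $p(n)\leq c\,t(n)$, then for every $n$ (with $h\mid n$) there exists a balanced bipartite graph $G^{*}_{n;\alpha}$ with parts $A,B$, $|A|=|B|=n$, and minimum degree at least $\alpha n$ such that with high probability $G^{*}_{n;\alpha}\cup G_{n,n,p}$ has no perfect $K_{h,h}$-tiling; (2) if $p(n)\geq C\,t(n)$, then for every balanced bipartite graph $G_{n;\alpha}$ with parts $A,B$, $|A|=|B|=n$ (with $h\mid n$), and minimum degree at least $\alpha n$, with high probability $G_{n;\alpha}\cup G_{n,n,p}$ has a perfect $K_{h,h}$-tiling.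
   Context: For a graph $H$, an $H$-tiling of a graph $G$ is a collection of vertex-disjoint copies of $H$ in $G$; it is perfect if it covers every vertex of $G$. Fix disjoint sets $A,B$ with $|A|=|B|=n$, $h\mid n$. $G_{n;\alpha}$ denotes an arbitrary bipartite graph with bipartition $(A,B)$ and minimum degree at least $\alpha n$; $G_{n,n,p}$ is the random bipartite graph with the same bipartition $(A,B)$ in which each of the $n^2$ pairs $\{a,b\}$, $a\in A$, $b\in B$, is an edge independently with probability $p$. The union $G_{n;\alpha}\cup G_{n,n,p}$ is on vertex set $A\cup B$ with the union of the edge sets. An event holds with high probability (whp) if its probability tends to $1$ as $n\to\infty$. *)

theory Defs
  imports "HOL-Probability.Probability" "HOL-Probability.Product_PMF"
begin

section \<open>Finite simple graphs, copies and tilings\<close>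

record 'v graph =
  verts :: "'v set"
  edges :: "'v set set"

definition simple_graph :: "'v graph \<Rightarrow> bool" where
  "simple_graph G \<longleftrightarrow> finite (verts G) \<and> (\<forall>e\<in>edges G. e \<subseteq> verts G \<and> card e = 2)"

definition graph_union :: "'v graph \<Rightarrow> 'v graph \<Rightarrow> 'v graph" where
  "graph_union G H = \<lparr>verts = verts G \<union> verts H, edges = edges G \<union> edges H\<rparr>"

definition degree :: "'v graph \<Rightarrow> 'v \<Rightarrow> nat" where
  "degree G v = card {e \<in> edges G. v \<in> e}"

text \<open>Only meaningful for a graph with at least one vertex.\<close>

definition min_degree :: "'v graph \<Rightarrow> nat" where
  "min_degree G = Min (degree G ` verts G)"

definition bipartite_graph :: "'v set \<Rightarrow> 'v set \<Rightarrow> 'v graph \<Rightarrow> bool" where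
  "bipartite_graph A B G \<longleftrightarrow>
     simple_graph G \<and> A \<inter> B = {} \<and> verts G = A \<union> B \<and>
     (\<forall>e\<in>edges G. \<exists>a\<in>A. \<exists>b\<in>B. e = {a, b})"

definition subgraph :: "'v graph \<Rightarrow> 'v graph \<Rightarrow> bool" where
  "subgraph F G \<longleftrightarrow> simple_graph F \<and> verts F \<subseteq> verts G \<and> edges F \<subseteq> edges G"

definition isomorphic :: "'v graph \<Rightarrow> 'w graph \<Rightarrow> bool" where
  "isomorphic G H \<longleftrightarrow>
     (\<exists>f. bij_betw f (verts G) (verts H) \<and> edges H = (\<lambda>e. f ` e) ` edges G)"

definition is_tiling :: "'w graph \<Rightarrow> 'v graph \<Rightarrow> 'v graph set \<Rightarrow> bool" where
  "is_tiling H G T \<longleftrightarrow>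
     (\<forall>F\<in>T. subgraph F G \<and> isomorphic H F) \<and>
     pairwise (\<lambda>F F'. disjnt (verts F) (verts F')) T"

definition has_perfect_tiling :: "'w graph \<Rightarrow> 'v graph \<Rightarrow> bool" where
  "has_perfect_tiling H G \<longleftrightarrow> (\<exists>T. is_tiling H G T \<and> (\<Union>F\<in>T. verts F) = verts G)"

section \<open>The bipartition, complete and random bipartite graphs\<close>

definition part_A :: "nat \<Rightarrow> (nat + nat) set" where
  "part_A n = Inl ` {..<n}"

definition part_B :: "nat \<Rightarrow> (nat + nat) set" where
  "part_B n = Inr ` {..<n}"

definition complete_bipartite :: "nat \<Rightarrow> nat \<Rightarrow> (nat + nat) graph" where
  "complete_bipartite k l =
     \<lparr>verts = part_A k \<union> part_B l, edges = {{a, b} | a b. a \<in> part_A k \<and> b \<in> part_B l}\<rparr>"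

text \<open>
  A family of independent Bernoulli variables indexed by the pairs in \<open>A \<times> B\<close> decides which
  of these pairs are edges. Outside \<open>0 \<le> p \<le> 1\<close> the library's \<open>bernoulli_pmf\<close> truncates \<open>p\<close>.
\<close>

definition random_bipartite :: "nat \<Rightarrow> real \<Rightarrow> (nat + nat) graph pmf" where
  "random_bipartite n p =
     map_pmf (\<lambda>\<omega>. \<lparr>verts = part_A n \<union> part_B n,
                    edges = {{a, b} | a b. a \<in> part_A n \<and> b \<in> part_B n \<and> \<omega> (a, b)}\<rparr>)
       (Pi_pmf (part_A n \<times> part_B n) False (\<lambda>_. bernoulli_pmf p))"

section \<open>Asymptotics along the multiples of a fixed integer\<close>

definition multiples_at_top :: "nat \<Rightarrow> nat filter" where
  "multiples_at_top h = inf sequentially (principal {n. h dvd n})"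

definition whp :: "nat filter \<Rightarrow> (nat \<Rightarrow> 'a pmf) \<Rightarrow> (nat \<Rightarrow> 'a \<Rightarrow> bool) \<Rightarrow> bool" where
  "whp F \<mu> P \<longleftrightarrow> ((\<lambda>n. measure_pmf.prob (\<mu> n) {x. P n x}) \<longlongrightarrow> 1) F"

text \<open>A choice, for every positive multiple \<open>n\<close> of \<open>h\<close>, of a deterministic graph \<open>G\<^bsub>n;\<alpha>\<^esub>\<close>.\<close>

definition dense_bipartite_seq :: "nat \<Rightarrow> real \<Rightarrow> (nat \<Rightarrow> (nat + nat) graph) \<Rightarrow> bool" where
  "dense_bipartite_seq h \<alpha> G \<longleftrightarrow>
     (\<forall>n. 0 < n \<and> h dvd n \<longrightarrow>
        bipartite_graph (part_A n) (part_B n) (G n) \<and> real (min_degree (G n)) \<ge> \<alpha> * real n)"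

end

theory Submission
  imports Defs "HOL-Real_Asymp.Real_Asymp"
begin

text \<open>
  The lower bound is a first moment argument. Let \<open>G\<close> consist of all pairs meeting fixed sets of
  about \<open>\<alpha>n\<close> vertices in each part. Since \<open>2\<alpha> < 1/h\<close>, a linear number of the \<open>n/h\<close> copies in a
  perfect tiling avoids these sets, so they are disjoint copies in the random graph alone; for small
  \<open>c\<close> a union bound rules out so many of them.

  For the upper bound, Janson's inequality shows that a fixed family of at least \<open>\<beta>n\<^sup>2\<^sup>h\<close> potential
  copies is missed by the random graph with probability at most \<open>exp(-Kn)\<close>, with \<open>K\<close> as large as we
  like. Hence \<open>exp(O(n))\<close> such families are hit simultaneously. This gives a linear number of disjoint
  random copies \<open>T\<close> such that almost every vertex \<open>v\<close> can replace, by means of \<open>G\<close>-edges, the first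
  vertex \<open>x\<^sub>T\<close> of linearly many of them. The few exceptional vertices are covered one by one by a
  \<open>G\<close>-star completed by random edges, and the rest is tiled greedily up to a small leftover. A leftover
  \<open>2h\<close>-set is absorbed by letting its vertices replace vertices \<open>x\<^sub>T\<close> that themselves span a random copy:
  each leftover vertex has a linear set of candidates \<open>x\<^sub>T\<close>, so such a random copy exists.
\<close>

section \<open>Janson's inequality\<close>

text \<open>The exponent is the one at which n^(2h) p^(h^2) has order n. There are then linearly
  many random copies, but on average only boundedly many through a given vertex. The random graph
  therefore supplies statements about linear-sized vertex sets only, and whatever concerns a single
  vertex has to pass through its \<open>\<alpha> n\<close> neighbours in G.

  The sets to which such statements are applied depend on the random graph themselves. Edges are not
  exposed in rounds to cope with this. Instead one family is fixed, from G alone, for every choice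
  of vertex sets that might ever arise, and all of them are hit at once. From then on the argument
  is deterministic and uses only \<open>rich\<close> and \<open>popular_rich\<close>. The price is
  one family for each choice among exponentially many; this is why a failure probability exp(-Kn)
  with prescribed K is needed, and why C depends on h and \<open>\<alpha>\<close>.\<close>

abbreviation random_subset :: "'e set \<Rightarrow> real \<Rightarrow> ('e \<Rightarrow> bool) pmf" where
  "random_subset E p \<equiv> Pi_pmf E False (\<lambda>_. bernoulli_pmf p)"

lemma finite_set_random_subset:
  assumes "finite E"
  shows "finite (set_pmf (random_subset E p))"
  by (rule finite_subset[OF set_Pi_pmf_subset'[OF assms]]) (use assms in auto)

lemma integrable_random_subset [simp]:
  fixes f :: "('e \<Rightarrow> bool) \<Rightarrow> real"
  assumes "finite E"
  shows "integrable (measure_pmf (random_subset E p)) f"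
  by (intro integrable_measure_pmf_finite finite_set_random_subset assms)

lemma expectation_present_element:
  fixes f :: "('e \<Rightarrow> bool) \<Rightarrow> real"
  assumes "finite E" "x \<in> E" "0 \<le> p" "p \<le> 1"
  shows "measure_pmf.expectation (random_subset E p) (\<lambda>\<omega>. of_bool (\<omega> x) * f \<omega>) =
         p * measure_pmf.expectation (random_subset E p) (\<lambda>\<omega>. f (fun_upd \<omega> x True))"
proof -
  define E' where "E' = E - {x}"
  have E: "E = insert x E'" "x \<notin> E'" "finite E'"
    using assms by (auto simp: E'_def)
  \<comment> \<open>The coordinate \<open>x\<close> is split off and the formula is used on both
    sides of the claim: on the left only the branch with \<open>x\<close> present survives, on the
    right both branches agree because \<open>x\<close> is overwritten.\<close>
  have *: "measure_pmf.expectation (random_subset E p) g =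
      p * measure_pmf.expectation (random_subset E' p) (\<lambda>\<omega>. g (fun_upd \<omega> x True)) +
      (1 - p) * measure_pmf.expectation (random_subset E' p) (\<lambda>\<omega>. g (fun_upd \<omega> x False))"
    for g :: "('e \<Rightarrow> bool) \<Rightarrow> real"
  proof -
    have "measure_pmf.expectation (random_subset E p) g =
      measure_pmf.expectation (bernoulli_pmf p \<bind>
        (\<lambda>y. map_pmf (\<lambda>\<omega>. fun_upd \<omega> x y) (random_subset E' p))) g"
      unfolding E(1) Pi_pmf_insert'[OF E(3,2)] by (simp add: map_pmf_def)
    also have "\<dots> = (\<Sum>y\<in>UNIV. pmf (bernoulli_pmf p) y *\<^sub>R
        measure_pmf.expectation (map_pmf (\<lambda>\<omega>. fun_upd \<omega> x y) (random_subset E' p)) g)"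
      by (rule pmf_expectation_bind) (auto simp: finite_set_random_subset E)
    finally show ?thesis
      using assms by (simp add: UNIV_bool)
  qed
  show ?thesis
    unfolding * by (simp add: algebra_simps)
qed

lemma expectation_present:
  fixes f :: "('e \<Rightarrow> bool) \<Rightarrow> real"
  assumes "finite E" "S \<subseteq> E" "0 \<le> p" "p \<le> 1"
  shows "measure_pmf.expectation (random_subset E p) (\<lambda>\<omega>. of_bool (\<forall>e\<in>S. \<omega> e) * f \<omega>) =
         p ^ card S * measure_pmf.expectation (random_subset E p) (\<lambda>\<omega>. f (\<lambda>e. e \<in> S \<or> \<omega> e))"
proof -
  have "finite S"
    using assms finite_subset by blast
  then show ?thesis
    using assms(2)
  \<comment> \<open>The function is generalised because each step moves the indicator of one element
    into it.\<close>
  proof (induction S arbitrary: f)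
    case empty
    then show ?case by simp
  next
    case (insert x S)
    have "measure_pmf.expectation (random_subset E p) (\<lambda>\<omega>. of_bool (\<forall>e\<in>insert x S. \<omega> e) * f \<omega>) =
      measure_pmf.expectation (random_subset E p) (\<lambda>\<omega>. of_bool (\<forall>e\<in>S. \<omega> e) * (of_bool (\<omega> x) * f \<omega>))"
      by (intro arg_cong[where f = "measure_pmf.expectation _"] ext) auto
    also have "\<dots> = p ^ card S * measure_pmf.expectation (random_subset E p)
        (\<lambda>\<omega>. of_bool (\<omega> x) * f (\<lambda>e. e \<in> S \<or> \<omega> e))"
      using insert by simp
    also have "\<dots> = p ^ card S * (p * measure_pmf.expectation (random_subset E p)
        (\<lambda>\<omega>. f (\<lambda>e. e \<in> S \<or> (fun_upd \<omega> x True) e)))"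
      using insert assms by (subst expectation_present_element) auto
    also have "(\<lambda>\<omega>. f (\<lambda>e. e \<in> S \<or> (fun_upd \<omega> x True) e)) = (\<lambda>\<omega>. f (\<lambda>e. e \<in> insert x S \<or> \<omega> e))"
      by (intro ext arg_cong[where f = f]) auto
    finally show ?case
      using insert by (simp add: mult.assoc)
  qed
qed

lemma prob_present:
  assumes "finite E" "S \<subseteq> E" "0 \<le> p" "p \<le> 1"
  shows "measure_pmf.prob (random_subset E p) {\<omega>. \<forall>e\<in>S. \<omega> e} = p ^ card S"
proof -
  have "measure_pmf.prob (random_subset E p) {\<omega>. \<forall>e\<in>S. \<omega> e} =
    measure_pmf.expectation (random_subset E p) (indicator {\<omega>. \<forall>e\<in>S. \<omega> e})"
    by simp
  also have "\<dots> = measure_pmf.expectation (random_subset E p) (\<lambda>\<omega>. of_bool (\<forall>e\<in>S. \<omega> e) * 1)"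
    by (intro arg_cong[where f = "measure_pmf.expectation _"] ext) (auto simp: indicator_def)
  also have "\<dots> = p ^ card S"
    using expectation_present[OF assms, of "\<lambda>_. 1"] by simp
  finally show ?thesis .
qed

text \<open>The Weierstrass product inequality. In the proof of Janson's inequality it linearises
  the factors of the dependent events.\<close>

lemma one_minus_sum_le_prod:
  fixes x :: "'i \<Rightarrow> real"
  assumes "finite I" "\<And>i. i \<in> I \<Longrightarrow> 0 \<le> x i \<and> x i \<le> 1"
  shows "1 - sum x I \<le> (\<Prod>i\<in>I. 1 - x i)"
  using assms
proof (induction I)
  case (insert i I)
  have "(\<Prod>i\<in>I. 1 - x i) \<le> 1"
    using insert by (intro prod_le_1) auto
  then have "x i * (\<Prod>i\<in>I. 1 - x i) \<le> x i"
    using insert by (simp add: mult_left_le)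
  then show ?case
    using insert by (simp add: algebra_simps)
qed simp

text \<open>
  The factor \<open>1 - q b\<^sub>i\<close> is what remains of \<open>1 - b\<^sub>i\<close> when the event \<open>i\<close> is kept only with probability
  \<open>q\<close>; a small \<open>q\<close> makes the quadratic term harmless. Correlation inequalities are not needed in
  general form: conditioning on the presence of a set is the same as adding it.
\<close>

lemma janson_thinned:
  fixes S :: "'i \<Rightarrow> 'e set"
  assumes E: "finite E" and p: "0 \<le> p" "p \<le> 1" and q: "0 \<le> q" "q \<le> 1"
    and I: "finite I" "\<And>i. i \<in> I \<Longrightarrow> S i \<subseteq> E"
  shows "measure_pmf.expectation (random_subset E p)
           (\<lambda>\<omega>. \<Prod>i\<in>I. 1 - q * of_bool (\<forall>e\<in>S i. \<omega> e)) \<le>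
         exp (- q * (\<Sum>i\<in>I. p ^ card (S i)) +
              q\<^sup>2 * (\<Sum>i\<in>I. \<Sum>j | j \<in> I \<and> S i \<inter> S j \<noteq> {}. p ^ card (S i \<union> S j)))"
  using I
proof (induction I)
  case empty
  then show ?case by simp
next
  case (insert i I)
  let ?E = "measure_pmf.expectation (random_subset E p)"
  define b where "b j \<omega> = (of_bool (\<forall>e\<in>S j. \<omega> e) :: real)" for j and \<omega> :: "'e \<Rightarrow> bool"
  define F where "F J \<omega> = (\<Prod>j\<in>J. 1 - q * b j \<omega>)" for J and \<omega> :: "'e \<Rightarrow> bool"
  \<comment> \<open>The events that depend on event \<open>i\<close>. The factors outside
    \<open>D\<close> are handled exactly, those in \<open>D\<close> are bounded below by a linear
    expression.\<close>
  define D where "D = {j \<in> I. S i \<inter> S j \<noteq> {}}"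
  define \<delta> where "\<delta> = (\<Sum>j\<in>D. p ^ card (S i \<union> S j))"
  have b01: "0 \<le> q * b j \<omega> \<and> q * b j \<omega> \<le> 1" for j \<omega>
    using q by (auto simp: b_def)
  have F01: "0 \<le> F J \<omega>" "F J \<omega> \<le> 1" for J \<omega>
    unfolding F_def using b01 by (auto intro!: prod_nonneg prod_le_1)
  have finD: "finite D" "D \<subseteq> I" and fin: "finite I"
    using insert by (auto simp: D_def)
  have F_split: "F I \<omega> = F (I - D) \<omega> * F D \<omega>" for \<omega>
    unfolding F_def by (rule prod.subset_diff[OF finD(2) fin])
  have F_mono: "F I \<omega> \<le> F (I - D) \<omega>" for \<omega>
    unfolding F_split using F01 by (simp add: mult_left_le)
  define m where "m = ?E (F (I - D))"
  have indep: "?E (\<lambda>\<omega>. b i \<omega> * F (I - D) \<omega>) = p ^ card (S i) * m"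
  proof -
    have "F (I - D) (\<lambda>e. e \<in> S i \<or> \<omega> e) = F (I - D) \<omega>" for \<omega>
      unfolding F_def
    proof (rule prod.cong)
      fix j assume j: "j \<in> I - D"
      have "b j (\<lambda>e. e \<in> S i \<or> \<omega> e) = b j \<omega>"
        unfolding b_def using j by (intro arg_cong[where f = of_bool]) (auto simp: D_def)
      then show "1 - q * b j (\<lambda>e. e \<in> S i \<or> \<omega> e) = 1 - q * b j \<omega>" by simp
    qed simp
    then show ?thesis
      unfolding b_def m_def using insert expectation_present[OF E _ p, of "S i" "F (I - D)"] by simp
  qed
  \<comment> \<open>The product \<open>F (I - D)\<close> can only decrease when elements are added,
    so forcing \<open>S i\<close> and \<open>S j\<close> to be present costs nothing. This takes the
    place of the Harris inequality.\<close>
  have harris: "?E (\<lambda>\<omega>. b i \<omega> * b j \<omega> * F (I - D) \<omega>) \<le> p ^ card (S i \<union> S j) * m"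
    if "j \<in> D" for j
  proof -
    have "?E (\<lambda>\<omega>. b i \<omega> * b j \<omega> * F (I - D) \<omega>) =
        ?E (\<lambda>\<omega>. of_bool (\<forall>e\<in>S i \<union> S j. \<omega> e) * F (I - D) \<omega>)"
      by (intro arg_cong[where f = ?E] ext) (auto simp: b_def)
    also have "\<dots> = p ^ card (S i \<union> S j) * ?E (\<lambda>\<omega>. F (I - D) (\<lambda>e. e \<in> S i \<union> S j \<or> \<omega> e))"
      using insert.prems that finD by (intro expectation_present[OF E _ p]) auto
    also have "\<dots> \<le> p ^ card (S i \<union> S j) * m"
      unfolding m_def
    proof (intro mult_left_mono Bochner_Integration.integral_mono integrable_random_subset E)
      fix \<omega>
      show "F (I - D) (\<lambda>e. e \<in> S i \<union> S j \<or> \<omega> e) \<le> F (I - D) \<omega>"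
        unfolding F_def
      proof (rule prod_mono)
        fix k
        have "q * b k \<omega> \<le> q * b k (\<lambda>e. e \<in> S i \<union> S j \<or> \<omega> e)"
          using q by (intro mult_left_mono) (auto simp: b_def)
        then show "0 \<le> 1 - q * b k (\<lambda>e. e \<in> S i \<union> S j \<or> \<omega> e) \<and>
            1 - q * b k (\<lambda>e. e \<in> S i \<union> S j \<or> \<omega> e) \<le> 1 - q * b k \<omega>"
          using b01 by auto
      qed
    qed (use p in auto)
    finally show ?thesis .
  qed
  have lower: "m * (p ^ card (S i) - q * \<delta>) \<le> ?E (\<lambda>\<omega>. b i \<omega> * F I \<omega>)"
  proof -
    have "m * (p ^ card (S i) - q * \<delta>) = p ^ card (S i) * m - q * (\<Sum>j\<in>D. p ^ card (S i \<union> S j) * m)"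
      by (simp add: algebra_simps \<delta>_def sum_distrib_left)
    also have "\<dots> \<le> ?E (\<lambda>\<omega>. b i \<omega> * F (I - D) \<omega>) -
        q * (\<Sum>j\<in>D. ?E (\<lambda>\<omega>. b i \<omega> * b j \<omega> * F (I - D) \<omega>))"
      unfolding indep using harris q by (intro diff_left_mono mult_left_mono sum_mono) auto
    also have "\<dots> = ?E (\<lambda>\<omega>. b i \<omega> * F (I - D) \<omega> - q * (\<Sum>j\<in>D. b i \<omega> * b j \<omega> * F (I - D) \<omega>))"
      using E by simp
    also have "\<dots> \<le> ?E (\<lambda>\<omega>. b i \<omega> * F I \<omega>)"
    proof (intro Bochner_Integration.integral_mono integrable_random_subset E)
      fix \<omega>
      have "1 - (\<Sum>j\<in>D. q * b j \<omega>) \<le> F D \<omega>"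
        unfolding F_def using finD b01 by (intro one_minus_sum_le_prod) auto
      then have "(b i \<omega> * F (I - D) \<omega>) * (1 - (\<Sum>j\<in>D. q * b j \<omega>)) \<le> (b i \<omega> * F (I - D) \<omega>) * F D \<omega>"
        using F01 by (intro mult_left_mono) (auto simp: b_def)
      then show "b i \<omega> * F (I - D) \<omega> - q * (\<Sum>j\<in>D. b i \<omega> * b j \<omega> * F (I - D) \<omega>) \<le> b i \<omega> * F I \<omega>"
        unfolding F_split by (simp add: algebra_simps sum_distrib_left)
    qed
    finally show ?thesis .
  qed
  have F_nonneg: "0 \<le> ?E (F I)"
    by (intro Bochner_Integration.integral_nonneg) (use F01 in auto)
  have "?E (F I) \<le> m"
    unfolding m_def by (intro Bochner_Integration.integral_mono integrable_random_subset E F_mono)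
  then have lower': "?E (F I) * (p ^ card (S i) - q * \<delta>) \<le> ?E (\<lambda>\<omega>. b i \<omega> * F I \<omega>)"
  \<comment> \<open>Replacing \<open>m\<close> by the smaller \<open>?E (F I)\<close> is monotone
    only if the bracket is nonnegative. If it is negative, the left side is at most 0 and the right
    side at least 0.\<close>
  proof (cases "p ^ card (S i) - q * \<delta> \<ge> 0")
    case True
    then show ?thesis
      using \<open>?E (F I) \<le> m\<close> lower by (meson mult_right_mono order_trans)
  next
    case False
    have "0 \<le> ?E (\<lambda>\<omega>. b i \<omega> * F I \<omega>)"
      by (intro Bochner_Integration.integral_nonneg) (use F01 in \<open>auto simp: b_def\<close>)
    moreover have "?E (F I) * (p ^ card (S i) - q * \<delta>) \<le> 0"
      using False F_nonneg by (intro mult_nonneg_nonpos) auto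
    ultimately show ?thesis by linarith
  qed
  have "?E (F (insert i I)) = ?E (\<lambda>\<omega>. F I \<omega> - q * (b i \<omega> * F I \<omega>))"
    using insert by (intro arg_cong[where f = ?E] ext) (simp add: F_def algebra_simps)
  also have "\<dots> = ?E (F I) - q * ?E (\<lambda>\<omega>. b i \<omega> * F I \<omega>)"
    using E by simp
  also have "\<dots> \<le> ?E (F I) - q * (?E (F I) * (p ^ card (S i) - q * \<delta>))"
    using lower' q by (intro diff_left_mono mult_left_mono) auto
  also have "\<dots> = ?E (F I) * (1 + (- q * p ^ card (S i) + q\<^sup>2 * \<delta>))"
    by (simp add: algebra_simps power2_eq_square)
  also have "\<dots> \<le> ?E (F I) * exp (- q * p ^ card (S i) + q\<^sup>2 * \<delta>)"
    using F_nonneg exp_ge_add_one_self by (intro mult_left_mono) auto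
  also have "\<dots> \<le> exp (- q * (\<Sum>i\<in>I. p ^ card (S i)) +
              q\<^sup>2 * (\<Sum>i\<in>I. \<Sum>j | j \<in> I \<and> S i \<inter> S j \<noteq> {}. p ^ card (S i \<union> S j))) *
      exp (- q * p ^ card (S i) + q\<^sup>2 * \<delta>)"
    using insert unfolding F_def b_def by (intro mult_right_mono) auto
  also have "\<dots> = exp (- q * (\<Sum>i\<in>insert i I. p ^ card (S i)) +
              q\<^sup>2 * (\<delta> + (\<Sum>i\<in>I. \<Sum>j | j \<in> I \<and> S i \<inter> S j \<noteq> {}. p ^ card (S i \<union> S j))))"
    using insert by (simp add: exp_add[symmetric] algebra_simps)
  \<comment> \<open>The full double sum also contains the reversed pairs and the diagonal, all
    nonnegative.\<close>
  also have "\<dots> \<le> exp (- q * (\<Sum>i\<in>insert i I. p ^ card (S i)) +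
              q\<^sup>2 * (\<Sum>k\<in>insert i I. \<Sum>j | j \<in> insert i I \<and> S k \<inter> S j \<noteq> {}. p ^ card (S k \<union> S j)))"
  proof -
    have "\<delta> \<le> (\<Sum>j | j \<in> insert i I \<and> S i \<inter> S j \<noteq> {}. p ^ card (S i \<union> S j))"
      unfolding \<delta>_def D_def using fin p by (intro sum_mono2) auto
    moreover have "(\<Sum>k\<in>I. \<Sum>j | j \<in> I \<and> S k \<inter> S j \<noteq> {}. p ^ card (S k \<union> S j)) \<le>
        (\<Sum>k\<in>I. \<Sum>j | j \<in> insert i I \<and> S k \<inter> S j \<noteq> {}. p ^ card (S k \<union> S j))"
      using fin p by (intro sum_mono sum_mono2) auto
    ultimately show ?thesis
      using insert by (auto intro!: mult_left_mono)
  qed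
  finally show ?case
    unfolding F_def b_def .
qed

text \<open>If no set is present, every thinned factor equals 1, so the expected product dominates
  the probability. The parameter \<open>q\<close> stays free in order to balance the linear against
  the quadratic term in the application.\<close>

lemma janson_inequality:
  fixes S :: "'i \<Rightarrow> 'e set"
  assumes E: "finite E" and p: "0 \<le> p" "p \<le> 1" and q: "0 \<le> q" "q \<le> 1"
    and I: "finite I" "\<And>i. i \<in> I \<Longrightarrow> S i \<subseteq> E"
  shows "measure_pmf.prob (random_subset E p) {\<omega>. \<forall>i\<in>I. \<not> (\<forall>e\<in>S i. \<omega> e)} \<le>
         exp (- q * (\<Sum>i\<in>I. p ^ card (S i)) +
              q\<^sup>2 * (\<Sum>i\<in>I. \<Sum>j | j \<in> I \<and> S i \<inter> S j \<noteq> {}. p ^ card (S i \<union> S j)))"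
proof -
  have "measure_pmf.prob (random_subset E p) {\<omega>. \<forall>i\<in>I. \<not> (\<forall>e\<in>S i. \<omega> e)} =
      measure_pmf.expectation (random_subset E p) (indicator {\<omega>. \<forall>i\<in>I. \<not> (\<forall>e\<in>S i. \<omega> e)})"
    by simp
  also have "\<dots> \<le> measure_pmf.expectation (random_subset E p)
           (\<lambda>\<omega>. \<Prod>i\<in>I. 1 - q * of_bool (\<forall>e\<in>S i. \<omega> e))"
  proof (intro Bochner_Integration.integral_mono integrable_random_subset E)
    fix \<omega>
    have "0 \<le> (\<Prod>i\<in>I. 1 - q * of_bool (\<forall>e\<in>S i. \<omega> e))"
      using q by (intro prod_nonneg) auto
    moreover have "(\<Prod>i\<in>I. 1 - q * of_bool (\<forall>e\<in>S i. \<omega> e)) = 1" if "\<forall>i\<in>I. \<not> (\<forall>e\<in>S i. \<omega> e)"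
      using that by (intro prod.neutral) auto
    ultimately show "indicator {\<omega>. \<forall>i\<in>I. \<not> (\<forall>e\<in>S i. \<omega> e)} \<omega> \<le> (\<Prod>i\<in>I. 1 - q * of_bool (\<forall>e\<in>S i. \<omega> e))"
      by (auto simp: indicator_def)
  qed
  also note janson_thinned[OF E p q I]
  finally show ?thesis .
qed

section \<open>Dense families of bicliques\<close>

text \<open>Vertex tuples are counted with order and repetitions, so that there are exactly n^k of
  them. Distinctness is imposed separately where it matters.\<close>

abbreviation lists_of :: "nat \<Rightarrow> nat \<Rightarrow> nat list set" where
  "lists_of n k \<equiv> {xs. set xs \<subseteq> {..<n} \<and> length xs = k}"

lemma finite_lists_of: "finite (lists_of n k)"
  by (rule finite_lists_length_eq) simp

lemma card_lists_of: "card (lists_of n k) = n ^ k"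
  by (simp add: card_lists_length_eq)

text \<open>Bounding the number of common vertices by the number of positions with an entry in
  \<open>T\<close> turns the sum into a k-fold product: each position contributes n for each of at
  most \<open>card T\<close> entries in \<open>T\<close>, and 1 for each of the at most n others.
  The weight n^i just compensates for the rarity of i common vertices, so the sum exceeds n^k by a
  constant factor only.\<close>

lemma sum_power_card_common_le:
  assumes "finite T"
  shows "(\<Sum>xs\<in>lists_of n k. real n ^ card (T \<inter> set xs)) \<le> ((real (card T) + 1) * real n) ^ k"
proof (cases "n = 0")
  case True
  have "lists_of 0 k = (if k = 0 then {[]} else {})" by auto
  then show ?thesis using True by auto
next
  case False
  show ?thesis
  proof (induction k)
    case 0
    have "lists_of n 0 = {[]}" by auto
    then show ?case by simp
  next
    case (Suc k)
    have card_le: "card (T \<inter> set (x # xs)) \<le> of_bool (x \<in> T) + card (T \<inter> set xs)" for x xs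
      using assms by (auto simp: card_insert_if)
    have "(\<Sum>xs\<in>lists_of n (Suc k). real n ^ card (T \<inter> set xs)) =
        (\<Sum>xs\<in>lists_of n k. \<Sum>x<n. real n ^ card (T \<inter> set (x # xs)))"
    proof -
      have "inj_on (\<lambda>(xs, x). x # xs) (lists_of n k \<times> {..<n})"
        by (auto simp: inj_on_def)
      then show ?thesis
        unfolding lists_length_Suc_eq sum.cartesian_product
        by (subst sum.reindex) (auto simp: case_prod_unfold comp_def simp del: set_simps intro!: sum.cong)
    qed
    also have "\<dots> \<le> (\<Sum>xs\<in>lists_of n k. \<Sum>x<n. real n ^ of_bool (x \<in> T) * real n ^ card (T \<inter> set xs))"
      unfolding power_add[symmetric] using False card_le by (intro sum_mono power_increasing) auto
    also have "\<dots> = (\<Sum>x<n. real n ^ of_bool (x \<in> T)) * (\<Sum>xs\<in>lists_of n k. real n ^ card (T \<inter> set xs))"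
      by (simp add: sum_distrib_left sum_distrib_right)
    also have "\<dots> \<le> ((real (card T) + 1) * real n) * ((real (card T) + 1) * real n) ^ k"
    proof (intro mult_mono Suc.IH sum_nonneg)
      have "(\<Sum>x<n. real n ^ of_bool (x \<in> T)) \<le> (\<Sum>x<n. real n * of_bool (x \<in> T) + 1)"
        by (intro sum_mono) auto
      also have "\<dots> = real n * real (card ({..<n} \<inter> T)) + real n"
        by (simp add: sum.distrib sum_distrib_left[symmetric] Int_def)
      also have "\<dots> \<le> real n * real (card T) + real n"
        using assms by (intro add_mono mult_left_mono) (auto intro!: card_mono)
      finally show "(\<Sum>x<n. real n ^ of_bool (x \<in> T)) \<le> (real (card T) + 1) * real n"
        by (simp add: algebra_simps)
    qed auto
    finally show ?case by simp
  qed
qed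

text \<open>Equivalently, (i+j-1)/(ij) is smallest at i = j = h. Hence no proper sub-biclique of
  K_{h,h} is a bottleneck, and the full copy determines the exponent of the threshold.\<close>

lemma biclique_exponent_le:
  fixes i j h :: nat
  assumes "1 \<le> i" "i \<le> h" "1 \<le> j" "j \<le> h"
  shows "i * j * (2 * h - 1) \<le> (i + j - 1) * h\<^sup>2"
proof -
  \<comment> \<open>In terms of the deficits \<open>u\<close> and \<open>v\<close> the right side
    minus the left side is h(h-1)(u+v) - (2h-1)uv, and both deficits are at most h-1.\<close>
  obtain u v where u: "h = i + u" and v: "h = j + v"
    using assms le_Suc_ex by metis
  have "int i * int j * (2 * int h - 1) \<le> (int i + int j - 1) * (int h)\<^sup>2"
  proof -
    have i: "int i = int h - int u" and j: "int j = int h - int v"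
      using u v by simp_all
    have "int u * int v \<le> int u * (int h - 1)" "int u * int v \<le> (int h - 1) * int v"
      using u v assms by (auto intro!: mult_left_mono mult_right_mono)
    then have "int h * (int u * int v) \<le> int h * (int u * (int h - 1))"
      "(int h - 1) * (int u * int v) \<le> int h * ((int h - 1) * int v)"
      using assms by (auto intro!: mult_mono)
    then show ?thesis
      unfolding i j by (simp add: algebra_simps power2_eq_square)
  qed
  then have "int (i * j * (2 * h - 1)) \<le> int ((i + j - 1) * h\<^sup>2)"
    using assms by (simp add: of_nat_diff)
  then show ?thesis
    by (simp only: of_nat_le_iff)
qed

text \<open>Up to constants this is the expected number of copies of K_{i,j} through a given vertex,
  with i+j-1 further vertices to choose. At the threshold function itself it is at least 1 by
  \<open>biclique_exponent_le\<close>, and C enters with the exponent ij, which is at least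
  1.\<close>

lemma biclique_power_ge:
  fixes i j h n :: nat and C p :: real
  assumes ij: "1 \<le> i" "i \<le> h" "1 \<le> j" "j \<le> h" and n: "n \<ge> 1" and C: "C \<ge> 1"
    and p: "p \<ge> C * real n powr (- (2 * real h - 1) / (real h)\<^sup>2)"
  shows "C \<le> p ^ (i * j) * real n ^ (i + j - 1)"
proof -
  define t where "t = real n powr (- (2 * real h - 1) / (real h)\<^sup>2)"
  have "real (i * j * (2 * h - 1)) \<le> real ((i + j - 1) * h\<^sup>2)"
    using biclique_exponent_le[OF ij] by (simp only: of_nat_le_iff)
  then have exponent: "real (i * j) * ((2 * real h - 1) / (real h)\<^sup>2) \<le> real (i + j - 1)"
    using ij by (simp add: field_simps of_nat_diff)
  have t: "1 \<le> t ^ (i * j) * real n ^ (i + j - 1)"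
  proof -
    have "t ^ (i * j) = real n powr (- (real (i * j) * ((2 * real h - 1) / (real h)\<^sup>2)))"
    proof -
      have "t ^ (i * j) = t powr real (i * j)"
        using n by (intro powr_realpow[symmetric]) (simp add: t_def)
      also have "\<dots> = real n powr ((- (2 * real h - 1) / (real h)\<^sup>2) * real (i * j))"
        unfolding t_def by (rule powr_powr)
      also have "(- (2 * real h - 1) / (real h)\<^sup>2) * real (i * j) =
          - (real (i * j) * ((2 * real h - 1) / (real h)\<^sup>2))"
        by (simp only: minus_divide_left[symmetric] mult_minus_left mult.commute)
      finally show ?thesis .
    qed
    moreover have "real n ^ (i + j - 1) = real n powr real (i + j - 1)"
      using n by (intro powr_realpow[symmetric]) simp
    ultimately have "t ^ (i * j) * real n ^ (i + j - 1) =
        real n powr (- (real (i * j) * ((2 * real h - 1) / (real h)\<^sup>2)) + real (i + j - 1))"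
      by (simp only: powr_add)
    also have "\<dots> \<ge> 1"
      using n exponent by (intro ge_one_powr_ge_zero) auto
    finally show ?thesis .
  qed
  have "C \<le> C ^ (i * j)"
    using C ij by (intro self_le_power) auto
  also have "\<dots> \<le> C ^ (i * j) * (t ^ (i * j) * real n ^ (i + j - 1))"
    using t C by (simp add: mult_le_cancel_left1)
  also have "\<dots> = (C * t) ^ (i * j) * real n ^ (i + j - 1)"
    by (simp add: power_mult_distrib)
  also have "\<dots> \<le> p ^ (i * j) * real n ^ (i + j - 1)"
    using p C by (intro mult_right_mono power_mono) (auto simp: t_def)
  finally show ?thesis .
qed

definition cross_pairs :: "nat list \<times> nat list \<Rightarrow> ((nat + nat) \<times> (nat + nat)) set" where
  "cross_pairs T = (Inl ` set (fst T)) \<times> (Inr ` set (snd T))"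

text \<open>In Janson's inequality q = 2Kn/\<open>\<mu>\<close> makes the linear term -2Kn, so
  \<open>\<Delta>\<close> must be at most \<open>\<mu>\<close> squared divided by 4Kn. Two members
  with i and j common vertices gain a factor p^(-ij) over independence, at most n^(i+j-1)/C by
  \<open>biclique_power_ge\<close>, while such pairs are rarer by a factor of order n^(-i-j). Thus
  \<open>\<Delta>\<close> is smaller than the square of \<open>\<mu>\<close> by a factor of order
  Cn. The bound on \<open>\<beta> * C\<close> gives q \<le> 1, the last bound on C gives the right
  constant.\<close>

lemma prob_no_member_of_dense_family:
  fixes h n :: nat and \<beta> K C p :: real
  assumes h: "h \<ge> 1" and \<beta>: "\<beta> > 0" and K: "K > 0"
    and C: "C \<ge> 1" "\<beta> * C \<ge> 2 * K" "\<beta>\<^sup>2 * C \<ge> 4 * K * (real h + 1) ^ (2 * h)"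
    and n: "n \<ge> 1" and p: "p \<ge> C * real n powr (- (2 * real h - 1) / (real h)\<^sup>2)" "p \<le> 1"
    and \<F>: "\<F> \<subseteq> {(as, bs). as \<in> lists_of n h \<and> bs \<in> lists_of n h \<and> distinct as \<and> distinct bs}"
      "real (card \<F>) \<ge> \<beta> * real n ^ (2 * h)"
  shows "measure_pmf.prob (random_subset (part_A n \<times> part_B n) p)
           {\<omega>. \<forall>T\<in>\<F>. \<not> (\<forall>e\<in>cross_pairs T. \<omega> e)} \<le> exp (- K * real n)"
proof -
  let ?E = "part_A n \<times> part_B n" and ?L = "lists_of n h"
  have finE: "finite ?E"
    by (simp add: part_A_def part_B_def)
  have \<F>_sub: "\<F> \<subseteq> ?L \<times> ?L"
    using \<F>(1) by auto
  have fin\<F>: "finite \<F>"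
    by (rule finite_subset[OF \<F>_sub]) (intro finite_cartesian_product finite_lists_of)
  have p0: "0 < p"
    using C n by (intro less_le_trans[OF _ p(1)] mult_pos_pos) auto
  define \<mu> where "\<mu> = (\<Sum>T\<in>\<F>. p ^ card (cross_pairs T))"
  define \<Delta> where "\<Delta> = (\<Sum>T\<in>\<F>. \<Sum>T' | T' \<in> \<F> \<and> cross_pairs T \<inter> cross_pairs T' \<noteq> {}.
      p ^ card (cross_pairs T \<union> cross_pairs T'))"
  have card_cross: "card (cross_pairs T) = h\<^sup>2" if "T \<in> \<F>" for T
    using that \<F>(1) unfolding cross_pairs_def
    by (auto simp: card_cartesian_product card_image distinct_card power2_eq_square)
  have \<mu>: "\<mu> = real (card \<F>) * p ^ h\<^sup>2"
    unfolding \<mu>_def using card_cross by simp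
  \<comment> \<open>The bound is given weights that factorise over the two parts, so that each part
    can be summed by \<open>sum_power_card_common_le\<close>.\<close>
  have pair_term: "p ^ card (cross_pairs T \<union> cross_pairs T') * (C * real n) \<le>
      p ^ (2 * h\<^sup>2) * (real n ^ card (set (fst T) \<inter> set (fst T')) * real n ^ card (set (snd T) \<inter> set (snd T')))"
    if T: "T \<in> \<F>" "T' \<in> \<F>" "cross_pairs T \<inter> cross_pairs T' \<noteq> {}" for T T'
  proof -
    define i where "i = card (set (fst T) \<inter> set (fst T'))"
    define j where "j = card (set (snd T) \<inter> set (snd T'))"
    have len: "length (fst T) = h" "length (snd T) = h"
      using T(1) \<F>_sub by auto
    have Int: "cross_pairs T \<inter> cross_pairs T' =
        (Inl ` (set (fst T) \<inter> set (fst T'))) \<times> (Inr ` (set (snd T) \<inter> set (snd T')))"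
      unfolding cross_pairs_def by auto
    then have cardI: "card (cross_pairs T \<inter> cross_pairs T') = i * j"
      by (simp add: card_cartesian_product card_image i_def j_def)
    have "set (fst T) \<inter> set (fst T') \<noteq> {}" "set (snd T) \<inter> set (snd T') \<noteq> {}"
      using T(3) Int by auto
    then have "i \<noteq> 0" "j \<noteq> 0"
      by (auto simp: i_def j_def)
    have "i \<le> card (set (fst T))" "j \<le> card (set (snd T))"
      unfolding i_def j_def by (auto intro!: card_mono)
    then have ij: "1 \<le> i" "i \<le> h" "1 \<le> j" "j \<le> h"
      using len card_length[of "fst T"] card_length[of "snd T"] \<open>i \<noteq> 0\<close> \<open>j \<noteq> 0\<close> by auto
    have cardU: "card (cross_pairs T \<union> cross_pairs T') + i * j = 2 * h\<^sup>2"
      using card_Un_Int[of "cross_pairs T" "cross_pairs T'"] card_cross[OF T(1)] card_cross[OF T(2)] cardI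
      by (simp add: cross_pairs_def)
    have "p ^ card (cross_pairs T \<union> cross_pairs T') * (C * real n) \<le>
        p ^ card (cross_pairs T \<union> cross_pairs T') * ((p ^ (i * j) * real n ^ (i + j - 1)) * real n)"
      using biclique_power_ge[OF ij n C(1) p(1)] p0 by (intro mult_left_mono mult_right_mono) auto
    also have "\<dots> = p ^ (card (cross_pairs T \<union> cross_pairs T') + i * j) * (real n ^ (i + j - 1) * real n)"
      by (simp add: power_add)
    also have "real n ^ (i + j - 1) * real n = real n ^ i * real n ^ j"
      using ij by (simp add: power_Suc2[symmetric] power_add[symmetric] del: power_Suc)
    finally have "p ^ card (cross_pairs T \<union> cross_pairs T') * (C * real n) \<le>
        p ^ (2 * h\<^sup>2) * (real n ^ i * real n ^ j)"
      unfolding cardU .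
    then show ?thesis
      unfolding i_def j_def .
  qed
  define Z where "Z = (\<Sum>as\<in>?L. \<Sum>as'\<in>?L. real n ^ card (set as \<inter> set as'))"
  have Z: "Z \<le> real n ^ h * ((real h + 1) * real n) ^ h"
  proof -
    have "Z \<le> (\<Sum>as\<in>?L. ((real h + 1) * real n) ^ h)"
      unfolding Z_def
    proof (intro sum_mono)
      fix as assume as: "as \<in> ?L"
      have "(\<Sum>as'\<in>?L. real n ^ card (set as \<inter> set as')) \<le> ((real (card (set as)) + 1) * real n) ^ h"
        by (rule sum_power_card_common_le) simp
      also have "\<dots> \<le> ((real h + 1) * real n) ^ h"
        using as card_length[of as] by (intro power_mono mult_right_mono) auto
      finally show "(\<Sum>as'\<in>?L. real n ^ card (set as \<inter> set as')) \<le> ((real h + 1) * real n) ^ h" .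
    qed
    also have "\<dots> = real n ^ h * ((real h + 1) * real n) ^ h"
      by (simp add: card_lists_of)
    finally show ?thesis .
  qed
  have Z0: "0 \<le> Z"
    unfolding Z_def by (intro sum_nonneg) auto
  have "\<Delta> * (C * real n) = (\<Sum>T\<in>\<F>. \<Sum>T' | T' \<in> \<F> \<and> cross_pairs T \<inter> cross_pairs T' \<noteq> {}.
      p ^ card (cross_pairs T \<union> cross_pairs T') * (C * real n))"
    unfolding \<Delta>_def by (simp add: sum_distrib_right)
  also have "\<dots> \<le> (\<Sum>T\<in>\<F>. \<Sum>T' | T' \<in> \<F> \<and> cross_pairs T \<inter> cross_pairs T' \<noteq> {}.
      p ^ (2 * h\<^sup>2) * (real n ^ card (set (fst T) \<inter> set (fst T')) * real n ^ card (set (snd T) \<inter> set (snd T'))))"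
    by (intro sum_mono) (use pair_term in auto)
  \<comment> \<open>All terms are nonnegative, so the sum may be extended to all pairs of tuples,
    where it splits into the square of the one-sided sum \<open>Z\<close>.\<close>
  also have "\<dots> \<le> (\<Sum>T\<in>?L \<times> ?L. \<Sum>T'\<in>?L \<times> ?L.
      p ^ (2 * h\<^sup>2) * (real n ^ card (set (fst T) \<inter> set (fst T')) * real n ^ card (set (snd T) \<inter> set (snd T'))))"
  proof -
    have fin: "finite (?L \<times> ?L)"
      by (intro finite_cartesian_product finite_lists_of)
    show ?thesis
      by (rule order_trans[OF sum_mono[OF sum_mono2[OF fin]] sum_mono2[OF fin \<F>_sub]])
         (use \<F>_sub p0 in \<open>auto intro!: sum_nonneg\<close>)
  qed
  also have "\<dots> = p ^ (2 * h\<^sup>2) * Z\<^sup>2"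
  proof -
    have "Z\<^sup>2 = (\<Sum>as\<in>?L. \<Sum>bs\<in>?L. (\<Sum>as'\<in>?L. real n ^ card (set as \<inter> set as')) *
        (\<Sum>bs'\<in>?L. real n ^ card (set bs \<inter> set bs')))"
      unfolding Z_def power2_eq_square by (rule sum_product)
    also have "\<dots> = (\<Sum>as\<in>?L. \<Sum>bs\<in>?L. \<Sum>as'\<in>?L. \<Sum>bs'\<in>?L.
        real n ^ card (set as \<inter> set as') * real n ^ card (set bs \<inter> set bs'))"
      by (simp only: sum_product)
    finally show ?thesis
      by (simp only: sum.cartesian_product' sum_distrib_left fst_conv snd_conv)
  qed
  also have "\<dots> \<le> p ^ (2 * h\<^sup>2) * (real n ^ h * ((real h + 1) * real n) ^ h)\<^sup>2"
    using Z Z0 p0 by (intro mult_left_mono power_mono) auto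
  also have "\<dots> = (real h + 1) ^ (2 * h) * (real n ^ (2 * h) * p ^ h\<^sup>2)\<^sup>2"
  proof -
    have "p ^ (2 * h\<^sup>2) = (p ^ h\<^sup>2)\<^sup>2" "(real h + 1) ^ (2 * h) = ((real h + 1) ^ h)\<^sup>2"
      by (simp_all only: power_mult[symmetric] mult.commute)
    moreover have "real n ^ (2 * h) = real n ^ h * real n ^ h"
      by (simp only: mult_2 power_add)
    ultimately show ?thesis
      by (simp only: power_mult_distrib mult.assoc mult.left_commute mult.commute power2_eq_square)
  qed
  finally have \<Delta>1: "\<Delta> * (C * real n) \<le> (real h + 1) ^ (2 * h) * (real n ^ (2 * h) * p ^ h\<^sup>2)\<^sup>2" .
  have \<mu>1: "\<beta> * (real n ^ (2 * h) * p ^ h\<^sup>2) \<le> \<mu>"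
    unfolding \<mu> using \<F>(2) p0 by (simp add: mult.assoc[symmetric])
  have \<mu>2: "\<beta> * C * real n \<le> \<mu>"
  proof -
    have "C \<le> p ^ (h * h) * real n ^ (h + h - 1)"
      using h by (intro biclique_power_ge[OF _ _ _ _ n C(1) p(1)]) auto
    then have "C * real n \<le> p ^ (h * h) * (real n ^ (h + h - 1) * real n)"
      using n by (simp add: mult.assoc[symmetric])
    also have "real n ^ (h + h - 1) * real n = real n ^ (2 * h)"
      using h by (simp add: power_Suc2[symmetric] mult_2 del: power_Suc)
    finally have "\<beta> * (C * real n) \<le> \<beta> * (real n ^ (2 * h) * p ^ h\<^sup>2)"
      using \<beta> by (intro mult_left_mono) (auto simp: power2_eq_square mult.commute)
    then show ?thesis
      using \<mu>1 by (simp add: mult.assoc)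
  qed
  have \<mu>0: "0 < \<mu>"
    using \<mu>2 \<beta> C n by (smt (verit) mult_pos_pos of_nat_0_less_iff zero_less_one_class.zero_less_one less_le_trans)
  define q where "q = 2 * K * real n / \<mu>"
  have q: "0 \<le> q" "q \<le> 1"
  proof -
    show "0 \<le> q" using K \<mu>0 by (simp add: q_def)
    have "2 * K * real n \<le> \<beta> * C * real n"
      using C by (intro mult_right_mono) auto
    then show "q \<le> 1" using \<mu>2 \<mu>0 by (simp add: q_def field_simps)
  qed
  have q\<mu>: "q * \<mu> = 2 * K * real n"
    using \<mu>0 by (simp add: q_def)
  have q\<Delta>: "q\<^sup>2 * \<Delta> \<le> K * real n"
  proof -
    define Y where "Y = real n ^ (2 * h) * p ^ h\<^sup>2"
    define D where "D = (real h + 1) ^ (2 * h)"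
    have "0 \<le> Y" using p0 by (simp add: Y_def)
    have "4 * K * (\<Delta> * (C * real n)) * \<beta>\<^sup>2 \<le> 4 * K * (D * Y\<^sup>2) * \<beta>\<^sup>2"
      using \<Delta>1 K by (intro mult_right_mono mult_left_mono) (auto simp: Y_def D_def)
    also have "\<dots> = (4 * K * D) * (\<beta> * Y)\<^sup>2"
      by (simp add: power2_eq_square)
    also have "\<dots> \<le> (\<beta>\<^sup>2 * C) * \<mu>\<^sup>2"
      using C(3) \<mu>1 \<open>0 \<le> Y\<close> \<beta> K C(1)
      by (intro mult_mono[of "4 * K * D" "\<beta>\<^sup>2 * C"] power_mono) (auto simp: Y_def D_def)
    finally have "(\<beta>\<^sup>2 * C) * (4 * K * \<Delta> * real n) \<le> (\<beta>\<^sup>2 * C) * \<mu>\<^sup>2"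
      by (simp add: algebra_simps)
    then have "4 * K * \<Delta> * real n \<le> \<mu>\<^sup>2"
      using \<beta> C(1) by (simp add: mult_le_cancel_left)
    then have "(4 * K * \<Delta> * real n) * (K * real n) \<le> \<mu>\<^sup>2 * (K * real n)"
      using K by (intro mult_right_mono) auto
    then have "4 * K\<^sup>2 * (real n)\<^sup>2 * \<Delta> / \<mu>\<^sup>2 \<le> K * real n"
      using \<mu>0 by (simp add: field_simps power2_eq_square)
    then show ?thesis
      by (simp add: q_def power_divide power_mult_distrib)
  qed
  have "measure_pmf.prob (random_subset ?E p) {\<omega>. \<forall>T\<in>\<F>. \<not> (\<forall>e\<in>cross_pairs T. \<omega> e)} \<le>
      exp (- q * \<mu> + q\<^sup>2 * \<Delta>)"
    unfolding \<mu>_def \<Delta>_def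
  proof (rule janson_inequality[OF finE _ p(2) q fin\<F>])
    fix T assume "T \<in> \<F>"
    then show "cross_pairs T \<subseteq> ?E"
      using \<F>_sub unfolding cross_pairs_def part_A_def part_B_def by fastforce
  qed (use p0 in auto)
  also have "\<dots> \<le> exp (- K * real n)"
    using q\<mu> q\<Delta> by simp
  finally show ?thesis .
qed

section \<open>Absorption and greedy covering\<close>

text \<open>Lists instead of sets, because positions are prescribed in \<open>rich\<close> and the
  head is the vertex that gets exchanged. Both parts are indexed by the same numbers, so exchanging
  the parts means flipping the relation and swapping the pair.\<close>

definition biclique :: "nat \<Rightarrow> nat \<Rightarrow> (nat \<Rightarrow> nat \<Rightarrow> bool) \<Rightarrow> nat list \<times> nat list \<Rightarrow> bool" where
  "biclique n h E T \<longleftrightarrow> fst T \<in> lists_of n h \<and> snd T \<in> lists_of n h \<and>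
     distinct (fst T) \<and> distinct (snd T) \<and> (\<forall>a\<in>set (fst T). \<forall>b\<in>set (snd T). E a b)"

text \<open>
  Only covering is required: if \<open>k h \<le> n\<close>, then bicliques covering all \<open>n\<close> vertices of each part are
  automatically disjoint, by counting.
\<close>

definition coverable :: "nat \<Rightarrow> nat \<Rightarrow> (nat \<Rightarrow> nat \<Rightarrow> bool) \<Rightarrow> nat \<Rightarrow> nat set \<Rightarrow> nat set \<Rightarrow> bool" where
  "coverable n h E k A B \<longleftrightarrow> (\<exists>Ts. length Ts \<le> k \<and> (\<forall>T\<in>set Ts. biclique n h E T) \<and>
     A \<subseteq> (\<Union>T\<in>set Ts. set (fst T)) \<and> B \<subseteq> (\<Union>T\<in>set Ts. set (snd T)))"

lemma biclique_swap: "biclique n h E T \<Longrightarrow> biclique n h (\<lambda>a b. E b a) (prod.swap T)"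
  unfolding biclique_def by auto

lemma biclique_mono: "biclique n h E T \<Longrightarrow> (\<And>a b. E a b \<Longrightarrow> E' a b) \<Longrightarrow> biclique n h E' T"
  unfolding biclique_def by blast

lemma biclique_card:
  assumes "biclique n h E T"
  shows "card (set (fst T)) = h" "card (set (snd T)) = h"
  using assms unfolding biclique_def by (auto simp: distinct_card)

lemma biclique_subset:
  assumes "biclique n h E T"
  shows "set (fst T) \<subseteq> {..<n}" "set (snd T) \<subseteq> {..<n}"
  using assms unfolding biclique_def by auto

lemma biclique_replace_hd:
  assumes "biclique n h r (a # as, bs)" "v < n" "v \<notin> set as" "\<forall>b\<in>set bs. g v b"
  shows "biclique n h (\<lambda>a b. g a b \<or> r a b) (v # as, bs)"
  using assms unfolding biclique_def by auto

lemma coverable_union: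
  assumes "coverable n h E k A B" "coverable n h E k' A' B'"
  shows "coverable n h E (k + k') (A \<union> A') (B \<union> B')"
proof -
  obtain Ts where "length Ts \<le> k" "\<forall>T\<in>set Ts. biclique n h E T"
    "A \<subseteq> (\<Union>T\<in>set Ts. set (fst T))" "B \<subseteq> (\<Union>T\<in>set Ts. set (snd T))"
    using assms(1) unfolding coverable_def by auto
  moreover obtain Ts' where "length Ts' \<le> k'" "\<forall>T\<in>set Ts'. biclique n h E T"
    "A' \<subseteq> (\<Union>T\<in>set Ts'. set (fst T))" "B' \<subseteq> (\<Union>T\<in>set Ts'. set (snd T))"
    using assms(2) unfolding coverable_def by auto
  ultimately show ?thesis
    unfolding coverable_def by (intro exI[of _ "Ts @ Ts'"]) auto
qed

lemma coverable_mono: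
  assumes "coverable n h E k A B" "k \<le> k'" "A' \<subseteq> A" "B' \<subseteq> B" "\<And>a b. E a b \<Longrightarrow> E' a b"
  shows "coverable n h E' k' A' B'"
proof -
  obtain Ts where "length Ts \<le> k" "\<forall>T\<in>set Ts. biclique n h E T"
    "A \<subseteq> (\<Union>T\<in>set Ts. set (fst T))" "B \<subseteq> (\<Union>T\<in>set Ts. set (snd T))"
    using assms(1) unfolding coverable_def by auto
  with assms(2-) show ?thesis
    unfolding coverable_def by (intro exI[of _ Ts]) (auto intro: biclique_mono)
qed

lemma coverable_empty [simp]: "coverable n h E k {} {}"
  unfolding coverable_def by (intro exI[of _ "[]"]) auto

lemma coverable_biclique: "biclique n h E T \<Longrightarrow> coverable n h E 1 (set (fst T)) (set (snd T))"
  unfolding coverable_def by (intro exI[of _ "[T]"]) auto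

lemma coverable_family:
  assumes "finite I" "\<And>i. i \<in> I \<Longrightarrow> biclique n h E (T i)"
  shows "coverable n h E (card I) (\<Union>i\<in>I. set (fst (T i))) (\<Union>i\<in>I. set (snd (T i)))"
  using assms
proof (induction I)
  case (insert i I)
  have "coverable n h E (1 + card I) (set (fst (T i)) \<union> (\<Union>i\<in>I. set (fst (T i))))
      (set (snd (T i)) \<union> (\<Union>i\<in>I. set (snd (T i))))"
    using insert by (intro coverable_union coverable_biclique) auto
  then show ?case
    using insert by simp
qed simp

lemma coverable_swap:
  assumes "coverable n h E k A B"
  shows "coverable n h (\<lambda>a b. E b a) k B A"
proof -
  obtain Ts where Ts: "length Ts \<le> k" "\<forall>T\<in>set Ts. biclique n h E T"
    "A \<subseteq> (\<Union>T\<in>set Ts. set (fst T))" "B \<subseteq> (\<Union>T\<in>set Ts. set (snd T))"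
    using assms unfolding coverable_def by auto
  have "\<forall>T\<in>set Ts. biclique n h (\<lambda>a b. E b a) (prod.swap T)"
    using Ts(2) biclique_swap by blast
  then have "\<forall>T\<in>set (map prod.swap Ts). biclique n h (\<lambda>a b. E b a) T"
    by simp
  moreover have "B \<subseteq> (\<Union>T\<in>set (map prod.swap Ts). set (fst T))"
    "A \<subseteq> (\<Union>T\<in>set (map prod.swap Ts). set (snd T))"
    using Ts(3,4) by auto
  ultimately show ?thesis
    unfolding coverable_def using Ts(1)
    by (intro exI[where x = "map prod.swap Ts"] conjI) (simp_all only: length_map)
qed

text \<open>Each position has a target set of its own. Equal sets suffice for greedy covering, but
  in the absorption every leftover vertex brings its own set of candidates. Only the values of
  \<open>X\<close> and \<open>Y\<close> below h matter.\<close>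

definition rich :: "nat \<Rightarrow> nat \<Rightarrow> (nat \<Rightarrow> nat \<Rightarrow> bool) \<Rightarrow> real \<Rightarrow> bool" where
  "rich n h r \<epsilon> \<longleftrightarrow> (\<forall>X Y. (\<forall>l<h. X l \<subseteq> {..<n} \<and> Y l \<subseteq> {..<n} \<and>
       \<epsilon> * real n \<le> real (card (X l)) \<and> \<epsilon> * real n \<le> real (card (Y l))) \<longrightarrow>
     (\<exists>T. biclique n h r T \<and> (\<forall>l<h. fst T ! l \<in> X l \<and> snd T ! l \<in> Y l)))"

lemma richE:
  assumes "rich n h r \<epsilon>"
    and "\<And>l. l < h \<Longrightarrow> X l \<subseteq> {..<n}" "\<And>l. l < h \<Longrightarrow> Y l \<subseteq> {..<n}"
    and "\<And>l. l < h \<Longrightarrow> \<epsilon> * real n \<le> real (card (X l))"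
    and "\<And>l. l < h \<Longrightarrow> \<epsilon> * real n \<le> real (card (Y l))"
  obtains T where "biclique n h r T" "\<And>l. l < h \<Longrightarrow> fst T ! l \<in> X l" "\<And>l. l < h \<Longrightarrow> snd T ! l \<in> Y l"
proof -
  have "\<exists>T. biclique n h r T \<and> (\<forall>l<h. fst T ! l \<in> X l \<and> snd T ! l \<in> Y l)"
    by (rule assms(1)[unfolded rich_def, rule_format]) (use assms(2-) in blast)
  then show ?thesis
    using that by blast
qed

lemma rich_swap:
  assumes "rich n h r \<epsilon>"
  shows "rich n h (\<lambda>a b. r b a) \<epsilon>"
  unfolding rich_def
proof (intro allI impI)
  fix X Y :: "nat \<Rightarrow> nat set"
  assume *: "\<forall>l<h. X l \<subseteq> {..<n} \<and> Y l \<subseteq> {..<n} \<and>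
       \<epsilon> * real n \<le> real (card (X l)) \<and> \<epsilon> * real n \<le> real (card (Y l))"
  obtain T where T: "biclique n h r T" "\<And>l. l < h \<Longrightarrow> fst T ! l \<in> Y l" "\<And>l. l < h \<Longrightarrow> snd T ! l \<in> X l"
    by (rule richE[OF assms, of Y X]) (use * in auto)
  then show "\<exists>T. biclique n h (\<lambda>a b. r b a) T \<and> (\<forall>l<h. fst T ! l \<in> X l \<and> snd T ! l \<in> Y l)"
    using biclique_swap[of n h r T] by (intro exI[of _ "prod.swap T"]) auto
qed

text \<open>
  The vertices counted here are those that can replace the first vertex of \<open>T\<close>.
\<close>

definition popular_rich ::
    "nat \<Rightarrow> nat \<Rightarrow> (nat \<Rightarrow> nat \<Rightarrow> bool) \<Rightarrow> (nat \<Rightarrow> nat \<Rightarrow> bool) \<Rightarrow> real \<Rightarrow> real \<Rightarrow> real \<Rightarrow> bool" where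
  "popular_rich n h g r \<alpha> \<eta> \<kappa> \<longleftrightarrow> (\<forall>A B W. A \<subseteq> {..<n} \<and> B \<subseteq> {..<n} \<and> W \<subseteq> {..<n} \<and>
       real n / 2 \<le> real (card A) \<and> (1 - \<alpha> / 2) * real n \<le> real (card B) \<and> \<eta> * real n \<le> real (card W) \<longrightarrow>
     (\<exists>T. biclique n h r T \<and> set (fst T) \<subseteq> A \<and> set (snd T) \<subseteq> B \<and>
        \<kappa> * real n \<le> real (card {w\<in>W. \<forall>b\<in>set (snd T). g w b})))"

text \<open>The vertex \<open>hd (fst T)\<close>, respectively \<open>hd (snd T)\<close>, plays the role of \<open>x\<^sub>T\<close>.\<close>

lemma absorb:
  assumes h: "h \<ge> 1" and rich: "rich n h r \<epsilon>"
    and "finite \<A>" "finite \<B>" "\<And>T. T \<in> \<A> \<union> \<B> \<Longrightarrow> biclique n h r T"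
    and "inj_on (hd \<circ> fst) \<A>" "inj_on (hd \<circ> snd) \<B>"
    and "L \<subseteq> {..<n}" "M \<subseteq> {..<n}" "card L = h * k" "card M = h * k"
    and "\<And>v T. v \<in> L \<Longrightarrow> T \<in> \<A> \<Longrightarrow> v \<notin> set (fst T)"
    and "\<And>u T. u \<in> M \<Longrightarrow> T \<in> \<B> \<Longrightarrow> u \<notin> set (snd T)"
    and "\<And>v. v \<in> L \<Longrightarrow> \<epsilon> * real n + real (h * k) \<le> real (card {T\<in>\<A>. \<forall>b\<in>set (snd T). g v b})"
    and "\<And>u. u \<in> M \<Longrightarrow> \<epsilon> * real n + real (h * k) \<le> real (card {T\<in>\<B>. \<forall>a\<in>set (fst T). g a u})"
  shows "coverable n h (\<lambda>a b. g a b \<or> r a b) (card \<A> + card \<B> + k)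
           (L \<union> (\<Union>T\<in>\<A> \<union> \<B>. set (fst T))) (M \<union> (\<Union>T\<in>\<A> \<union> \<B>. set (snd T)))"
  using assms(3-)
\<comment> \<open>Each round settles h leftover vertices in each part and retires h bicliques from
  each family. The summand h k in the degree hypotheses pays for this, since a vertex loses at most
  h of its bicliques per round.\<close>
proof (induction k arbitrary: \<A> \<B> L M)
  case 0
  have LM: "L = {}" "M = {}"
    using 0 finite_subset[OF _ finite_lessThan] by auto
  have "coverable n h r (card (\<A> \<union> \<B>)) (\<Union>T\<in>\<A> \<union> \<B>. set (fst T)) (\<Union>T\<in>\<A> \<union> \<B>. set (snd T))"
    using 0 by (intro coverable_family) auto
  then show ?case
    unfolding LM by (rule coverable_mono) (auto simp: card_Un_le)
next
  case (Suc k)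
  let ?E = "\<lambda>a b. g a b \<or> r a b"
  have finLM: "finite L" "finite M"
    using Suc.prems finite_subset[OF _ finite_lessThan] by auto
  have hk: "h \<le> h * Suc k" by simp
  obtain V where V: "V \<subseteq> L" "card V = h" "finite V"
    using obtain_subset_with_card_n[of h L] Suc.prems(8) hk by metis
  obtain vs where vs: "set vs = V" "distinct vs" "length vs = h"
    using V finite_distinct_list[of V] distinct_card by metis
  obtain U where U: "U \<subseteq> M" "card U = h" "finite U"
    using obtain_subset_with_card_n[of h M] Suc.prems(9) hk by metis
  obtain us where us: "set us = U" "distinct us" "length us = h"
    using U finite_distinct_list[of U] distinct_card by metis
  have vsL: "vs ! l \<in> L" "us ! l \<in> M" if "l < h" for l
    using that V U vs us nth_mem[of l vs] nth_mem[of l us] by auto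
  define AA where "AA v = {T\<in>\<A>. \<forall>b\<in>set (snd T). g v b}" for v
  define BB where "BB u = {T\<in>\<B>. \<forall>a\<in>set (fst T). g a u}" for u
  have ne: "fst T \<noteq> []" "snd T \<noteq> []" if "T \<in> \<A> \<union> \<B>" for T
    using Suc.prems(3)[OF that] h by (auto simp: biclique_def)
  have sub: "set (fst T) \<subseteq> {..<n}" "set (snd T) \<subseteq> {..<n}" if "T \<in> \<A> \<union> \<B>" for T
    using Suc.prems(3)[OF that] by (auto simp: biclique_def)
  have hd_less: "hd (fst T) < n" "hd (snd T) < n" if "T \<in> \<A> \<union> \<B>" for T
    using sub[OF that] ne[OF that] hd_in_set by blast+
  \<comment> \<open>Position l of \<open>T0\<close> has to be the head of a biclique in which
    \<open>vs ! l\<close>, respectively \<open>us ! l\<close>, can take over that head.\<close>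
  obtain T0 where T0: "biclique n h r T0"
    "\<And>l. l < h \<Longrightarrow> fst T0 ! l \<in> (hd \<circ> fst) ` AA (vs ! l)"
    "\<And>l. l < h \<Longrightarrow> snd T0 ! l \<in> (hd \<circ> snd) ` BB (us ! l)"
  proof (rule richE[OF rich, of "\<lambda>l. (hd \<circ> fst) ` AA (vs ! l)" "\<lambda>l. (hd \<circ> snd) ` BB (us ! l)"])
    fix l assume l: "l < h"
    show "(hd \<circ> fst) ` AA (vs ! l) \<subseteq> {..<n}" "(hd \<circ> snd) ` BB (us ! l) \<subseteq> {..<n}"
      using hd_less by (auto simp: AA_def BB_def)
    have "card ((hd \<circ> fst) ` AA (vs ! l)) = card (AA (vs ! l))"
      by (intro card_image inj_on_subset[OF Suc.prems(4)]) (simp add: AA_def)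
    then show "\<epsilon> * real n \<le> real (card ((hd \<circ> fst) ` AA (vs ! l)))"
      using Suc.prems(12)[OF vsL(1)[OF l]] of_nat_0_le_iff[of "h * Suc k"]
      unfolding AA_def by linarith
    have "card ((hd \<circ> snd) ` BB (us ! l)) = card (BB (us ! l))"
      by (intro card_image inj_on_subset[OF Suc.prems(5)]) (simp add: BB_def)
    then show "\<epsilon> * real n \<le> real (card ((hd \<circ> snd) ` BB (us ! l)))"
      using Suc.prems(13)[OF vsL(2)[OF l]] of_nat_0_le_iff[of "h * Suc k"]
      unfolding BB_def by linarith
  qed (rule that)
  have "\<exists>T. T \<in> AA (vs ! l) \<and> fst T0 ! l = hd (fst T)" if "l < h" for l
    using T0(2)[OF that] by (auto simp del: split_paired_Ex)
  then obtain TA where TA: "\<And>l. l < h \<Longrightarrow> TA l \<in> AA (vs ! l)" "\<And>l. l < h \<Longrightarrow> fst T0 ! l = hd (fst (TA l))"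
    by metis
  have "\<exists>T. T \<in> BB (us ! l) \<and> snd T0 ! l = hd (snd T)" if "l < h" for l
    using T0(3)[OF that] by (auto simp del: split_paired_Ex)
  then obtain TB where TB: "\<And>l. l < h \<Longrightarrow> TB l \<in> BB (us ! l)" "\<And>l. l < h \<Longrightarrow> snd T0 ! l = hd (snd (TB l))"
    by metis
  have len0: "length (fst T0) = h" "length (snd T0) = h" "distinct (fst T0)" "distinct (snd T0)"
    using T0(1) by (auto simp: biclique_def)
  \<comment> \<open>Distinct vertices of \<open>T0\<close> are heads of distinct bicliques, so no
    member of \<A> has to take in two vertices of \<open>V\<close>.\<close>
  have injA: "inj_on TA {..<h}"
    using TA(2) len0 by (intro inj_onI) (metis lessThan_iff nth_eq_iff_index_eq)
  have injB: "inj_on TB {..<h}"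
    using TB(2) len0 by (intro inj_onI) (metis lessThan_iff nth_eq_iff_index_eq)
  define \<A>' where "\<A>' = \<A> - TA ` {..<h}"
  define \<B>' where "\<B>' = \<B> - TB ` {..<h}"
  have TA_in: "TA l \<in> \<A>" and TB_in: "TB l \<in> \<B>" if "l < h" for l
    using TA(1)[OF that] TB(1)[OF that] by (auto simp: AA_def BB_def)
  have subA: "TA ` {..<h} \<subseteq> \<A>" and subB: "TB ` {..<h} \<subseteq> \<B>"
    using TA_in TB_in by auto
  have cardA: "card \<A>' + h = card \<A>"
  proof -
    have "card (TA ` {..<h}) = h" using injA by (simp add: card_image)
    then show ?thesis
      unfolding \<A>'_def using subA Suc.prems(1) card_mono[OF Suc.prems(1) subA]
      by (simp add: card_Diff_subset finite_subset)
  qed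
  have cardB: "card \<B>' + h = card \<B>"
  proof -
    have "card (TB ` {..<h}) = h" using injB by (simp add: card_image)
    then show ?thesis
      unfolding \<B>'_def using subB Suc.prems(2) card_mono[OF Suc.prems(2) subB]
      by (simp add: card_Diff_subset finite_subset)
  qed
  have cov1: "coverable n h ?E (card \<A>' + card \<B>' + k)
      ((L - V) \<union> (\<Union>T\<in>\<A>' \<union> \<B>'. set (fst T))) ((M - U) \<union> (\<Union>T\<in>\<A>' \<union> \<B>'. set (snd T)))"
  proof (rule Suc.IH)
    show "inj_on (hd \<circ> fst) \<A>'" "inj_on (hd \<circ> snd) \<B>'"
      unfolding \<A>'_def \<B>'_def
      by (rule inj_on_subset[OF Suc.prems(4)], blast) (rule inj_on_subset[OF Suc.prems(5)], blast)
    show "card (L - V) = h * k" "card (M - U) = h * k"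
      using V U finLM Suc.prems(8,9) by (auto simp: card_Diff_subset)
    show "\<epsilon> * real n + real (h * k) \<le> real (card {T \<in> \<A>'. \<forall>b\<in>set (snd T). g v b})" if "v \<in> L - V" for v
    proof -
      have "AA v \<subseteq> {T \<in> \<A>'. \<forall>b\<in>set (snd T). g v b} \<union> TA ` {..<h}"
        by (auto simp: AA_def \<A>'_def)
      then have "card (AA v) \<le> card ({T \<in> \<A>'. \<forall>b\<in>set (snd T). g v b} \<union> TA ` {..<h})"
        using Suc.prems(1) by (intro card_mono) (auto simp: \<A>'_def)
      also have "\<dots> \<le> card {T \<in> \<A>'. \<forall>b\<in>set (snd T). g v b} + h"
        using injA by (intro order_trans[OF card_Un_le]) (simp add: card_image)
      finally show ?thesis
        using Suc.prems(12)[of v] that by (simp add: AA_def)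
    qed
    show "\<epsilon> * real n + real (h * k) \<le> real (card {T \<in> \<B>'. \<forall>a\<in>set (fst T). g a u})" if "u \<in> M - U" for u
    proof -
      have "BB u \<subseteq> {T \<in> \<B>'. \<forall>a\<in>set (fst T). g a u} \<union> TB ` {..<h}"
        by (auto simp: BB_def \<B>'_def)
      then have "card (BB u) \<le> card ({T \<in> \<B>'. \<forall>a\<in>set (fst T). g a u} \<union> TB ` {..<h})"
        using Suc.prems(2) by (intro card_mono) (auto simp: \<B>'_def)
      also have "\<dots> \<le> card {T \<in> \<B>'. \<forall>a\<in>set (fst T). g a u} + h"
        using injB by (intro order_trans[OF card_Un_le]) (simp add: card_image)
      finally show ?thesis
        using Suc.prems(13)[of u] that by (simp add: BB_def)
    qed
  qed (use Suc.prems(1-3,6,7,10,11) in \<open>auto simp: \<A>'_def \<B>'_def\<close>)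
  have cov2: "coverable n h ?E (card {..<h})
      (\<Union>l\<in>{..<h}. set (fst (vs ! l # tl (fst (TA l)), snd (TA l))))
      (\<Union>l\<in>{..<h}. set (snd (vs ! l # tl (fst (TA l)), snd (TA l))))"
  proof (intro coverable_family finite_lessThan)
    fix l assume "l \<in> {..<h}"
    then have l: "l < h" by simp
    have "biclique n h r (hd (fst (TA l)) # tl (fst (TA l)), snd (TA l))"
      using Suc.prems(3)[of "TA l"] TA_in[OF l] ne(1)[of "TA l"] by simp
    moreover have "vs ! l \<notin> set (tl (fst (TA l)))"
      using Suc.prems(10)[OF vsL(1)[OF l] TA_in[OF l]] ne(1)[of "TA l"] TA_in[OF l]
      by (metis UnI1 list.set_sel(2))
    ultimately show "biclique n h ?E (vs ! l # tl (fst (TA l)), snd (TA l))"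
      using vsL(1)[OF l] Suc.prems(6) TA(1)[OF l] by (intro biclique_replace_hd) (auto simp: AA_def)
  qed
  have cov3: "coverable n h ?E (card {..<h})
      (\<Union>l\<in>{..<h}. set (fst (fst (TB l), us ! l # tl (snd (TB l)))))
      (\<Union>l\<in>{..<h}. set (snd (fst (TB l), us ! l # tl (snd (TB l)))))"
  proof (intro coverable_family finite_lessThan)
    fix l assume "l \<in> {..<h}"
    then have l: "l < h" by simp
    have "biclique n h r (fst (TB l), hd (snd (TB l)) # tl (snd (TB l)))"
      using Suc.prems(3)[of "TB l"] TB_in[OF l] ne(2)[of "TB l"] by simp
    from biclique_swap[OF this]
    have "biclique n h (\<lambda>a b. r b a) (hd (snd (TB l)) # tl (snd (TB l)), fst (TB l))"
      by simp
    moreover have "us ! l \<notin> set (tl (snd (TB l)))"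
      using Suc.prems(11)[OF vsL(2)[OF l] TB_in[OF l]] ne(2)[of "TB l"] TB_in[OF l]
      by (metis UnI2 list.set_sel(2))
    ultimately have "biclique n h (\<lambda>a b. g b a \<or> r b a) (us ! l # tl (snd (TB l)), fst (TB l))"
      using vsL(2)[OF l] Suc.prems(7) TB(1)[OF l]
      by (intro biclique_replace_hd[where r = "\<lambda>a b. r b a" and g = "\<lambda>a b. g b a"]) (auto simp: BB_def)
    from biclique_swap[OF this] show "biclique n h ?E (fst (TB l), us ! l # tl (snd (TB l)))"
      by simp
  qed
  \<comment> \<open>The heads released by the 2h exchanges are exactly the vertices of
    \<open>T0\<close>.\<close>
  have cov4: "coverable n h ?E 1 (set (fst T0)) (set (snd T0))"
    by (intro coverable_biclique biclique_mono[OF T0(1)]) simp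
  note cov = coverable_union[OF coverable_union[OF coverable_union[OF cov1 cov2] cov3] cov4]
  have split_set: "set xs \<subseteq> insert (hd xs) (set (tl xs))" for xs :: "nat list"
    by (cases xs) auto
  have hdA: "hd (fst (TA l)) \<in> set (fst T0)" and hdB: "hd (snd (TB l)) \<in> set (snd T0)" if "l < h" for l
    using TA(2)[OF that] TB(2)[OF that] len0 that by (metis nth_mem)+
  show ?case
  proof (rule coverable_mono[OF cov])
    \<comment> \<open>The 2h modified bicliques stand for the 2h retired ones, and \<open>T0\<close>
      accounts for the increase of k by one.\<close>
    show "card \<A>' + card \<B>' + k + card {..<h} + card {..<h} + 1 \<le> card \<A> + card \<B> + Suc k"
      using cardA cardB by simp
    have 1: "set (fst T) \<subseteq> (\<Union>T\<in>\<A>' \<union> \<B>'. set (fst T)) \<union>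
        (\<Union>l\<in>{..<h}. set (tl (fst (TA l)))) \<union> (\<Union>l\<in>{..<h}. set (fst (TB l))) \<union> set (fst T0)"
      if TAB: "T \<in> \<A> \<union> \<B>" for T
    proof (cases "T \<in> \<A>' \<union> \<B>'")
      case False
      then consider l where "l < h" "T = TA l" | l where "l < h" "T = TB l"
        using TAB by (auto simp: \<A>'_def \<B>'_def)
      then show ?thesis
      proof cases
        case 1
        then show ?thesis using split_set[of "fst T"] hdA[of l] by auto
      qed auto
    qed auto
    have 2: "set (snd T) \<subseteq> (\<Union>T\<in>\<A>' \<union> \<B>'. set (snd T)) \<union>
        (\<Union>l\<in>{..<h}. set (snd (TA l))) \<union> (\<Union>l\<in>{..<h}. set (tl (snd (TB l)))) \<union> set (snd T0)"
      if TAB: "T \<in> \<A> \<union> \<B>" for T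
    proof (cases "T \<in> \<A>' \<union> \<B>'")
      case False
      then consider l where "l < h" "T = TA l" | l where "l < h" "T = TB l"
        using TAB by (auto simp: \<A>'_def \<B>'_def)
      then show ?thesis
      proof cases
        case 2
        then show ?thesis using split_set[of "snd T"] hdB[of l] by auto
      qed auto
    qed auto
    have VU: "V \<subseteq> (\<Union>l<h. {vs ! l})" "U \<subseteq> (\<Union>l<h. {us ! l})"
      using vs us by (auto simp: set_conv_nth)
    show "L \<union> (\<Union>T\<in>\<A> \<union> \<B>. set (fst T)) \<subseteq> L - V \<union> (\<Union>T\<in>\<A>' \<union> \<B>'. set (fst T)) \<union>
        (\<Union>l<h. set (fst (vs ! l # tl (fst (TA l)), snd (TA l)))) \<union>
        (\<Union>l<h. set (fst (fst (TB l), us ! l # tl (snd (TB l))))) \<union> set (fst T0)" (is "_ \<subseteq> ?R")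
    proof (intro Un_least UN_least)
      have "L \<subseteq> L - V \<union> (\<Union>l<h. {vs ! l})"
        using VU(1) by blast
      also have "\<dots> \<subseteq> ?R"
        by auto
      finally show "L \<subseteq> ?R" .
      fix T assume "T \<in> \<A> \<union> \<B>"
      from 1[OF this] show "set (fst T) \<subseteq> ?R"
        by (rule order_trans) auto
    qed
    show "M \<union> (\<Union>T\<in>\<A> \<union> \<B>. set (snd T)) \<subseteq> M - U \<union> (\<Union>T\<in>\<A>' \<union> \<B>'. set (snd T)) \<union>
        (\<Union>l<h. set (snd (vs ! l # tl (fst (TA l)), snd (TA l)))) \<union>
        (\<Union>l<h. set (snd (fst (TB l), us ! l # tl (snd (TB l))))) \<union> set (snd T0)" (is "_ \<subseteq> ?R")
    proof (intro Un_least UN_least)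
      have "M \<subseteq> M - U \<union> (\<Union>l<h. {us ! l})"
        using VU(2) by blast
      also have "\<dots> \<subseteq> ?R"
        by auto
      finally show "M \<subseteq> ?R" .
      fix T assume "T \<in> \<A> \<union> \<B>"
      from 2[OF this] show "set (snd T) \<subseteq> ?R"
        by (rule order_trans) auto
    qed
  qed simp
qed

text \<open>As long as \<open>\<epsilon> n\<close> vertices remain in each part, \<open>rich\<close>
  with the same set at every position finds a further biclique among them.\<close>

lemma greedy_cover:
  assumes h: "h \<ge> 1" and rich: "rich n h r \<epsilon>"
    and "A \<subseteq> {..<n}" "B \<subseteq> {..<n}" "card A = card B"
  obtains L M k where "L \<subseteq> A" "M \<subseteq> B" "card L = card M" "real (card L) < \<epsilon> * real n"
    "card A = card L + h * k" "coverable n h r k (A - L) (B - M)"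
proof -
  have "\<exists>L M k. L \<subseteq> A \<and> M \<subseteq> B \<and> card L = card M \<and> real (card L) < \<epsilon> * real n \<and>
    card A = card L + h * k \<and> coverable n h r k (A - L) (B - M)"
    using assms(3-5)
  proof (induction "card A" arbitrary: A B rule: less_induct)
    case less
    show ?case
    proof (cases "real (card A) < \<epsilon> * real n")
      case True
      then show ?thesis
        using less.prems by (intro exI[of _ A] exI[of _ B] exI[of _ 0]) auto
    next
      case False
      obtain T where T: "biclique n h r T" "\<And>l. l < h \<Longrightarrow> fst T ! l \<in> A" "\<And>l. l < h \<Longrightarrow> snd T ! l \<in> B"
        by (rule richE[OF rich, of "\<lambda>_. A" "\<lambda>_. B"]) (use less.prems False in auto)
      have sub: "set (fst T) \<subseteq> A" "set (snd T) \<subseteq> B"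
        using T by (auto simp: set_conv_nth biclique_def)
      note cardT = biclique_card[OF T(1)]
      have fin: "finite A" "finite B"
        using less.prems finite_subset[OF _ finite_lessThan] by auto
      have hA: "h \<le> card A" "h \<le> card B"
        using card_mono[OF fin(1) sub(1)] card_mono[OF fin(2) sub(2)] cardT by auto
      have cards: "card (A - set (fst T)) = card A - h" "card (B - set (snd T)) = card B - h"
        using sub cardT by (simp_all add: card_Diff_subset)
      have "\<exists>L M k. L \<subseteq> A - set (fst T) \<and> M \<subseteq> B - set (snd T) \<and> card L = card M \<and>
        real (card L) < \<epsilon> * real n \<and> card (A - set (fst T)) = card L + h * k \<and>
        coverable n h r k (A - set (fst T) - L) (B - set (snd T) - M)"
      proof (rule less.hyps)
        show "card (A - set (fst T)) < card A"
          using cards hA h by linarith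
        show "card (A - set (fst T)) = card (B - set (snd T))"
          using cards less.prems by simp
      qed (use less.prems in auto)
      then obtain L M k where IH: "L \<subseteq> A - set (fst T)" "M \<subseteq> B - set (snd T)" "card L = card M"
        "real (card L) < \<epsilon> * real n" "card (A - set (fst T)) = card L + h * k"
        "coverable n h r k (A - set (fst T) - L) (B - set (snd T) - M)"
        by blast
      have "coverable n h r (k + 1) (A - set (fst T) - L \<union> set (fst T)) (B - set (snd T) - M \<union> set (snd T))"
        by (intro coverable_union coverable_biclique IH T)
      then have "coverable n h r (Suc k) (A - L) (B - M)"
        by (rule coverable_mono) auto
      moreover have "card A = card L + h * Suc k"
        using IH(5) cards hA by simp
      ultimately show ?thesis
        using IH(1-4) by blast
    qed
  qed
  then show ?thesis
    using that by blast
qed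

lemma cover_exceptional:
  assumes h: "h \<ge> 1" and rich: "rich n h r \<epsilon>"
    and deg: "\<And>v. v < n \<Longrightarrow> \<alpha> * real n \<le> real (card {b. b < n \<and> g v b})"
    and \<alpha>: "\<epsilon> \<le> \<alpha> / 2" "\<alpha> \<le> 1"
    and U: "U \<subseteq> {..<n}" "V \<subseteq> {..<n}" "card U = card V"
    and "finite D" "D \<subseteq> {..<n}" "real (card U + h * card D) \<le> \<alpha> * real n / 2"
  shows "\<exists>U' V' k. U \<union> D \<subseteq> U' \<and> U' \<subseteq> {..<n} \<and> V \<subseteq> V' \<and> V' \<subseteq> {..<n} \<and> k \<le> card D \<and>
    card U' = card U + h * k \<and> card V' = card U + h * k \<and>
    coverable n h (\<lambda>a b. g a b \<or> r a b) k (U' - U) (V' - V)"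
  using assms(9-)
proof (induction D)
  case empty
  show ?case
    using U by (intro exI[of _ U] exI[of _ V] exI[of _ 0]) auto
next
  case (insert v D)
  let ?E = "\<lambda>a b. g a b \<or> r a b"
  have "real (card U + h * card D) \<le> real (card U + h * card (insert v D))"
    using insert.hyps by simp
  then obtain U' V' k where IH: "U \<union> D \<subseteq> U'" "U' \<subseteq> {..<n}" "V \<subseteq> V'" "V' \<subseteq> {..<n}" "k \<le> card D"
    "card U' = card U + h * k" "card V' = card U + h * k" "coverable n h ?E k (U' - U) (V' - V)"
    using insert by (smt (verit) insert_subset)
  show ?case
  \<comment> \<open>A vertex that is already in \<open>U'\<close> costs no biclique. Hence the
    number of bicliques is only bounded by \<open>card D\<close>.\<close>
  proof (cases "v \<in> U'")
    case True
    then show ?thesis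
      using IH insert.hyps by (intro exI[of _ U'] exI[of _ V'] exI[of _ k]) auto
  next
    case False
    have v: "v < n" using insert by auto
    have fin: "finite U'" "finite V'"
      using IH finite_subset[OF _ finite_lessThan] by auto
    have "h * k \<le> h * card D" using IH by simp
    moreover have "h * card (insert v D) = h * card D + h" using insert.hyps by simp
    \<comment> \<open>The extra 1 is for \<open>v\<close> itself, which must not occur in the random
      biclique that it is about to enter.\<close>
    ultimately have "card U + h * k + 1 \<le> card U + h * card (insert v D)"
      using h by linarith
    then have "real (card U + h * k + 1) \<le> real (card U + h * card (insert v D))"
      by (simp only: of_nat_le_iff)
    then have small: "real (card U + h * k + 1) \<le> \<alpha> * real n / 2"
      using insert.prems by linarith
    have cX: "\<epsilon> * real n \<le> real (card ({..<n} - insert v U'))"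
    proof -
      have "card ({..<n} - insert v U') = n - (card U + h * k + 1)"
        using IH v False fin by (subst card_Diff_subset) auto
      then have "real n - real (card U + h * k + 1) \<le> real (card ({..<n} - insert v U'))"
        by linarith
      moreover have "\<alpha> * real n \<le> 1 * real n"
        using \<alpha> by (intro mult_right_mono) simp_all
      moreover have "\<epsilon> * real n \<le> \<alpha> / 2 * real n"
        using \<alpha> by (intro mult_right_mono) simp_all
      ultimately show ?thesis using small by linarith
    qed
    have cY: "\<epsilon> * real n \<le> real (card ({b. b < n \<and> g v b} - V'))"
    proof -
      have "card {b. b < n \<and> g v b} - card V' \<le> card ({b. b < n \<and> g v b} - V')"
        by (rule diff_card_le_card_Diff[OF fin(2)])
      then have "real (card {b. b < n \<and> g v b}) - real (card U + h * k) \<le> real (card ({b. b < n \<and> g v b} - V'))"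
        using IH by linarith
      moreover have "\<epsilon> * real n \<le> \<alpha> / 2 * real n"
        using \<alpha> by (intro mult_right_mono) simp_all
      ultimately show ?thesis using small deg[OF v] by linarith
    qed
    obtain T where T: "biclique n h r T" "\<And>l. l < h \<Longrightarrow> fst T ! l \<in> {..<n} - insert v U'"
      "\<And>l. l < h \<Longrightarrow> snd T ! l \<in> {b. b < n \<and> g v b} - V'"
      by (rule richE[OF rich, of "\<lambda>_. {..<n} - insert v U'" "\<lambda>_. {b. b < n \<and> g v b} - V'"])
         (use cX cY in auto)
    have subT: "set (fst T) \<subseteq> {..<n} - insert v U'" "set (snd T) \<subseteq> {b. b < n \<and> g v b} - V'"
      using T by (auto simp: set_conv_nth biclique_def subset_iff)
    obtain a as where as: "fst T = a # as"
      using T(1) h by (cases "fst T") (auto simp: biclique_def)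
    have "biclique n h r (a # as, snd T)"
      using T(1) as by (metis prod.collapse)
    \<comment> \<open>The dropped vertex \<open>a\<close> is not counted as used and remains
      available later.\<close>
    then have "biclique n h ?E (v # as, snd T)"
      by (rule biclique_replace_hd) (use subT v in \<open>auto simp: as\<close>)
    note T' = this biclique_card[OF this] biclique_subset[OF this]
    have "coverable n h ?E (k + 1) ((U' - U) \<union> set (v # as)) ((V' - V) \<union> set (snd T))"
      using coverable_union[OF IH(8) coverable_biclique[OF T'(1)]] by simp
    then have "coverable n h ?E (Suc k) (U' \<union> set (v # as) - U) (V' \<union> set (snd T) - V)"
      by (rule coverable_mono) auto
    moreover have "card (U' \<union> set (v # as)) = card U + h * Suc k"
      using subT as False fin T'(2) IH by (subst card_Un_disjoint) auto
    moreover have "card (V' \<union> set (snd T)) = card U + h * Suc k"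
      using subT fin T'(3) IH by (subst card_Un_disjoint) auto
    moreover have "Suc k \<le> card (insert v D)"
      using IH insert.hyps by simp
    ultimately show ?thesis
      using IH T'(4,5)
      by (intro exI[of _ "U' \<union> set (v # as)"] exI[of _ "V' \<union> set (snd T)"] exI[of _ "Suc k"]) auto
  qed
qed

section \<open>Covers of all vertices\<close>

definition packing ::
    "nat \<Rightarrow> nat \<Rightarrow> (nat \<Rightarrow> nat \<Rightarrow> bool) \<Rightarrow> nat set \<Rightarrow> nat set \<Rightarrow> (nat list \<times> nat list) set \<Rightarrow> bool" where
  "packing n h r U V \<T> \<longleftrightarrow> finite \<T> \<and>
     (\<forall>T\<in>\<T>. biclique n h r T \<and> set (fst T) \<inter> U = {} \<and> set (snd T) \<inter> V = {}) \<and>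
     (\<forall>T\<in>\<T>. \<forall>T'\<in>\<T>. T \<noteq> T' \<longrightarrow> set (fst T) \<inter> set (fst T') = {} \<and> set (snd T) \<inter> set (snd T') = {})"

lemma packing_swap:
  assumes "packing n h r U V \<T>"
  shows "packing n h (\<lambda>a b. r b a) V U (prod.swap ` \<T>)"
  unfolding packing_def
proof (intro conjI ballI impI)
  show "finite (prod.swap ` \<T>)"
    using assms by (simp add: packing_def)
next
  fix T assume "T \<in> prod.swap ` \<T>"
  then obtain S where S: "S \<in> \<T>" "T = prod.swap S" by blast
  then have *: "biclique n h r S" "set (fst S) \<inter> U = {}" "set (snd S) \<inter> V = {}"
    using assms by (simp_all add: packing_def)
  show "biclique n h (\<lambda>a b. r b a) T"
    unfolding S(2) by (rule biclique_swap[OF *(1)])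
  show "set (fst T) \<inter> V = {}" "set (snd T) \<inter> U = {}"
    using * S(2) by auto
next
  fix T T' assume "T \<in> prod.swap ` \<T>" "T' \<in> prod.swap ` \<T>" "T \<noteq> T'"
  then obtain S S' where S: "S \<in> \<T>" "T = prod.swap S" "S' \<in> \<T>" "T' = prod.swap S'" "S \<noteq> S'" by blast
  then have "set (fst S) \<inter> set (fst S') = {}" "set (snd S) \<inter> set (snd S') = {}"
    using assms unfolding packing_def by blast+
  then show "set (fst T) \<inter> set (fst T') = {}" "set (snd T) \<inter> set (snd T') = {}"
    using S by simp_all
qed

lemma packing_card:
  assumes "packing n h r U V \<T>"
  shows "card (\<Union>T\<in>\<T>. set (fst T)) = h * card \<T>" "card (\<Union>T\<in>\<T>. set (snd T)) = h * card \<T>"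
proof -
  have bi: "biclique n h r T" if "T \<in> \<T>" for T
    using assms that by (simp add: packing_def)
  have "card (\<Union>T\<in>\<T>. set (fst T)) = (\<Sum>T\<in>\<T>. card (set (fst T)))"
    using assms by (intro card_UN_disjoint) (auto simp: packing_def)
  then show "card (\<Union>T\<in>\<T>. set (fst T)) = h * card \<T>"
    using biclique_card(1)[OF bi] by simp
  have "card (\<Union>T\<in>\<T>. set (snd T)) = (\<Sum>T\<in>\<T>. card (set (snd T)))"
    using assms by (intro card_UN_disjoint) (auto simp: packing_def)
  then show "card (\<Union>T\<in>\<T>. set (snd T)) = h * card \<T>"
    using biclique_card(2)[OF bi] by simp
qed

lemma packing_inj_hd:
  assumes "packing n h r U V \<T>" "h \<ge> 1"
  shows "inj_on (hd \<circ> fst) \<T>" "inj_on (hd \<circ> snd) \<T>"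
proof -
  have hd: "hd (fst T) \<in> set (fst T)" "hd (snd T) \<in> set (snd T)" if "T \<in> \<T>" for T
  proof -
    have "biclique n h r T"
      using assms that by (simp add: packing_def)
    then have "fst T \<noteq> []" "snd T \<noteq> []"
      using assms(2) by (auto simp: biclique_def)
    then show "hd (fst T) \<in> set (fst T)" "hd (snd T) \<in> set (snd T)"
      by simp_all
  qed
  have disj: "T = T'" if "T \<in> \<T>" "T' \<in> \<T>" "set (fst T) \<inter> set (fst T') \<noteq> {} \<or> set (snd T) \<inter> set (snd T') \<noteq> {}" for T T'
    using assms(1) that unfolding packing_def by blast
  show "inj_on (hd \<circ> fst) \<T>"
  proof (rule inj_onI)
    fix T T' assume *: "T \<in> \<T>" "T' \<in> \<T>" "(hd \<circ> fst) T = (hd \<circ> fst) T'"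
    then have "hd (fst T) \<in> set (fst T) \<inter> set (fst T')"
      using hd(1)[of T] hd(1)[of T'] by simp
    then show "T = T'" using disj[OF *(1,2)] by blast
  qed
  show "inj_on (hd \<circ> snd) \<T>"
  proof (rule inj_onI)
    fix T T' assume *: "T \<in> \<T>" "T' \<in> \<T>" "(hd \<circ> snd) T = (hd \<circ> snd) T'"
    then have "hd (snd T) \<in> set (snd T) \<inter> set (snd T')"
      using hd(2)[of T] hd(2)[of T'] by simp
    then show "T = T'" using disj[OF *(1,2)] by blast
  qed
qed

lemma packing_subset:
  assumes "packing n h r U V \<T>"
  shows "(\<Union>T\<in>\<T>. set (fst T)) \<subseteq> {..<n} - U" "(\<Union>T\<in>\<T>. set (snd T)) \<subseteq> {..<n} - V"
proof -
  have "set (fst T) \<subseteq> {..<n} - U \<and> set (snd T) \<subseteq> {..<n} - V" if "T \<in> \<T>" for T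
  proof -
    have "biclique n h r T" "set (fst T) \<inter> U = {}" "set (snd T) \<inter> V = {}"
      using assms that by (simp_all add: packing_def)
    then show ?thesis
      using biclique_subset[of n h r T] by blast
  qed
  then show "(\<Union>T\<in>\<T>. set (fst T)) \<subseteq> {..<n} - U" "(\<Union>T\<in>\<T>. set (snd T)) \<subseteq> {..<n} - V"
    by blast+
qed

lemma packing_insert:
  assumes "packing n h r U V \<T>" "biclique n h r T"
    and "set (fst T) \<inter> (U \<union> (\<Union>T\<in>\<T>. set (fst T))) = {}"
    and "set (snd T) \<inter> (V \<union> (\<Union>T\<in>\<T>. set (snd T))) = {}"
  shows "packing n h r U V (insert T \<T>)"
  using assms unfolding packing_def by (simp add: Int_Un_distrib Int_commute) blast

lemma ex_serving_packing:
  assumes h: "h \<ge> 1" and pop: "popular_rich n h g r \<alpha> \<eta> \<kappa>" and \<alpha>: "\<alpha> \<le> 1"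
    and U: "U \<subseteq> {..<n}" "V \<subseteq> {..<n}" "card U = card V" and n: "n \<ge> 1"
    and small: "real (card U + h * k) \<le> \<alpha> * real n / 2" and m: "real m < \<kappa> * real k"
  obtains \<T> where "packing n h r U V \<T>" "card \<T> \<le> k"
    "real (card {v. v < n \<and> card {T\<in>\<T>. \<forall>b\<in>set (snd T). g v b} < m}) < \<eta> * real n"
proof -
  define deg where "deg \<T> v = card {T\<in>\<T>. \<forall>b\<in>set (snd T). g v b}" for \<T> :: "(nat list \<times> nat list) set" and v
  have "\<exists>\<T>. packing n h r U V \<T> \<and> card \<T> \<le> k \<and> real (card {v. v < n \<and> deg \<T> v < m}) < \<eta> * real n"
  proof (rule ccontr)
    assume neg: "\<not> ?thesis"
    have "\<exists>\<T>. packing n h r U V \<T> \<and> card \<T> \<le> j \<and>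
        real j * (\<kappa> * real n) \<le> real (\<Sum>v<n. min (deg \<T> v) m)" if "j \<le> k" for j
      using that
    proof (induction j)
      case 0
      then show ?case
        by (intro exI[of _ "{}"]) (auto simp: packing_def intro!: sum_nonneg)
    next
      case (Suc j)
      then obtain \<T> where \<T>: "packing n h r U V \<T>" "card \<T> \<le> j"
        "real j * (\<kappa> * real n) \<le> real (\<Sum>v<n. min (deg \<T> v) m)"
        by auto
      \<comment> \<open>The vertices still below the cap. There are at least \<open>\<eta> n\<close>
        of them, since otherwise the current packing would be as desired.\<close>
      define W where "W = {v. v < n \<and> deg \<T> v < m}"
      have W: "\<eta> * real n \<le> real (card W)"
        using neg \<T> Suc.prems unfolding W_def by (meson Suc_leD le_trans not_le)
      have fin\<T>: "finite \<T>" using \<T>(1) by (simp add: packing_def)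
      have fin: "finite U" "finite V"
        using U finite_subset[OF _ finite_lessThan] by auto
      have used: "real (h * card \<T>) \<le> real (h * k)"
        using \<T>(2) Suc.prems by (intro of_nat_mono mult_le_mono) auto
      have half: "\<alpha> * real n / 2 \<le> real n / 2"
        using mult_right_mono[OF \<alpha>, of "real n"] by simp
      define A where "A = {..<n} - (U \<union> (\<Union>T\<in>\<T>. set (fst T)))"
      define B where "B = {..<n} - (V \<union> (\<Union>T\<in>\<T>. set (snd T)))"
      have "n - card (U \<union> (\<Union>T\<in>\<T>. set (fst T))) \<le> card A"
        unfolding A_def using diff_card_le_card_Diff[of "U \<union> (\<Union>T\<in>\<T>. set (fst T))" "{..<n}"] fin fin\<T> by simp
      moreover have "card (U \<union> (\<Union>T\<in>\<T>. set (fst T))) \<le> card U + h * card \<T>"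
        using card_Un_le packing_card(1)[OF \<T>(1)] by metis
      ultimately have "n - (card U + h * card \<T>) \<le> card A"
        by linarith
      then have cardA: "real n - \<alpha> * real n / 2 \<le> real (card A)"
        using small used by linarith
      have "n - card (V \<union> (\<Union>T\<in>\<T>. set (snd T))) \<le> card B"
        unfolding B_def using diff_card_le_card_Diff[of "V \<union> (\<Union>T\<in>\<T>. set (snd T))" "{..<n}"] fin fin\<T> by simp
      moreover have "card (V \<union> (\<Union>T\<in>\<T>. set (snd T))) \<le> card V + h * card \<T>"
        using card_Un_le packing_card(2)[OF \<T>(1)] by metis
      ultimately have "n - (card U + h * card \<T>) \<le> card B"
        using U by linarith
      then have cardB: "real n - \<alpha> * real n / 2 \<le> real (card B)"
        using small used by linarith
      have sub': "A \<subseteq> {..<n}" "B \<subseteq> {..<n}" "W \<subseteq> {..<n}"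
        by (auto simp: A_def B_def W_def)
      have "real n / 2 \<le> real (card A)"
        using cardA half by linarith
      moreover have "(1 - \<alpha> / 2) * real n \<le> real (card B)"
        using cardB by (simp add: algebra_simps)
      ultimately have "\<exists>T. biclique n h r T \<and> set (fst T) \<subseteq> A \<and> set (snd T) \<subseteq> B \<and>
          \<kappa> * real n \<le> real (card {w\<in>W. \<forall>b\<in>set (snd T). g w b})"
        using sub' W by (intro pop[unfolded popular_rich_def, rule_format] conjI)
      then obtain T where T: "biclique n h r T" "set (fst T) \<subseteq> A" "set (snd T) \<subseteq> B"
        "\<kappa> * real n \<le> real (card {w\<in>W. \<forall>b\<in>set (snd T). g w b})"
        by blast
      have pack: "packing n h r U V (insert T \<T>)"
        using \<T>(1) T(1-3) by (intro packing_insert) (auto simp: A_def B_def)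
      have "T \<notin> \<T>"
      proof
        assume "T \<in> \<T>"
        then have "set (fst T) \<subseteq> (\<Union>T\<in>\<T>. set (fst T))" by (rule UN_upper)
        moreover have "set (fst T) \<inter> (\<Union>T\<in>\<T>. set (fst T)) = {}"
          using T(2) unfolding A_def by auto
        ultimately have "set (fst T) = {}" by (simp only: Int_absorb2)
        then show False using biclique_card(1)[OF T(1)] h by simp
      qed
      then have degT: "deg (insert T \<T>) v = deg \<T> v + of_bool (\<forall>b\<in>set (snd T). g v b)" for v
      proof -
        have "{S\<in>insert T \<T>. \<forall>b\<in>set (snd S). g v b} =
            (if \<forall>b\<in>set (snd T). g v b then insert T {S\<in>\<T>. \<forall>b\<in>set (snd S). g v b} else {S\<in>\<T>. \<forall>b\<in>set (snd S). g v b})"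
          by auto
        then show ?thesis
          using \<open>T \<notin> \<T>\<close> fin\<T> by (simp add: deg_def)
      qed
      \<comment> \<open>A vertex of \<open>W\<close> is strictly below the cap, so its capped degree
        really grows by one.\<close>
      have "(\<Sum>v<n. min (deg \<T> v) m + of_bool (v \<in> W \<and> (\<forall>b\<in>set (snd T). g v b))) \<le>
          (\<Sum>v<n. min (deg (insert T \<T>) v) m)"
        unfolding degT by (intro sum_mono) (auto simp: W_def)
      moreover have "(\<Sum>v<n. of_bool (v \<in> W \<and> (\<forall>b\<in>set (snd T). g v b))) =
          card {w\<in>W. \<forall>b\<in>set (snd T). g w b}"
        using sub' by (simp add: Int_def) (intro arg_cong[where f = card], auto)
      ultimately have "(\<Sum>v<n. min (deg \<T> v) m) + card {w\<in>W. \<forall>b\<in>set (snd T). g w b} \<le>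
          (\<Sum>v<n. min (deg (insert T \<T>) v) m)"
        by (simp only: sum.distrib)
      then have "real (\<Sum>v<n. min (deg \<T> v) m) + real (card {w\<in>W. \<forall>b\<in>set (snd T). g w b}) \<le>
          real (\<Sum>v<n. min (deg (insert T \<T>) v) m)"
        by linarith
      moreover have "real (Suc j) * (\<kappa> * real n) = real j * (\<kappa> * real n) + \<kappa> * real n"
        by (simp add: algebra_simps)
      ultimately have "real (Suc j) * (\<kappa> * real n) \<le> real (\<Sum>v<n. min (deg (insert T \<T>) v) m)"
        using \<T>(3) T(4) by linarith
      moreover have "card (insert T \<T>) \<le> Suc j"
        using \<T>(2) \<open>T \<notin> \<T>\<close> fin\<T> by simp
      ultimately show ?case
        using pack by blast
    qed
    then obtain \<T> where \<T>: "real k * (\<kappa> * real n) \<le> real (\<Sum>v<n. min (deg \<T> v) m)"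
      by blast
    have "(\<Sum>v<n. min (deg \<T> v) m) \<le> (\<Sum>v<n. m)"
      by (intro sum_mono) simp
    then have "real (\<Sum>v<n. min (deg \<T> v) m) \<le> real (n * m)"
      by (simp only: of_nat_le_iff sum_constant card_lessThan of_nat_id)
    then have "real n * (\<kappa> * real k) \<le> real n * real m"
      using \<T> by (simp add: algebra_simps)
    then show False
      using m n by (simp add: mult_le_cancel_left)
  qed
  then show ?thesis
    using that unfolding deg_def by blast
qed

text \<open>The serving packings come first because they determine which vertices are exceptional.
  The budget \<open>small\<close> covers two packings of at most k bicliques together with h
  vertices for each exceptional vertex of either part, so at most half of a neighbourhood is ever
  used up. The bound 2 \<open>\<epsilon> n\<close> on m provides \<open>\<epsilon> n\<close> for
  \<open>rich\<close> and another \<open>\<epsilon> n\<close> for the bicliques retired while the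
  leftover is absorbed.\<close>

lemma ex_perfect_cover:
  assumes h: "h \<ge> 1" and n: "n \<ge> 1" "h dvd n" and rich: "rich n h r \<epsilon>"
    and pop: "popular_rich n h g r \<alpha> \<eta> \<kappa>" "popular_rich n h (\<lambda>a b. g b a) (\<lambda>a b. r b a) \<alpha> \<eta> \<kappa>"
    and deg: "\<And>v. v < n \<Longrightarrow> \<alpha> * real n \<le> real (card {b. b < n \<and> g v b})"
      "\<And>v. v < n \<Longrightarrow> \<alpha> * real n \<le> real (card {a. a < n \<and> g a v})"
    and \<epsilon>: "\<epsilon> \<le> \<alpha> / 2" and \<alpha>: "\<alpha> \<le> 1"
    and small: "2 * real h * real k + 2 * real h * \<eta> * real n \<le> \<alpha> * real n / 2" and \<eta>: "0 \<le> \<eta>"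
    and m: "2 * \<epsilon> * real n \<le> real m" "real m < \<kappa> * real k"
  shows "coverable n h (\<lambda>a b. g a b \<or> r a b) (n div h) {..<n} {..<n}"
proof -
  let ?E = "\<lambda>a b. g a b \<or> r a b"
  have slack: "0 \<le> real h * (\<eta> * real n)"
    using \<eta> by simp
  have hk0: "0 \<le> real h * real k" by simp
  have "real (card ({} :: nat set) + h * k) \<le> \<alpha> * real n / 2"
    using small slack hk0 unfolding card.empty add_0 of_nat_mult by linarith
  then obtain \<A> where \<A>: "packing n h r {} {} \<A>" "card \<A> \<le> k"
    "real (card {v. v < n \<and> card {T\<in>\<A>. \<forall>b\<in>set (snd T). g v b} < m}) < \<eta> * real n"
    using ex_serving_packing[OF h pop(1) \<alpha> _ _ _ n(1) _ m(2), of "{}" "{}"] by auto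
  define U1 where "U1 = (\<Union>T\<in>\<A>. set (fst T))"
  define V1 where "V1 = (\<Union>T\<in>\<A>. set (snd T))"
  have UV1: "U1 \<subseteq> {..<n}" "V1 \<subseteq> {..<n}" "card U1 = h * card \<A>" "card V1 = h * card \<A>"
    using packing_subset[OF \<A>(1)] packing_card[OF \<A>(1)] by (auto simp: U1_def V1_def)
  have hA: "real (h * card \<A>) \<le> real h * real k"
    using \<A>(2) by (simp add: mult_left_mono)
  have "real (card V1 + h * k) \<le> \<alpha> * real n / 2"
    using UV1 hA small slack by simp
  \<comment> \<open>The second packing serves the other part. It is built with the parts exchanged,
    outside the vertices of the first packing, and swapped back afterwards.\<close>
  then obtain \<B>' where \<B>': "packing n h (\<lambda>a b. r b a) V1 U1 \<B>'" "card \<B>' \<le> k"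
    "real (card {v. v < n \<and> card {T\<in>\<B>'. \<forall>b\<in>set (snd T). g b v} < m}) < \<eta> * real n"
    using ex_serving_packing[OF h pop(2) \<alpha> UV1(2,1) _ n(1) _ m(2)] UV1(3,4) by auto
  define \<B> where "\<B> = prod.swap ` \<B>'"
  have \<B>: "packing n h r U1 V1 \<B>"
    using packing_swap[OF \<B>'(1)] by (simp add: \<B>_def)
  have card\<B>: "card \<B> = card \<B>'"
    unfolding \<B>_def by (intro card_image inj_onI) (metis swap_swap)
  have deg\<B>: "card {T\<in>\<B>. \<forall>a\<in>set (fst T). g a v} = card {T\<in>\<B>'. \<forall>b\<in>set (snd T). g b v}" for v
  proof -
    have "{T\<in>\<B>. \<forall>a\<in>set (fst T). g a v} = prod.swap ` {T\<in>\<B>'. \<forall>b\<in>set (snd T). g b v}"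
      by (auto simp: \<B>_def)
    then show ?thesis
      by (simp add: card_image inj_on_def)
  qed
  define U2 where "U2 = U1 \<union> (\<Union>T\<in>\<B>. set (fst T))"
  define V2 where "V2 = V1 \<union> (\<Union>T\<in>\<B>. set (snd T))"
  have fin1: "finite U1" "finite V1"
    using UV1 finite_subset[OF _ finite_lessThan] by auto
  have finB: "finite \<A>" "finite \<B>"
    using \<A>(1) \<B> by (auto simp: packing_def)
  have UV2: "U2 \<subseteq> {..<n}" "V2 \<subseteq> {..<n}"
    using packing_subset[OF \<B>] UV1 by (auto simp: U2_def V2_def)
  have cardUV2: "card U2 = h * (card \<A> + card \<B>)" "card V2 = h * (card \<A> + card \<B>)"
  proof -
    have "card U2 = card U1 + card (\<Union>T\<in>\<B>. set (fst T))"
      unfolding U2_def using packing_subset(1)[OF \<B>] fin1 finB by (intro card_Un_disjoint) auto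
    then show "card U2 = h * (card \<A> + card \<B>)"
      using UV1 packing_card[OF \<B>] by (simp add: algebra_simps)
    have "card V2 = card V1 + card (\<Union>T\<in>\<B>. set (snd T))"
      unfolding V2_def using packing_subset(2)[OF \<B>] fin1 finB by (intro card_Un_disjoint) auto
    then show "card V2 = h * (card \<A> + card \<B>)"
      using UV1 packing_card[OF \<B>] by (simp add: algebra_simps)
  qed
  define D where "D = {v. v < n \<and> card {T\<in>\<A>. \<forall>b\<in>set (snd T). g v b} < m}"
  define D' where "D' = {v. v < n \<and> card {T\<in>\<B>. \<forall>a\<in>set (fst T). g a v} < m}"
  have DD': "D \<subseteq> {..<n}" "D' \<subseteq> {..<n}" "finite D" "finite D'"
    by (auto simp: D_def D'_def)
  have cardD: "real (card D) < \<eta> * real n" "real (card D') < \<eta> * real n"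
    using \<A>(3) \<B>'(3) by (simp_all add: D_def D'_def deg\<B>)
  have hD: "real (h * card D) \<le> real h * (\<eta> * real n)" "real (h * card D') \<le> real h * (\<eta> * real n)"
    using cardD by (simp_all add: mult_left_mono)
  have hAB: "real (h * (card \<A> + card \<B>)) \<le> 2 * real h * real k"
  proof -
    have "h * (card \<A> + card \<B>) \<le> h * (2 * k)"
      using \<A>(2) \<B>'(2) card\<B> by (intro mult_le_mono) auto
    then have "real (h * (card \<A> + card \<B>)) \<le> real (h * (2 * k))"
      by (simp only: of_nat_le_iff)
    then show ?thesis by simp
  qed
  have "real (card U2 + h * card D) \<le> \<alpha> * real n / 2"
    unfolding cardUV2 of_nat_add using hAB hD small slack by linarith
  then obtain U3 V3 k1 where UV3: "U2 \<union> D \<subseteq> U3" "U3 \<subseteq> {..<n}" "V2 \<subseteq> V3" "V3 \<subseteq> {..<n}" "k1 \<le> card D"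
    "card U3 = card U2 + h * k1" "card V3 = card U2 + h * k1"
    "coverable n h ?E k1 (U3 - U2) (V3 - V2)"
    using cover_exceptional[where g = g and \<alpha> = \<alpha>, OF h rich deg(1) \<epsilon> \<alpha> UV2 _ DD'(3,1)] cardUV2
    by auto
  have hk1: "real (h * k1) \<le> real (h * card D)"
    using UV3(5) by (intro of_nat_mono mult_le_mono) auto
  have "real (card V3 + h * card D') \<le> \<alpha> * real n / 2"
    unfolding UV3(7) cardUV2 of_nat_add using hk1 hAB hD small slack by linarith
  then obtain V4 U4 k2 where UV4: "V3 \<union> D' \<subseteq> V4" "V4 \<subseteq> {..<n}" "U3 \<subseteq> U4" "U4 \<subseteq> {..<n}"
    "card V4 = card V3 + h * k2" "card U4 = card V3 + h * k2"
    "coverable n h (\<lambda>a b. g b a \<or> r b a) k2 (V4 - V3) (U4 - U3)"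
    using cover_exceptional[where g = "\<lambda>a b. g b a" and \<alpha> = \<alpha>,
        OF h rich_swap[OF rich] deg(2) \<epsilon> \<alpha> UV3(4,2) _ DD'(4,2)] UV3(6,7) by auto
  have cov34: "coverable n h ?E (k1 + k2) ((U3 - U2) \<union> (U4 - U3)) ((V3 - V2) \<union> (V4 - V3))"
    by (rule coverable_union[OF UV3(8) coverable_swap[OF UV4(7)]])
  have fin4: "finite U4" "finite V4"
    using UV4 finite_subset[OF _ finite_lessThan] by auto
  have rest: "card ({..<n} - U4) = n - card U4" "card ({..<n} - V4) = n - card V4"
    using UV4 fin4 by (simp_all add: card_Diff_subset)
  have U4n: "card U4 \<le> n"
    using card_mono[OF finite_lessThan UV4(4)] by simp
  obtain L M k3 where LM: "L \<subseteq> {..<n} - U4" "M \<subseteq> {..<n} - V4" "card L = card M"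
    "real (card L) < \<epsilon> * real n" "card ({..<n} - U4) = card L + h * k3"
    "coverable n h r k3 ({..<n} - U4 - L) ({..<n} - V4 - M)"
    using greedy_cover[OF h rich, of "{..<n} - U4" "{..<n} - V4"] rest UV4(5,6) by auto
  \<comment> \<open>All vertices outside \<open>L\<close> were used in groups of h, so divisibility
    of n passes to the leftover.\<close>
  have n_eq: "n = h * (card \<A> + card \<B> + k1 + k2 + k3) + card L"
    using LM(5) rest U4n UV4(6) UV3(7) cardUV2 by (simp add: algebra_simps)
  then have "h dvd card L"
    using n(2) by (metis dvd_add_right_iff dvd_triv_left)
  then obtain k4 where k4: "card L = h * k4" by blast
  \<comment> \<open>No leftover vertex is exceptional, since \<open>D\<close> was put into
    \<open>U3\<close>. It therefore has degree at least m, while the leftover itself has fewer than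
    \<open>\<epsilon> n\<close> vertices.\<close>
  have Lgood: "\<epsilon> * real n + real (h * k4) \<le> real (card {T\<in>\<A>. \<forall>b\<in>set (snd T). g v b})" if "v \<in> L" for v
  proof -
    have "v < n" "v \<notin> D" using that LM(1) UV3 UV4 by auto
    then have "m \<le> card {T\<in>\<A>. \<forall>b\<in>set (snd T). g v b}" by (auto simp: D_def)
    then show ?thesis using m(1) LM(4) k4 by linarith
  qed
  have Mgood: "\<epsilon> * real n + real (h * k4) \<le> real (card {T\<in>\<B>. \<forall>a\<in>set (fst T). g a v})" if "v \<in> M" for v
  proof -
    have "v < n" "v \<notin> D'" using that LM(2) UV3 UV4 by auto
    then have "m \<le> card {T\<in>\<B>. \<forall>a\<in>set (fst T). g a v}" by (auto simp: D'_def)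
    then show ?thesis using m(1) LM(4) k4 by linarith
  qed
  have cov: "coverable n h ?E (card \<A> + card \<B> + k4)
      (L \<union> (\<Union>T\<in>\<A> \<union> \<B>. set (fst T))) (M \<union> (\<Union>T\<in>\<A> \<union> \<B>. set (snd T)))"
  proof (rule absorb[OF h rich finB _ packing_inj_hd(1)[OF \<A>(1) h] packing_inj_hd(2)[OF \<B> h]])
    show "biclique n h r T" if "T \<in> \<A> \<union> \<B>" for T
      using that \<A>(1) \<B> by (auto simp: packing_def)
    show "card L = h * k4" "card M = h * k4" "L \<subseteq> {..<n}" "M \<subseteq> {..<n}"
      using k4 LM(1-3) by auto
    show "v \<notin> set (fst T)" if "v \<in> L" "T \<in> \<A>" for v T
    proof -
      have "set (fst T) \<subseteq> U2" using that(2) by (auto simp: U2_def U1_def)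
      then show ?thesis using that(1) LM(1) UV3(1) UV4(3) by blast
    qed
    show "u \<notin> set (snd T)" if "u \<in> M" "T \<in> \<B>" for u T
    proof -
      have "set (snd T) \<subseteq> V2" using that(2) by (auto simp: V2_def V1_def)
      then show ?thesis using that(1) LM(2) UV3(3) UV4(1) by blast
    qed
  qed (use Lgood Mgood in auto)
  have cov3: "coverable n h ?E k3 ({..<n} - U4 - L) ({..<n} - V4 - M)"
    using LM(6) by (rule coverable_mono) auto
  show ?thesis
  proof (rule coverable_mono[OF coverable_union[OF coverable_union[OF cov cov34] cov3]])
    \<comment> \<open>Absorption exchanges the \<open>card L\<close> leftover vertices of each part
      for \<open>k4\<close> further bicliques. The total is exactly n/h, which later forces
      disjointness.\<close>
    have "n = h * (card \<A> + card \<B> + k4 + (k1 + k2) + k3)"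
      using n_eq k4 by (simp add: algebra_simps)
    then have "n div h = card \<A> + card \<B> + k4 + (k1 + k2) + k3"
      using h by (metis div_mult_self1_is_m less_le_trans zero_less_one)
    then show "card \<A> + card \<B> + k4 + (k1 + k2) + k3 \<le> n div h"
      by simp
    show "{..<n} \<subseteq> L \<union> (\<Union>T\<in>\<A> \<union> \<B>. set (fst T)) \<union> (U3 - U2 \<union> (U4 - U3)) \<union> ({..<n} - U4 - L)"
      by (auto simp: U2_def U1_def)
    show "{..<n} \<subseteq> M \<union> (\<Union>T\<in>\<A> \<union> \<B>. set (snd T)) \<union> (V3 - V2 \<union> (V4 - V3)) \<union> ({..<n} - V4 - M)"
      by (auto simp: V2_def V1_def)
  qed
qed

section \<open>From covers by bicliques to perfect tilings\<close>

lemma coverable_imp_perfect_tiling: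
  assumes h: "h \<ge> 1" and cov: "coverable n h E k {..<n} {..<n}" and k: "h * k \<le> n"
    and G: "verts G = part_A n \<union> part_B n" "\<And>a b. E a b \<Longrightarrow> a < n \<Longrightarrow> b < n \<Longrightarrow> {Inl a, Inr b} \<in> edges G"
  shows "has_perfect_tiling (complete_bipartite h h) G"
proof -
  obtain Ts where Ts: "length Ts \<le> k" "\<forall>T\<in>set Ts. biclique n h E T"
    "{..<n} \<subseteq> (\<Union>T\<in>set Ts. set (fst T))" "{..<n} \<subseteq> (\<Union>T\<in>set Ts. set (snd T))"
    using cov unfolding coverable_def by auto
  have len: "length (fst T) = h" "length (snd T) = h" "distinct (fst T)" "distinct (snd T)"
    if "T \<in> set Ts" for T
    using Ts(2) that by (auto simp: biclique_def)
  \<comment> \<open>The concatenated first sides have at most n entries and contain all n vertices,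
    so nothing is repeated. The second sides are treated in the same way.\<close>
  have "length (concat (map fst Ts)) = (\<Sum>T\<leftarrow>Ts. h)"
    using len by (simp add: length_concat comp_def cong: map_cong)
  then have "length (concat (map fst Ts)) \<le> n"
    using Ts(1) k by (simp add: sum_list_triv) (metis mult.commute mult_le_mono1 order_trans)
  moreover have "n \<le> card (set (concat (map fst Ts)))"
    using card_mono[OF _ Ts(3)] by simp
  ultimately have distA: "distinct (concat (map fst Ts))"
    using card_length[of "concat (map fst Ts)"] by (intro card_distinct) linarith
  have "length (concat (map snd Ts)) = (\<Sum>T\<leftarrow>Ts. h)"
    using len by (simp add: length_concat comp_def cong: map_cong)
  then have "length (concat (map snd Ts)) \<le> n"
    using Ts(1) k by (simp add: sum_list_triv) (metis mult.commute mult_le_mono1 order_trans)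
  moreover have "n \<le> card (set (concat (map snd Ts)))"
    using card_mono[OF _ Ts(4)] by simp
  ultimately have distB: "distinct (concat (map snd Ts))"
    using card_length[of "concat (map snd Ts)"] by (intro card_distinct) linarith
  have disj_concat: "set (f T) \<inter> set (f T') = {}"
    if "distinct (concat (map f xs))" "T \<in> set xs" "T' \<in> set xs" "T \<noteq> T'"
    for f :: "nat list \<times> nat list \<Rightarrow> nat list" and xs T T'
    using that by (induction xs) auto
  define F :: "nat list \<times> nat list \<Rightarrow> (nat + nat) graph" where
    "F T = \<lparr>verts = Inl ` set (fst T) \<union> Inr ` set (snd T),
            edges = {{Inl a, Inr b} | a b. a \<in> set (fst T) \<and> b \<in> set (snd T)}\<rparr>" for T
  have sub: "subgraph (F T) G" if "T \<in> set Ts" for T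
  proof -
    have T: "biclique n h E T" using Ts(2) that by blast
    have "simple_graph (F T)"
      unfolding simple_graph_def F_def by auto
    moreover have "verts (F T) \<subseteq> verts G"
      using biclique_subset[OF T] by (auto simp: F_def G(1) part_A_def part_B_def)
    moreover have "edges (F T) \<subseteq> edges G"
      using biclique_subset[OF T] T by (auto simp: F_def biclique_def intro!: G(2))
    ultimately show ?thesis
      by (simp add: subgraph_def)
  qed
  have iso: "isomorphic (complete_bipartite h h) (F T)" if "T \<in> set Ts" for T
  proof -
    note len = len[OF that]
    define f :: "nat + nat \<Rightarrow> nat + nat" where
      "f = case_sum (\<lambda>i. Inl (fst T ! i)) (\<lambda>j. Inr (snd T ! j))"
    have imA: "(\<lambda>i. fst T ! i) ` {..<h} = set (fst T)" and imB: "(\<lambda>i. snd T ! i) ` {..<h} = set (snd T)"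
      using len by (auto simp: set_conv_nth)
    have "inj_on f (part_A h \<union> part_B h)"
      using len by (auto simp: inj_on_def f_def part_A_def part_B_def nth_eq_iff_index_eq)
    moreover have "f ` (part_A h \<union> part_B h) = Inl ` set (fst T) \<union> Inr ` set (snd T)"
      unfolding imA[symmetric] imB[symmetric] by (simp add: image_Un part_A_def part_B_def image_image f_def)
    ultimately have "bij_betw f (verts (complete_bipartite h h)) (verts (F T))"
      by (simp add: bij_betw_def complete_bipartite_def F_def)
    moreover have "edges (F T) = (\<lambda>e. f ` e) ` edges (complete_bipartite h h)"
    proof -
      have "edges (complete_bipartite h h) = (\<lambda>(i, j). {Inl i, Inr j}) ` ({..<h} \<times> {..<h})"
        by (auto simp: complete_bipartite_def part_A_def part_B_def)
      then have "(\<lambda>e. f ` e) ` edges (complete_bipartite h h) =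
          (\<lambda>(i, j). {Inl (fst T ! i), Inr (snd T ! j)}) ` ({..<h} \<times> {..<h})"
        by (simp add: image_image case_prod_unfold f_def)
      also have "\<dots> = (\<lambda>(a, b). {Inl a, Inr b}) ` (((\<lambda>i. fst T ! i) ` {..<h}) \<times> ((\<lambda>i. snd T ! i) ` {..<h}))"
        by (force simp: image_iff)
      also have "\<dots> = edges (F T)"
        unfolding imA imB by (auto simp: F_def)
      finally show ?thesis by simp
    qed
    ultimately show ?thesis
      unfolding isomorphic_def by blast
  qed
  have "is_tiling (complete_bipartite h h) G (F ` set Ts)"
    unfolding is_tiling_def
  proof (intro conjI ballI)
    show "pairwise (\<lambda>F F'. disjnt (verts F) (verts F')) (F ` set Ts)"
    proof (rule pairwiseI)
      fix H H' assume "H \<in> F ` set Ts" "H' \<in> F ` set Ts" "H \<noteq> H'"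
      then obtain T T' where T: "T \<in> set Ts" "T' \<in> set Ts" "T \<noteq> T'" "H = F T" "H' = F T'"
        by blast
      show "disjnt (verts H) (verts H')"
        using disj_concat[OF distA T(1-3)] disj_concat[OF distB T(1-3)]
        unfolding T(4,5) F_def disjnt_def by auto
    qed
  qed (use sub iso in auto)
  moreover have "(\<Union>H\<in>F ` set Ts. verts H) = verts G"
  proof
    show "(\<Union>H\<in>F ` set Ts. verts H) \<subseteq> verts G"
      using sub by (auto simp: subgraph_def)
    show "verts G \<subseteq> (\<Union>H\<in>F ` set Ts. verts H)"
    proof
      fix x assume "x \<in> verts G"
      then consider a where "x = Inl a" "a \<in> {..<n}" | b where "x = Inr b" "b \<in> {..<n}"
        by (auto simp: G(1) part_A_def part_B_def)
      then show "x \<in> (\<Union>H\<in>F ` set Ts. verts H)"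
      proof cases
        case 1
        then obtain T where "T \<in> set Ts" "a \<in> set (fst T)" using Ts(3) by blast
        then show ?thesis using 1 by (auto simp: F_def)
      next
        case 2
        then obtain T where "T \<in> set Ts" "b \<in> set (snd T)" using Ts(4) by blast
        then show ?thesis using 2 by (auto simp: F_def)
      qed
    qed
  qed
  ultimately show ?thesis
    unfolding has_perfect_tiling_def by blast
qed

section \<open>Simultaneously hitting many families\<close>

text \<open>A list with a repetition has one in its tail, or its head occurs in its tail, and k^2 +
  k \<le> (k+1)^2. The factor n on the left avoids the exponent k-1.\<close>

lemma card_nondistinct_lists_le:
  "n * card {xs \<in> lists_of n k. \<not> distinct xs} \<le> k\<^sup>2 * n ^ k"
proof (induction k)
  case 0
  have "{xs \<in> lists_of n 0. \<not> distinct xs} = {}" by auto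
  then show ?case by simp
next
  case (Suc k)
  let ?N = "{xs \<in> lists_of n k. \<not> distinct xs}"
  have fin: "finite (lists_of n k)" by (rule finite_lists_of)
  have finN: "finite ?N" by (rule finite_subset[OF _ fin]) auto
  have "{xs \<in> lists_of n (Suc k). \<not> distinct xs} \<subseteq>
      (\<lambda>(xs, x). x # xs) ` (?N \<times> {..<n} \<union> (SIGMA xs:lists_of n k. set xs))"
  proof
    fix ys assume "ys \<in> {xs \<in> lists_of n (Suc k). \<not> distinct xs}"
    then obtain x xs where "ys = x # xs" "xs \<in> lists_of n k" "x < n" "x \<in> set xs \<or> \<not> distinct xs"
      by (cases ys) auto
    then show "ys \<in> (\<lambda>(xs, x). x # xs) ` (?N \<times> {..<n} \<union> (SIGMA xs:lists_of n k. set xs))"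
      by (intro image_eqI[of _ _ "(xs, x)"]) auto
  qed
  then have "card {xs \<in> lists_of n (Suc k). \<not> distinct xs} \<le>
      card ((\<lambda>(xs, x). x # xs) ` (?N \<times> {..<n} \<union> (SIGMA xs:lists_of n k. set xs)))"
    using fin finN by (intro card_mono finite_imageI finite_UnI finite_cartesian_product finite_SigmaI) simp_all
  also have "\<dots> \<le> card (?N \<times> {..<n} \<union> (SIGMA xs:lists_of n k. set xs))"
    using fin finN by (intro card_image_le finite_UnI finite_cartesian_product finite_SigmaI) simp_all
  also have "\<dots> \<le> card ?N * n + (\<Sum>xs\<in>lists_of n k. card (set xs))"
    using fin by (intro order_trans[OF card_Un_le]) (simp add: card_cartesian_product)
  also have "(\<Sum>xs\<in>lists_of n k. card (set xs)) \<le> (\<Sum>xs\<in>lists_of n k. k)"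
  proof (rule sum_mono)
    fix xs assume "xs \<in> lists_of n k"
    then show "card (set xs) \<le> k" using card_length[of xs] by auto
  qed
  also have "\<dots> = n ^ k * k"
    by (simp add: card_lists_of)
  finally have "card {xs \<in> lists_of n (Suc k). \<not> distinct xs} \<le> card ?N * n + n ^ k * k"
    by simp
  then have "n * card {xs \<in> lists_of n (Suc k). \<not> distinct xs} \<le> n * (card ?N * n + n ^ k * k)"
    by (rule mult_le_mono2)
  also have "\<dots> = (n * card ?N) * n + k * n ^ Suc k"
    by (simp add: algebra_simps)
  also have "\<dots> \<le> (k\<^sup>2 * n ^ k) * n + k * n ^ Suc k"
    using Suc.IH by (intro add_mono mult_le_mono1) auto
  also have "\<dots> = (k\<^sup>2 + k) * n ^ Suc k"
    by (simp add: algebra_simps)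
  also have "\<dots> \<le> (Suc k)\<^sup>2 * n ^ Suc k"
    by (intro mult_le_mono1) (simp add: power2_eq_square)
  finally show ?case .
qed

text \<open>Pairs of tuples with a repetition number at most 2 h^2 n^(2h-1), which is negligible
  against n^(2h). So families may be described without mentioning distinctness, at the price of half
  of their density.\<close>

lemma card_distinct_members_ge:
  assumes "\<F> \<subseteq> lists_of n h \<times> lists_of n h" "2 * \<beta> * real n ^ (2 * h) \<le> real (card \<F>)"
    and n: "n \<ge> 1" "2 * (real h)\<^sup>2 \<le> \<beta> * real n"
  shows "\<beta> * real n ^ (2 * h) \<le> real (card {T\<in>\<F>. distinct (fst T) \<and> distinct (snd T)})"
proof -
  let ?N = "{xs \<in> lists_of n h. \<not> distinct xs}" and ?L = "lists_of n h"
  let ?D = "{T\<in>\<F>. distinct (fst T) \<and> distinct (snd T)}"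
  have fin: "finite ?L" by (rule finite_lists_of)
  have finN: "finite ?N" by (rule finite_subset[OF _ fin]) auto
  have fin\<F>: "finite \<F>"
    using assms(1) by (rule finite_subset) (intro finite_cartesian_product fin)
  have "\<F> \<subseteq> ?D \<union> (?N \<times> ?L \<union> ?L \<times> ?N)"
  proof
    fix T assume T: "T \<in> \<F>"
    have "T \<in> ?L \<times> ?L"
      using assms(1) T by (rule subsetD)
    then show "T \<in> ?D \<union> (?N \<times> ?L \<union> ?L \<times> ?N)"
      using T by (cases T) simp
  qed
  then have "card \<F> \<le> card (?D \<union> (?N \<times> ?L \<union> ?L \<times> ?N))"
    using fin finN fin\<F> by (intro card_mono finite_UnI finite_cartesian_product) simp_all
  also have "\<dots> \<le> card ?D + (card (?N \<times> ?L) + card (?L \<times> ?N))"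
    by (intro order_trans[OF card_Un_le] add_left_mono card_Un_le)
  also have "\<dots> = card ?D + 2 * (card ?N * n ^ h)"
    by (simp only: card_cartesian_product card_lists_of mult.commute mult_2)
  finally have "real (card \<F>) \<le> real (card ?D + 2 * (card ?N * n ^ h))"
    by (simp only: of_nat_le_iff)
  then have 1: "real (card \<F>) \<le> real (card ?D) + 2 * (real (card ?N) * real n ^ h)"
    by simp
  have "real (n * card ?N) \<le> real (h\<^sup>2 * n ^ h)"
    using card_nondistinct_lists_le[of n h] by (simp only: of_nat_le_iff)
  then have "real n * real (card ?N) \<le> (real h)\<^sup>2 * real n ^ h"
    by simp
  then have "(real n * real (card ?N)) * (2 * real n ^ h) \<le> ((real h)\<^sup>2 * real n ^ h) * (2 * real n ^ h)"
    by (intro mult_right_mono) auto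
  also have "\<dots> = (2 * (real h)\<^sup>2) * real n ^ (2 * h)"
    unfolding mult_2[of h] power_add by simp
  also have "\<dots> \<le> (\<beta> * real n) * real n ^ (2 * h)"
    using n by (intro mult_right_mono) auto
  finally have "real n * (2 * (real (card ?N) * real n ^ h)) \<le> real n * (\<beta> * real n ^ (2 * h))"
    by (simp only: mult.assoc mult.commute mult.left_commute)
  then have "2 * (real (card ?N) * real n ^ h) \<le> \<beta> * real n ^ (2 * h)"
    using n by (simp only: mult_le_cancel_left_pos of_nat_0_less_iff)
  then show ?thesis
    using 1 assms(2) by linarith
qed

definition present_edge :: "((nat + nat) \<times> (nat + nat) \<Rightarrow> bool) \<Rightarrow> nat \<Rightarrow> nat \<Rightarrow> bool" where
  "present_edge \<omega> a b \<longleftrightarrow> \<omega> (Inl a, Inr b)"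

text \<open>A union bound over the families. The factor 2 in the density hypothesis pays for
  discarding tuples with repetitions.\<close>

lemma prob_families_hit_ge:
  fixes h n :: nat and \<beta> K C p :: real
  assumes h: "h \<ge> 1" and \<beta>: "\<beta> > 0" and K: "K > 0"
    and C: "C \<ge> 1" "\<beta> * C \<ge> 2 * K" "\<beta>\<^sup>2 * C \<ge> 4 * K * (real h + 1) ^ (2 * h)"
    and n: "n \<ge> 1" "2 * (real h)\<^sup>2 \<le> \<beta> * real n"
    and p: "p \<ge> C * real n powr (- (2 * real h - 1) / (real h)\<^sup>2)" "p \<le> 1"
    and \<C>: "finite \<C>" "\<And>\<F>. \<F> \<in> \<C> \<Longrightarrow> \<F> \<subseteq> lists_of n h \<times> lists_of n h"
      "\<And>\<F>. \<F> \<in> \<C> \<Longrightarrow> 2 * \<beta> * real n ^ (2 * h) \<le> real (card \<F>)"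
  shows "1 - real (card \<C>) * exp (- K * real n) \<le>
    measure_pmf.prob (random_subset (part_A n \<times> part_B n) p)
      {\<omega>. \<forall>\<F>\<in>\<C>. \<exists>T\<in>\<F>. biclique n h (present_edge \<omega>) T}"
proof -
  let ?M = "random_subset (part_A n \<times> part_B n) p"
  let ?D = "\<lambda>\<F>. {T\<in>\<F>. distinct (fst T) \<and> distinct (snd T)}"
  define bad where "bad \<F> = {\<omega>. \<forall>T\<in>?D \<F>. \<not> (\<forall>e\<in>cross_pairs T. \<omega> e)}" for \<F>
  have "measure_pmf.prob ?M (\<Union>\<F>\<in>\<C>. bad \<F>) \<le> (\<Sum>\<F>\<in>\<C>. measure_pmf.prob ?M (bad \<F>))"
    using \<C>(1) by (intro measure_pmf.finite_measure_subadditive_finite) auto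
  also have "\<dots> \<le> (\<Sum>\<F>\<in>\<C>. exp (- K * real n))"
  proof (rule sum_mono)
    fix \<F> assume \<F>: "\<F> \<in> \<C>"
    show "measure_pmf.prob ?M (bad \<F>) \<le> exp (- K * real n)"
      unfolding bad_def
    proof (rule prob_no_member_of_dense_family[OF h \<beta> K C n(1) p])
      show "?D \<F> \<subseteq> {(as, bs). as \<in> lists_of n h \<and> bs \<in> lists_of n h \<and> distinct as \<and> distinct bs}"
        using \<C>(2)[OF \<F>] by auto
      show "\<beta> * real n ^ (2 * h) \<le> real (card (?D \<F>))"
        by (rule card_distinct_members_ge[OF \<C>(2,3) n]) (use \<F> in auto)
    qed
  qed
  finally have union: "measure_pmf.prob ?M (\<Union>\<F>\<in>\<C>. bad \<F>) \<le> real (card \<C>) * exp (- K * real n)"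
    by simp
  have "- (\<Union>\<F>\<in>\<C>. bad \<F>) \<subseteq> {\<omega>. \<forall>\<F>\<in>\<C>. \<exists>T\<in>\<F>. biclique n h (present_edge \<omega>) T}"
  proof clarify
    fix \<omega> \<F> assume "\<omega> \<notin> (\<Union>\<F>\<in>\<C>. bad \<F>)" "\<F> \<in> \<C>"
    then obtain T where T: "T \<in> ?D \<F>" "\<forall>e\<in>cross_pairs T. \<omega> e"
      unfolding bad_def by blast
    have "T \<in> lists_of n h \<times> lists_of n h"
      using T by (intro subsetD[OF \<C>(2)[OF \<open>\<F> \<in> \<C>\<close>]]) simp
    then have "biclique n h (present_edge \<omega>) T"
      using T unfolding biclique_def cross_pairs_def present_edge_def by auto
    then show "\<exists>T\<in>\<F>. biclique n h (present_edge \<omega>) T"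
      using T by blast
  qed
  then have "measure_pmf.prob ?M (- (\<Union>\<F>\<in>\<C>. bad \<F>)) \<le>
      measure_pmf.prob ?M {\<omega>. \<forall>\<F>\<in>\<C>. \<exists>T\<in>\<F>. biclique n h (present_edge \<omega>) T}"
    by (intro measure_pmf.finite_measure_mono) auto
  moreover have "measure_pmf.prob ?M (- (\<Union>\<F>\<in>\<C>. bad \<F>)) = 1 - measure_pmf.prob ?M (\<Union>\<F>\<in>\<C>. bad \<F>)"
    using measure_pmf.prob_compl[of "\<Union>\<F>\<in>\<C>. bad \<F>" ?M] by (simp add: Compl_eq_Diff_UNIV)
  ultimately show ?thesis
    using union by linarith
qed

section \<open>The families that must be hit: construction, density and number\<close>

definition transversals :: "nat set list \<Rightarrow> nat list set" where
  "transversals Xs = {xs. list_all2 (\<in>) xs Xs}"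

lemma transversals_card_ge:
  assumes "\<forall>X\<in>set Xs. finite X \<and> c \<le> real (card X)" "0 \<le> c"
  shows "finite (transversals Xs) \<and> c ^ length Xs \<le> real (card (transversals Xs))"
  using assms(1)
proof (induction Xs)
  case Nil
  have "transversals [] = {[]}" by (auto simp: transversals_def)
  then show ?case by simp
next
  case (Cons X Xs)
  have eq: "transversals (X # Xs) = (\<lambda>(x, xs). x # xs) ` (X \<times> transversals Xs)"
    by (auto simp: transversals_def list_all2_Cons2)
  have "inj_on (\<lambda>(x, xs). x # xs) (X \<times> transversals Xs)"
    by (auto simp: inj_on_def)
  then have "card (transversals (X # Xs)) = card X * card (transversals Xs)"
    unfolding eq by (simp add: card_image card_cartesian_product)
  moreover have "c * c ^ length Xs \<le> real (card X) * real (card (transversals Xs))"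
    using Cons assms(2) by (intro mult_mono) auto
  ultimately show ?case
    using Cons by (simp add: eq)
qed

text \<open>The candidates for the biclique in \<open>popular_rich\<close> before any random edge is
  required. Only the second side is restricted, because the vertices of \<open>W\<close> are to
  replace a vertex of the first side.\<close>

definition popular_family ::
    "nat \<Rightarrow> (nat \<Rightarrow> nat \<Rightarrow> bool) \<Rightarrow> real \<Rightarrow> nat set \<Rightarrow> nat set \<Rightarrow> nat set \<Rightarrow> (nat list \<times> nat list) set" where
  "popular_family h g c A B W = {as. set as \<subseteq> A \<and> length as = h} \<times>
     {bs. set bs \<subseteq> B \<and> length bs = h \<and> c \<le> real (card {w\<in>W. \<forall>b\<in>set bs. g w b})}"

text \<open>Double counting of pairs of a vertex w in \<open>W\<close> and an h-tuple of neighbours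
  of w in \<open>B\<close>. Since \<open>B\<close> misses at most \<open>\<alpha> n / 2\<close>
  vertices, there are at least 2 \<open>\<kappa>\<close> n^(h+1) such pairs. Tuples with fewer than
  \<open>\<kappa> n\<close> common neighbours account for at most half of them, and any other tuple
  for at most n. So at least \<open>\<kappa>\<close> n^h tuples are good, and the free choice in
  \<open>A\<close> contributes (n/2)^h.\<close>

lemma card_popular_family_ge:
  assumes n: "n \<ge> 1" and sub: "A \<subseteq> {..<n}" "B \<subseteq> {..<n}" "W \<subseteq> {..<n}"
    and A: "real n / 2 \<le> real (card A)" and B: "(1 - \<alpha> / 2) * real n \<le> real (card B)"
    and W: "\<eta> * real n \<le> real (card W)" and pos: "0 \<le> \<alpha>" "0 \<le> \<eta>"
    and deg: "\<And>v. v < n \<Longrightarrow> \<alpha> * real n \<le> real (card {b. b < n \<and> g v b})"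
    and \<kappa>: "\<kappa> = \<eta> * (\<alpha> / 2) ^ h / 2"
  shows "\<kappa> / 2 ^ h * real n ^ (2 * h) \<le> real (card (popular_family h g (\<kappa> * real n) A B W))"
proof -
  have fin: "finite A" "finite B" "finite W"
    using sub finite_subset[OF _ finite_lessThan] by auto
  let ?L = "{bs. set bs \<subseteq> B \<and> length bs = h}"
  define cnt where "cnt bs = card {w\<in>W. \<forall>b\<in>set bs. g w b}" for bs
  define good where "good = {bs \<in> ?L. \<kappa> * real n \<le> real (cnt bs)}"
  have finL: "finite ?L" using fin by (intro finite_lists_length_eq)
  have good_eq: "good = {bs. set bs \<subseteq> B \<and> length bs = h \<and> \<kappa> * real n \<le> real (card {w\<in>W. \<forall>b\<in>set bs. g w b})}"
    by (auto simp: good_def cnt_def)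
  have \<kappa>0: "0 \<le> \<kappa>" using pos by (simp add: \<kappa>)
  have cardB: "card B \<le> n" "card W \<le> n"
    using card_mono[OF finite_lessThan sub(2)] card_mono[OF finite_lessThan sub(3)] by simp_all
  have nbrs: "\<alpha> / 2 * real n \<le> real (card {b\<in>B. g w b})" if "w \<in> W" for w
  proof -
    have "card {b. b < n \<and> g w b} \<le> card ({b\<in>B. g w b} \<union> ({..<n} - B))"
      using fin by (intro card_mono) auto
    also have "\<dots> \<le> card {b\<in>B. g w b} + (n - card B)"
      using sub fin by (intro order_trans[OF card_Un_le]) (simp add: card_Diff_subset)
    finally have "real (card {b. b < n \<and> g w b}) \<le> real (card {b\<in>B. g w b}) + (real n - real (card B))"
      using cardB by linarith
    then show ?thesis
      using deg[of w] that sub(3) B by (auto simp: algebra_simps)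
  qed
  have "(\<Sum>bs\<in>?L. real (cnt bs)) = (\<Sum>bs\<in>?L. \<Sum>w\<in>W. of_bool (\<forall>b\<in>set bs. g w b))"
    using fin by (simp add: cnt_def Int_def)
  also have "\<dots> = (\<Sum>w\<in>W. \<Sum>bs\<in>?L. of_bool (\<forall>b\<in>set bs. g w b))"
    by (rule sum.swap)
  also have "\<dots> = (\<Sum>w\<in>W. real (card {b\<in>B. g w b} ^ h))"
  proof (rule sum.cong)
    fix w
    have "{bs \<in> ?L. \<forall>b\<in>set bs. g w b} = {bs. set bs \<subseteq> {b\<in>B. g w b} \<and> length bs = h}"
      by auto
    then have "card {bs \<in> ?L. \<forall>b\<in>set bs. g w b} = card {b\<in>B. g w b} ^ h"
      using fin by (simp only:) (intro card_lists_length_eq, simp)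
    moreover have "(\<Sum>bs\<in>?L. of_bool (\<forall>b\<in>set bs. g w b)) = real (card {bs \<in> ?L. \<forall>b\<in>set bs. g w b})"
      using finL by (simp add: Int_def)
    ultimately show "(\<Sum>bs\<in>?L. of_bool (\<forall>b\<in>set bs. g w b)) = real (card {b\<in>B. g w b} ^ h)"
      by simp
  qed simp
  also have "\<dots> \<ge> (\<Sum>w\<in>W. (\<alpha> / 2 * real n) ^ h)"
    unfolding of_nat_power using nbrs pos by (intro sum_mono power_mono) auto
  finally have "real (card W) * (\<alpha> / 2 * real n) ^ h \<le> (\<Sum>bs\<in>?L. real (cnt bs))"
    by simp
  moreover have "(\<eta> * real n) * (\<alpha> / 2 * real n) ^ h \<le> real (card W) * (\<alpha> / 2 * real n) ^ h"
    using W pos by (intro mult_right_mono) auto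
  moreover have "(\<eta> * real n) * (\<alpha> / 2 * real n) ^ h = 2 * \<kappa> * real n * real n ^ h"
    by (simp add: \<kappa> power_mult_distrib power_divide)
  \<comment> \<open>A reverse Markov bound: every tuple is charged \<open>\<kappa> n\<close>, and
    only good ones may carry up to n more.\<close>
  moreover have "(\<Sum>bs\<in>?L. real (cnt bs)) \<le> (\<Sum>bs\<in>?L. \<kappa> * real n + of_bool (bs \<in> good) * real n)"
  proof (rule sum_mono)
    fix bs assume bs: "bs \<in> ?L"
    have "cnt bs \<le> card W"
      unfolding cnt_def by (rule card_mono[OF fin(3)]) auto
    then have cnt: "real (cnt bs) \<le> real n"
      using cardB by simp
    have "0 \<le> \<kappa> * real n"
      using \<kappa>0 by simp
    moreover have "real (cnt bs) \<le> \<kappa> * real n" if "bs \<notin> good"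
      using that bs unfolding good_def by simp
    ultimately show "real (cnt bs) \<le> \<kappa> * real n + of_bool (bs \<in> good) * real n"
      using cnt by (cases "bs \<in> good") simp_all
  qed
  moreover have "(\<Sum>bs\<in>?L. \<kappa> * real n + of_bool (bs \<in> good) * real n) =
      real (card ?L) * (\<kappa> * real n) + real (card good) * real n"
  proof -
    have "(\<Sum>bs\<in>?L. of_bool (bs \<in> good) * real n) = real (card (?L \<inter> good)) * real n"
      using finL by (simp add: sum_distrib_right[symmetric] Int_def)
    moreover have "?L \<inter> good = good" by (auto simp: good_def)
    ultimately show ?thesis by (simp add: sum.distrib)
  qed
  moreover have "real (card ?L) * (\<kappa> * real n) \<le> real n ^ h * (\<kappa> * real n)"
  proof (intro mult_right_mono)
    have "card ?L \<le> n ^ h"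
      using cardB fin by (simp add: card_lists_length_eq power_mono)
    then have "real (card ?L) \<le> real (n ^ h)" by (simp only: of_nat_le_iff)
    then show "real (card ?L) \<le> real n ^ h" by simp
  qed (use \<kappa>0 in auto)
  ultimately have "2 * \<kappa> * real n * real n ^ h \<le> real n ^ h * (\<kappa> * real n) + real (card good) * real n"
    by linarith
  then have "real n * (\<kappa> * real n ^ h) \<le> real n * real (card good)"
    by (simp add: algebra_simps)
  then have good: "\<kappa> * real n ^ h \<le> real (card good)"
    using n by (simp add: mult_le_cancel_left_pos)
  have "(real n / 2) ^ h \<le> real (card {as. set as \<subseteq> A \<and> length as = h})"
    using A fin by (simp add: card_lists_length_eq power_mono)
  then have "(real n / 2) ^ h * (\<kappa> * real n ^ h) \<le>
      real (card {as. set as \<subseteq> A \<and> length as = h}) * real (card good)"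
    using good \<kappa>0 by (intro mult_mono) auto
  moreover have "\<kappa> / 2 ^ h * real n ^ (2 * h) = (real n / 2) ^ h * (\<kappa> * real n ^ h)"
    unfolding mult_2[of h] power_add power_divide by simp
  ultimately show ?thesis
    unfolding popular_family_def good_eq by (simp only: card_cartesian_product of_nat_mult)
qed

text \<open>One family for each instance of \<open>rich\<close>, of \<open>popular_rich\<close>, and
  of \<open>popular_rich\<close> with the parts exchanged. None of them refers to the random graph,
  so the union bound also covers sets that are chosen depending on it.\<close>

definition test_families ::
    "nat \<Rightarrow> nat \<Rightarrow> (nat \<Rightarrow> nat \<Rightarrow> bool) \<Rightarrow> real \<Rightarrow> real \<Rightarrow> real \<Rightarrow> real \<Rightarrow> (nat list \<times> nat list) set set" where
  "test_families n h g \<epsilon> \<alpha> \<eta> \<kappa> =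
     (let big = {X \<in> Pow {..<n}. \<epsilon> * real n \<le> real (card X)};
          triples = {(A, B, W). A \<subseteq> {..<n} \<and> B \<subseteq> {..<n} \<and> W \<subseteq> {..<n} \<and> real n / 2 \<le> real (card A) \<and>
            (1 - \<alpha> / 2) * real n \<le> real (card B) \<and> \<eta> * real n \<le> real (card W)}
      in (\<lambda>(Xs, Ys). transversals Xs \<times> transversals Ys) `
           ({Xs. set Xs \<subseteq> big \<and> length Xs = h} \<times> {Ys. set Ys \<subseteq> big \<and> length Ys = h}) \<union>
         (\<lambda>(A, B, W). popular_family h g (\<kappa> * real n) A B W) ` triples \<union>
         (\<lambda>(A, B, W). prod.swap ` popular_family h (\<lambda>a b. g b a) (\<kappa> * real n) A B W) ` triples)"

text \<open>Each vertex set has at most 2^n values. A transversal family is given by 2h sets, a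
  popular one by three, so 2h+3 sets bound each kind. The remaining factor 2^(2n) absorbs the sum
  over the three kinds, and finally 2 is replaced by e.\<close>

lemma test_families_finite_card:
  assumes "n \<ge> 1"
  shows "finite (test_families n h g \<epsilon> \<alpha> \<eta> \<kappa>) \<and>
    real (card (test_families n h g \<epsilon> \<alpha> \<eta> \<kappa>)) \<le> exp (real (2 * h + 5) * real n)"
proof -
  define big where "big = {X \<in> Pow {..<n}. \<epsilon> * real n \<le> real (card X)}"
  define triples where "triples = {(A, B, W). A \<subseteq> {..<n} \<and> B \<subseteq> {..<n} \<and> W \<subseteq> {..<n} \<and> real n / 2 \<le> real (card A) \<and>
            (1 - \<alpha> / 2) * real n \<le> real (card B) \<and> \<eta> * real n \<le> real (card W)}"
  define Ls where "Ls = {Xs. set Xs \<subseteq> big \<and> length Xs = h}"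
  have fin_big: "finite big" and card_big: "card big \<le> 2 ^ n"
  proof -
    show "finite big" by (simp add: big_def)
    have "card big \<le> card (Pow {..<n})"
      unfolding big_def by (intro card_mono) auto
    then show "card big \<le> 2 ^ n" by (simp add: card_Pow)
  qed
  have finLs: "finite Ls" and cardLs: "card Ls \<le> (2 ^ n) ^ h"
    unfolding Ls_def using fin_big card_big
    by (simp_all add: finite_lists_length_eq card_lists_length_eq power_mono)
  have sub: "triples \<subseteq> Pow {..<n} \<times> Pow {..<n} \<times> Pow {..<n}"
    by (auto simp: triples_def)
  have fint: "finite triples"
    by (rule finite_subset[OF sub]) auto
  have cardt: "card triples \<le> 2 ^ n * (2 ^ n * 2 ^ n)"
    using card_mono[OF _ sub] by (simp add: card_cartesian_product card_Pow)
  have eq: "test_families n h g \<epsilon> \<alpha> \<eta> \<kappa> =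
      (\<lambda>(Xs, Ys). transversals Xs \<times> transversals Ys) ` (Ls \<times> Ls) \<union>
         (\<lambda>(A, B, W). popular_family h g (\<kappa> * real n) A B W) ` triples \<union>
         (\<lambda>(A, B, W). prod.swap ` popular_family h (\<lambda>a b. g b a) (\<kappa> * real n) A B W) ` triples"
    unfolding test_families_def Let_def big_def[symmetric] triples_def[symmetric] Ls_def[symmetric] ..
  have "card (test_families n h g \<epsilon> \<alpha> \<eta> \<kappa>) \<le> card (Ls \<times> Ls) + card triples + card triples"
    unfolding eq
    by (intro order_trans[OF card_Un_le] add_mono card_image_le finite_cartesian_product finLs fint)
  also have "\<dots> \<le> (2 ^ n) ^ h * (2 ^ n) ^ h + 2 ^ n * (2 ^ n * 2 ^ n) + 2 ^ n * (2 ^ n * 2 ^ n)"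
    unfolding card_cartesian_product using cardLs cardt by (intro add_mono mult_mono) auto
  also have "\<dots> \<le> 2 ^ (n * (2 * h + 3)) + 2 ^ (n * (2 * h + 3)) + 2 ^ (n * (2 * h + 3))"
  proof -
    have "(2 ^ n) ^ h * (2 ^ n) ^ h = (2 :: nat) ^ (n * (2 * h))"
      by (simp add: power_mult[symmetric] power_add[symmetric] algebra_simps)
    moreover have "2 ^ n * (2 ^ n * 2 ^ n) = (2 :: nat) ^ (n * 3)"
      by (simp add: power_add[symmetric])
    ultimately show ?thesis
      by (auto intro!: add_mono power_increasing)
  qed
  also have "\<dots> \<le> 2 ^ (n * 2) * 2 ^ (n * (2 * h + 3))"
  proof -
    have "(2 :: nat) ^ (1 * 2) \<le> 2 ^ (n * 2)"
      using assms by (intro power_increasing mult_le_mono1) auto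
    then have "(3 :: nat) \<le> 2 ^ (n * 2)" by simp
    then have "3 * 2 ^ (n * (2 * h + 3)) \<le> (2 :: nat) ^ (n * 2) * 2 ^ (n * (2 * h + 3))"
      by (rule mult_le_mono1)
    then show ?thesis by linarith
  qed
  also have "\<dots> = 2 ^ (n * (2 * h + 5))"
    by (simp add: power_add[symmetric] algebra_simps)
  finally have "real (card (test_families n h g \<epsilon> \<alpha> \<eta> \<kappa>)) \<le> real (2 ^ (n * (2 * h + 5)))"
    by (simp only: of_nat_le_iff)
  also have "\<dots> = 2 ^ (n * (2 * h + 5))" by simp
  also have "\<dots> \<le> exp 1 ^ (n * (2 * h + 5))"
    using exp_ge_add_one_self[of 1] by (intro power_mono) auto
  also have "\<dots> = exp (real (2 * h + 5) * real n)"
    by (simp add: exp_of_nat_mult[symmetric] mult.commute)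
  finally show ?thesis
    unfolding eq using finLs fint by auto
qed

lemma test_families_dense:
  assumes n: "n \<ge> 1" and pos: "0 < \<epsilon>" "0 \<le> \<alpha>" "0 \<le> \<eta>"
    and deg: "\<And>v. v < n \<Longrightarrow> \<alpha> * real n \<le> real (card {b. b < n \<and> g v b})"
      "\<And>v. v < n \<Longrightarrow> \<alpha> * real n \<le> real (card {a. a < n \<and> g a v})"
    and \<kappa>: "\<kappa> = \<eta> * (\<alpha> / 2) ^ h / 2"
    and \<beta>: "2 * \<beta> \<le> \<epsilon> ^ (2 * h)" "2 * \<beta> \<le> \<kappa> / 2 ^ h"
    and \<F>: "\<F> \<in> test_families n h g \<epsilon> \<alpha> \<eta> \<kappa>"
  shows "\<F> \<subseteq> lists_of n h \<times> lists_of n h" "2 * \<beta> * real n ^ (2 * h) \<le> real (card \<F>)"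
proof -
  have "\<F> \<subseteq> lists_of n h \<times> lists_of n h \<and> 2 * \<beta> * real n ^ (2 * h) \<le> real (card \<F>)"
    using \<F> unfolding test_families_def Let_def
  proof (elim UnE imageE)
    fix z assume \<F>: "\<F> = (case z of (Xs, Ys) \<Rightarrow> transversals Xs \<times> transversals Ys)"
      and z: "z \<in> {Xs. set Xs \<subseteq> {X \<in> Pow {..<n}. \<epsilon> * real n \<le> real (card X)} \<and> length Xs = h} \<times>
        {Ys. set Ys \<subseteq> {X \<in> Pow {..<n}. \<epsilon> * real n \<le> real (card X)} \<and> length Ys = h}"
    obtain Xs Ys where z_eq: "z = (Xs, Ys)" by (cases z)
    have trans: "transversals Zs \<subseteq> lists_of n h \<and> (\<epsilon> * real n) ^ h \<le> real (card (transversals Zs))"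
      if Zs: "set Zs \<subseteq> {X \<in> Pow {..<n}. \<epsilon> * real n \<le> real (card X)}" "length Zs = h" for Zs
    proof
      show "transversals Zs \<subseteq> lists_of n h"
      proof
        fix xs assume "xs \<in> transversals Zs"
        then have xs: "length xs = h" "\<forall>l<h. xs ! l \<in> Zs ! l"
          using Zs by (auto simp: transversals_def list_all2_conv_all_nth)
        have "xs ! l < n" if "l < h" for l
          using xs(2) that Zs nth_mem[of l Zs] by blast
        then show "xs \<in> lists_of n h"
          using xs(1) by (auto simp: set_conv_nth)
      qed
      have "\<forall>X\<in>set Zs. finite X \<and> \<epsilon> * real n \<le> real (card X)"
        using Zs(1) finite_subset[OF _ finite_lessThan] by blast
      then show "(\<epsilon> * real n) ^ h \<le> real (card (transversals Zs))"
        using transversals_card_ge[of Zs "\<epsilon> * real n"] pos Zs(2) by auto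
    qed
    have X: "transversals Xs \<subseteq> lists_of n h" "(\<epsilon> * real n) ^ h \<le> real (card (transversals Xs))"
      and Y: "transversals Ys \<subseteq> lists_of n h" "(\<epsilon> * real n) ^ h \<le> real (card (transversals Ys))"
      using trans[of Xs] trans[of Ys] z z_eq by auto
    have "2 * \<beta> * real n ^ (2 * h) \<le> \<epsilon> ^ (2 * h) * real n ^ (2 * h)"
      using \<beta> by (intro mult_right_mono) auto
    also have "\<dots> = (\<epsilon> * real n) ^ h * (\<epsilon> * real n) ^ h"
      unfolding mult_2[of h] power_add power_mult_distrib by simp
    also have "\<dots> \<le> real (card (transversals Xs)) * real (card (transversals Ys))"
      using X Y pos by (intro mult_mono) auto
    finally show ?thesis
      using X Y by (auto simp: \<F> z_eq card_cartesian_product)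
  next
    fix z assume \<F>: "\<F> = (case z of (A, B, W) \<Rightarrow> popular_family h g (\<kappa> * real n) A B W)"
      and z: "z \<in> {(A, B, W). A \<subseteq> {..<n} \<and> B \<subseteq> {..<n} \<and> W \<subseteq> {..<n} \<and> real n / 2 \<le> real (card A) \<and>
            (1 - \<alpha> / 2) * real n \<le> real (card B) \<and> \<eta> * real n \<le> real (card W)}"
    obtain A B W where z_eq: "z = (A, B, W)" by (cases z)
    have "2 * \<beta> * real n ^ (2 * h) \<le> \<kappa> / 2 ^ h * real n ^ (2 * h)"
      using \<beta> by (intro mult_right_mono) auto
    also have "\<dots> \<le> real (card \<F>)"
      using card_popular_family_ge[OF n _ _ _ _ _ _ pos(2,3) deg(1) \<kappa>, of A B W] z
      by (simp add: \<F> z_eq)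
    finally show ?thesis
      using z by (auto simp: \<F> z_eq popular_family_def)
  next
    fix z assume \<F>: "\<F> = (case z of (A, B, W) \<Rightarrow> prod.swap ` popular_family h (\<lambda>a b. g b a) (\<kappa> * real n) A B W)"
      and z: "z \<in> {(A, B, W). A \<subseteq> {..<n} \<and> B \<subseteq> {..<n} \<and> W \<subseteq> {..<n} \<and> real n / 2 \<le> real (card A) \<and>
            (1 - \<alpha> / 2) * real n \<le> real (card B) \<and> \<eta> * real n \<le> real (card W)}"
    obtain A B W where z_eq: "z = (A, B, W)" by (cases z)
    have "2 * \<beta> * real n ^ (2 * h) \<le> \<kappa> / 2 ^ h * real n ^ (2 * h)"
      using \<beta> by (intro mult_right_mono) auto
    also have "\<dots> \<le> real (card (popular_family h (\<lambda>a b. g b a) (\<kappa> * real n) A B W))"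
      using card_popular_family_ge[OF n _ _ _ _ _ _ pos(2,3) deg(2) \<kappa>, of A B W] z
      by (simp add: z_eq)
    also have "\<dots> = real (card \<F>)"
    proof -
      have "inj_on prod.swap (popular_family h (\<lambda>a b. g b a) (\<kappa> * real n) A B W)"
        by (rule inj_onI) (metis swap_swap)
      then show ?thesis by (simp add: \<F> z_eq card_image)
    qed
    finally show ?thesis
      using z by (auto simp: \<F> z_eq popular_family_def)
  qed
  then show "\<F> \<subseteq> lists_of n h \<times> lists_of n h" "2 * \<beta> * real n ^ (2 * h) \<le> real (card \<F>)"
    by auto
qed

lemma test_families_hit:
  assumes hit: "\<forall>\<F>\<in>test_families n h g \<epsilon> \<alpha> \<eta> \<kappa>. \<exists>T\<in>\<F>. biclique n h r T"
  shows "rich n h r \<epsilon>" "popular_rich n h g r \<alpha> \<eta> \<kappa>"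
    "popular_rich n h (\<lambda>a b. g b a) (\<lambda>a b. r b a) \<alpha> \<eta> \<kappa>"
proof -
  note hit' = hit[unfolded test_families_def Let_def, rule_format]
  show "rich n h r \<epsilon>"
    unfolding rich_def
  proof (intro allI impI)
    fix X Y :: "nat \<Rightarrow> nat set"
    assume XY: "\<forall>l<h. X l \<subseteq> {..<n} \<and> Y l \<subseteq> {..<n} \<and>
       \<epsilon> * real n \<le> real (card (X l)) \<and> \<epsilon> * real n \<le> real (card (Y l))"
    have "\<exists>T\<in>transversals (map X [0..<h]) \<times> transversals (map Y [0..<h]). biclique n h r T"
      by (rule hit', rule UnI1, rule UnI1, rule image_eqI[of _ _ "(map X [0..<h], map Y [0..<h])"])
         (use XY in auto)
    then obtain T where "T \<in> transversals (map X [0..<h]) \<times> transversals (map Y [0..<h])" "biclique n h r T"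
      by blast
    then show "\<exists>T. biclique n h r T \<and> (\<forall>l<h. fst T ! l \<in> X l \<and> snd T ! l \<in> Y l)"
      by (intro exI[of _ T]) (auto simp: transversals_def list_all2_conv_all_nth)
  qed
  show "popular_rich n h g r \<alpha> \<eta> \<kappa>"
    unfolding popular_rich_def
  proof (intro allI impI)
    fix A B W
    assume ABW: "A \<subseteq> {..<n} \<and> B \<subseteq> {..<n} \<and> W \<subseteq> {..<n} \<and>
       real n / 2 \<le> real (card A) \<and> (1 - \<alpha> / 2) * real n \<le> real (card B) \<and> \<eta> * real n \<le> real (card W)"
    have "\<exists>T\<in>popular_family h g (\<kappa> * real n) A B W. biclique n h r T"
      by (rule hit', rule UnI1, rule UnI2, rule image_eqI[of _ _ "(A, B, W)"]) (use ABW in auto)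
    then show "\<exists>T. biclique n h r T \<and> set (fst T) \<subseteq> A \<and> set (snd T) \<subseteq> B \<and>
        \<kappa> * real n \<le> real (card {w \<in> W. \<forall>b\<in>set (snd T). g w b})"
      by (auto simp: popular_family_def)
  qed
  show "popular_rich n h (\<lambda>a b. g b a) (\<lambda>a b. r b a) \<alpha> \<eta> \<kappa>"
    unfolding popular_rich_def
  proof (intro allI impI)
    fix A B W
    assume ABW: "A \<subseteq> {..<n} \<and> B \<subseteq> {..<n} \<and> W \<subseteq> {..<n} \<and>
       real n / 2 \<le> real (card A) \<and> (1 - \<alpha> / 2) * real n \<le> real (card B) \<and> \<eta> * real n \<le> real (card W)"
    have "\<exists>T\<in>prod.swap ` popular_family h (\<lambda>a b. g b a) (\<kappa> * real n) A B W. biclique n h r T"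
      by (rule hit', rule UnI2, rule image_eqI[of _ _ "(A, B, W)"]) (use ABW in auto)
    then obtain T where T: "T \<in> popular_family h (\<lambda>a b. g b a) (\<kappa> * real n) A B W" "biclique n h r (prod.swap T)"
      by blast
    have "biclique n h (\<lambda>a b. r b a) T"
      using biclique_swap[OF T(2)] by simp
    then show "\<exists>T. biclique n h (\<lambda>a b. r b a) T \<and> set (fst T) \<subseteq> A \<and> set (snd T) \<subseteq> B \<and>
        \<kappa> * real n \<le> real (card {w \<in> W. \<forall>b\<in>set (snd T). g b w})"
      using T(1) by (auto simp: popular_family_def)
  qed
qed

section \<open>The threshold\<close>

lemma eventually_multiples_at_top:
  "eventually P (multiples_at_top h) \<longleftrightarrow> (\<forall>\<^sub>F n in sequentially. h dvd n \<longrightarrow> P n)"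
  unfolding multiples_at_top_def by (simp add: eventually_inf_principal)

lemma whp_multiplesI:
  assumes "\<forall>\<^sub>F n in multiples_at_top h. 1 - f n \<le> measure_pmf.prob (\<mu> n) {x. P n x}"
    and "f \<longlonglongrightarrow> 0"
  shows "whp (multiples_at_top h) \<mu> P"
  unfolding whp_def
proof (rule tendsto_sandwich[OF assms(1), where h = "\<lambda>_. 1"])
  have "(f \<longlongrightarrow> 0) (multiples_at_top h)"
    using assms(2) by (rule tendsto_mono[rotated]) (simp add: multiples_at_top_def)
  then have "((\<lambda>n. 1 - f n) \<longlongrightarrow> 1 - 0) (multiples_at_top h)"
    by (intro tendsto_intros)
  then show "((\<lambda>n. 1 - f n) \<longlongrightarrow> 1) (multiples_at_top h)"
    by simp
qed (auto intro!: always_eventually)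

definition bipartite_of :: "nat \<Rightarrow> ((nat + nat) \<times> (nat + nat) \<Rightarrow> bool) \<Rightarrow> (nat + nat) graph" where
  "bipartite_of n \<omega> = \<lparr>verts = part_A n \<union> part_B n,
     edges = {{a, b} | a b. a \<in> part_A n \<and> b \<in> part_B n \<and> \<omega> (a, b)}\<rparr>"

lemma prob_random_bipartite:
  "measure_pmf.prob (random_bipartite n p) {R. P R} =
   measure_pmf.prob (random_subset (part_A n \<times> part_B n) p) {\<omega>. P (bipartite_of n \<omega>)}"
  unfolding random_bipartite_def bipartite_of_def by (simp add: vimage_def)

lemma edges_bipartite_of:
  "{Inl a, Inr b} \<in> edges (bipartite_of n \<omega>) \<longleftrightarrow> a < n \<and> b < n \<and> present_edge \<omega> a b"
  by (auto simp: bipartite_of_def part_A_def part_B_def present_edge_def doubleton_eq_iff)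

section \<open>Above the threshold: existence of a perfect tiling\<close>

lemma min_degree_neighbours:
  assumes G: "bipartite_graph (part_A n) (part_B n) G" and n: "n \<ge> 1" and v: "v < n"
  shows "min_degree G \<le> card {b. b < n \<and> {Inl v, Inr b} \<in> edges G}"
    and "min_degree G \<le> card {a. a < n \<and> {Inl a, Inr v} \<in> edges G}"
proof -
  have fin: "finite (verts G)" and verts: "verts G = part_A n \<union> part_B n"
    using G by (auto simp: bipartite_graph_def simple_graph_def)
  have edges: "\<exists>a<n. \<exists>b<n. e = {Inl a, Inr b}" if "e \<in> edges G" for e
  proof -
    have "\<exists>a\<in>part_A n. \<exists>b\<in>part_B n. e = {a, b}"
      using G that by (simp add: bipartite_graph_def)
    then show ?thesis by (auto simp: part_A_def part_B_def)
  qed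
  have "min_degree G \<le> degree G (Inl v)" "min_degree G \<le> degree G (Inr v)"
    unfolding min_degree_def using fin v by (auto intro!: Min_le simp: verts part_A_def part_B_def)
  moreover have "degree G (Inl v) \<le> card ((\<lambda>b. {Inl v, Inr b :: nat + nat}) ` {b. b < n \<and> {Inl v, Inr b} \<in> edges G})"
    unfolding degree_def
  proof (intro card_mono subsetI)
    fix e assume e: "e \<in> {e \<in> edges G. Inl v \<in> e}"
    then obtain a b where "a < n" "b < n" "e = {Inl a, Inr b}"
      using edges by blast
    with e show "e \<in> (\<lambda>b. {Inl v, Inr b}) ` {b. b < n \<and> {Inl v, Inr b} \<in> edges G}"
      by auto
  qed simp
  moreover have "degree G (Inr v) \<le> card ((\<lambda>a. {Inl a, Inr v :: nat + nat}) ` {a. a < n \<and> {Inl a, Inr v} \<in> edges G})"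
    unfolding degree_def
  proof (intro card_mono subsetI)
    fix e assume e: "e \<in> {e \<in> edges G. Inr v \<in> e}"
    then obtain a b where "a < n" "b < n" "e = {Inl a, Inr b}"
      using edges by blast
    with e show "e \<in> (\<lambda>a. {Inl a, Inr v}) ` {a. a < n \<and> {Inl a, Inr v} \<in> edges G}"
      by auto
  qed simp
  moreover have "card ((\<lambda>b. {Inl v, Inr b :: nat + nat}) ` {b. b < n \<and> {Inl v, Inr b} \<in> edges G}) \<le>
      card {b. b < n \<and> {Inl v, Inr b} \<in> edges G}"
    by (intro card_image_le) simp
  moreover have "card ((\<lambda>a. {Inl a, Inr v :: nat + nat}) ` {a. a < n \<and> {Inl a, Inr v} \<in> edges G}) \<le>
      card {a. a < n \<and> {Inl a, Inr v} \<in> edges G}"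
    by (intro card_image_le) simp
  ultimately show "min_degree G \<le> card {b. b < n \<and> {Inl v, Inr b} \<in> edges G}"
    "min_degree G \<le> card {a. a < n \<and> {Inl a, Inr v} \<in> edges G}"
    by linarith+
qed

lemma perfect_tiling_whp:
  fixes h :: nat and \<alpha> :: real
  assumes h: "h \<ge> 1" and \<alpha>: "0 < \<alpha>" "\<alpha> \<le> 1"
  obtains C where "C > 0" and "\<And>p G. (\<And>n. 0 \<le> p n \<and> p n \<le> 1) \<Longrightarrow>
    \<forall>\<^sub>F n in multiples_at_top h. p n \<ge> C * real n powr (- (2 * real h - 1) / (real h)\<^sup>2) \<Longrightarrow>
    dense_bipartite_seq h \<alpha> G \<Longrightarrow>
    whp (multiples_at_top h) (\<lambda>n. random_bipartite n (p n))
      (\<lambda>n R. has_perfect_tiling (complete_bipartite h h) (graph_union (G n) R))"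
proof -
  \<comment> \<open>With this \<open>\<eta>\<close> the exceptional vertices take
    \<open>\<alpha> n / 4\<close> of the budget in \<open>ex_perfect_cover\<close>, and k of about
    \<open>\<alpha> n / (8 h)\<close> bicliques per packing take the other
    \<open>\<alpha> n / 4\<close>. The value of \<open>\<kappa>\<close> comes from
    \<open>card_popular_family_ge\<close>, and \<open>\<epsilon>\<close> makes 2
    \<open>\<epsilon> n\<close> about half of \<open>\<kappa> k\<close>.\<close>
  define \<eta> where "\<eta> = \<alpha> / (8 * real h)"
  define \<kappa> where "\<kappa> = \<eta> * (\<alpha> / 2) ^ h / 2"
  define \<epsilon> where "\<epsilon> = \<kappa> * \<alpha> / (32 * real h)"
  define \<beta> where "\<beta> = min (\<epsilon> ^ (2 * h)) (\<kappa> / 2 ^ h) / 2"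
  \<comment> \<open>One more than the constant 2h+5 in the exponent for the number of test families,
    so the union bound leaves exp(-n). C is the least value that meets the requirements of
    \<open>prob_families_hit_ge\<close>.\<close>
  define K where "K = real (2 * h + 6)"
  define C where "C = max 1 (max (2 * K / \<beta>) (4 * K * (real h + 1) ^ (2 * h) / \<beta>\<^sup>2))"
  have hr: "real h \<ge> 1" using h by simp
  have \<eta>: "0 < \<eta>" "\<eta> \<le> 1"
    using \<alpha> hr by (auto simp: \<eta>_def field_simps)
  have \<kappa>: "0 < \<kappa>" "\<kappa> \<le> 1"
  proof -
    show "0 < \<kappa>" using \<eta> \<alpha> by (simp add: \<kappa>_def)
    have "(\<alpha> / 2) ^ h \<le> 1" using \<alpha> by (intro power_le_one) auto
    then have "\<eta> * (\<alpha> / 2) ^ h \<le> 1 * 1" using \<eta> \<alpha> by (intro mult_mono) auto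
    then show "\<kappa> \<le> 1" by (simp add: \<kappa>_def)
  qed
  have \<epsilon>: "0 < \<epsilon>" "\<epsilon> \<le> \<alpha> / 2"
  proof -
    show "0 < \<epsilon>" using \<kappa> \<alpha> hr by (simp add: \<epsilon>_def)
    have "\<kappa> * \<alpha> / (32 * real h) \<le> \<alpha> / (32 * real h)"
      using \<kappa> \<alpha> hr by (intro divide_right_mono) auto
    also have "\<dots> \<le> \<alpha> / 2"
      using \<alpha> hr by (intro divide_left_mono) auto
    finally show "\<epsilon> \<le> \<alpha> / 2" by (simp add: \<epsilon>_def)
  qed
  have \<beta>: "0 < \<beta>" "2 * \<beta> \<le> \<epsilon> ^ (2 * h)" "2 * \<beta> \<le> \<kappa> / 2 ^ h"
    using \<epsilon> \<kappa> by (auto simp: \<beta>_def)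
  have K: "0 < K" by (simp add: K_def)
  have C: "1 \<le> C" "2 * K \<le> \<beta> * C" "4 * K * (real h + 1) ^ (2 * h) \<le> \<beta>\<^sup>2 * C"
  proof -
    show "1 \<le> C" by (simp add: C_def)
    have "2 * K / \<beta> \<le> C" "4 * K * (real h + 1) ^ (2 * h) / \<beta>\<^sup>2 \<le> C"
      by (auto simp: C_def)
    then show "2 * K \<le> \<beta> * C" "4 * K * (real h + 1) ^ (2 * h) \<le> \<beta>\<^sup>2 * C"
      using \<beta>(1) by (simp_all add: pos_divide_le_eq mult.commute)
  qed
  show ?thesis
  proof (rule that[of C])
    show "C > 0" using C by simp
    fix p :: "nat \<Rightarrow> real" and G
    assume p01: "\<And>n. 0 \<le> p n \<and> p n \<le> 1"
      and p: "\<forall>\<^sub>F n in multiples_at_top h. p n \<ge> C * real n powr (- (2 * real h - 1) / (real h)\<^sup>2)"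
      and G: "dense_bipartite_seq h \<alpha> G"
    show "whp (multiples_at_top h) (\<lambda>n. random_bipartite n (p n))
      (\<lambda>n R. has_perfect_tiling (complete_bipartite h h) (graph_union (G n) R))"
    proof (rule whp_multiplesI)
      show "(\<lambda>n. exp (- real n)) \<longlonglongrightarrow> 0"
        by real_asymp
      have "\<forall>\<^sub>F n in sequentially. n \<ge> 1"
        by (rule eventually_ge_at_top)
      moreover have "\<forall>\<^sub>F n in sequentially. 2 * (real h)\<^sup>2 \<le> \<beta> * real n"
        using \<beta>(1) by real_asymp
      \<comment> \<open>The two sides allow for rounding: 1 is for the ceiling in m, and
        \<open>\<kappa>\<close> for the floor in k.\<close>
      moreover have "\<forall>\<^sub>F n in sequentially. 1 + \<kappa> < \<kappa> * (\<alpha> / (16 * real h)) * real n"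
        using \<kappa>(1) \<alpha>(1) hr by real_asymp
      moreover note p[unfolded eventually_multiples_at_top]
      ultimately show "\<forall>\<^sub>F n in multiples_at_top h. 1 - exp (- real n) \<le>
          measure_pmf.prob (random_bipartite n (p n))
            {R. has_perfect_tiling (complete_bipartite h h) (graph_union (G n) R)}"
        unfolding eventually_multiples_at_top
      proof eventually_elim
        case (elim n)
        show ?case
        proof
          assume "h dvd n"
          with elim(4) have pn: "p n \<ge> C * real n powr (- (2 * real h - 1) / (real h)\<^sup>2)"
            by blast
          have Gn: "bipartite_graph (part_A n) (part_B n) (G n)" "\<alpha> * real n \<le> real (min_degree (G n))"
            using G elim(1) \<open>h dvd n\<close> by (auto simp: dense_bipartite_seq_def)
          define g where "g a b \<longleftrightarrow> {Inl a, Inr b} \<in> edges (G n)" for a b :: nat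
          have deg: "\<alpha> * real n \<le> real (card {b. b < n \<and> g v b})" "\<alpha> * real n \<le> real (card {a. a < n \<and> g a v})"
            if "v < n" for v
          proof -
            have "real (min_degree (G n)) \<le> real (card {b. b < n \<and> g v b})"
              "real (min_degree (G n)) \<le> real (card {a. a < n \<and> g a v})"
              using min_degree_neighbours[OF Gn(1) elim(1) that] unfolding g_def of_nat_le_iff by auto
            then show "\<alpha> * real n \<le> real (card {b. b < n \<and> g v b})" "\<alpha> * real n \<le> real (card {a. a < n \<and> g a v})"
              using Gn(2) by linarith+
          qed
          define \<C> where "\<C> = test_families n h g \<epsilon> \<alpha> \<eta> \<kappa>"
          define k where "k = nat \<lfloor>\<alpha> * real n / (8 * real h)\<rfloor>"
          define m where "m = nat \<lceil>2 * \<epsilon> * real n\<rceil>"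
          have k: "real k \<le> \<alpha> * real n / (8 * real h)" "\<alpha> * real n / (8 * real h) - 1 < real k"
          proof -
            have "0 \<le> \<alpha> * real n / (8 * real h)" using \<alpha> by simp
            then show "real k \<le> \<alpha> * real n / (8 * real h)" "\<alpha> * real n / (8 * real h) - 1 < real k"
              unfolding k_def by linarith+
          qed
          have m: "2 * \<epsilon> * real n \<le> real m" "real m < 2 * \<epsilon> * real n + 1"
          proof -
            have "0 \<le> 2 * \<epsilon> * real n" using \<epsilon> by simp
            then show "2 * \<epsilon> * real n \<le> real m" "real m < 2 * \<epsilon> * real n + 1"
              unfolding m_def by linarith+
          qed
          have small: "2 * real h * real k + 2 * real h * \<eta> * real n \<le> \<alpha> * real n / 2"
          proof -
            have "2 * real h * real k \<le> 2 * real h * (\<alpha> * real n / (8 * real h))"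
              using k(1) by (intro mult_left_mono) auto
            also have "\<dots> = \<alpha> * real n / 4" using hr by simp
            finally have "2 * real h * real k \<le> \<alpha> * real n / 4" .
            moreover have "2 * real h * \<eta> * real n = \<alpha> * real n / 4"
              using hr by (simp add: \<eta>_def)
            ultimately show ?thesis by linarith
          qed
          have mk: "real m < \<kappa> * real k"
          proof -
            have "2 * \<epsilon> * real n = \<kappa> * (\<alpha> / (16 * real h)) * real n"
              by (simp add: \<epsilon>_def)
            moreover have "\<kappa> * (\<alpha> * real n / (8 * real h) - 1) \<le> \<kappa> * real k"
              using k(2) \<kappa> by (intro mult_left_mono) auto
            moreover have "\<kappa> * (\<alpha> * real n / (8 * real h) - 1) = 2 * (\<kappa> * (\<alpha> / (16 * real h)) * real n) - \<kappa>"
              by (simp add: algebra_simps)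
            ultimately show ?thesis using m(2) elim(3) by linarith
          qed
          have tiling: "has_perfect_tiling (complete_bipartite h h) (graph_union (G n) (bipartite_of n \<omega>))"
            if hit: "\<forall>\<F>\<in>\<C>. \<exists>T\<in>\<F>. biclique n h (present_edge \<omega>) T" for \<omega>
          proof (rule coverable_imp_perfect_tiling[OF h])
            note rich = test_families_hit[OF hit[unfolded \<C>_def]]
            show "coverable n h (\<lambda>a b. g a b \<or> present_edge \<omega> a b) (n div h) {..<n} {..<n}"
              by (rule ex_perfect_cover[OF h elim(1) \<open>h dvd n\<close> rich deg \<epsilon>(2) \<alpha>(2) small _ m(1) mk]) (use \<eta> in auto)
            show "h * (n div h) \<le> n" by simp
            show "verts (graph_union (G n) (bipartite_of n \<omega>)) = part_A n \<union> part_B n"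
              using Gn(1) by (simp add: graph_union_def bipartite_graph_def bipartite_of_def)
            show "{Inl a, Inr b} \<in> edges (graph_union (G n) (bipartite_of n \<omega>))"
              if "g a b \<or> present_edge \<omega> a b" "a < n" "b < n" for a b
              using that edges_bipartite_of[of a b n \<omega>] by (auto simp: graph_union_def g_def)
          qed
          note fc = test_families_finite_card[OF elim(1), of h g \<epsilon> \<alpha> \<eta> \<kappa>, folded \<C>_def]
          have "1 - exp (- real n) \<le> 1 - real (card \<C>) * exp (- K * real n)"
          proof -
            have "real (card \<C>) * exp (- K * real n) \<le> exp (real (2 * h + 5) * real n) * exp (- K * real n)"
              using fc by (intro mult_right_mono) auto
            also have "\<dots> = exp (- real n)"
              by (simp add: exp_add[symmetric] K_def algebra_simps)
            finally show ?thesis by simp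
          qed
          also have "\<dots> \<le> measure_pmf.prob (random_subset (part_A n \<times> part_B n) (p n))
              {\<omega>. \<forall>\<F>\<in>\<C>. \<exists>T\<in>\<F>. biclique n h (present_edge \<omega>) T}"
          proof (rule prob_families_hit_ge[OF h \<beta>(1) K C elim(1,2) pn])
            show "p n \<le> 1" using p01 by blast
            show "finite \<C>" using fc by blast
            fix \<F> assume \<F>: "\<F> \<in> \<C>"
            note dense = test_families_dense[OF elim(1) \<epsilon>(1) _ _ deg \<kappa>_def \<beta>(2,3) \<F>[unfolded \<C>_def]]
            show "\<F> \<subseteq> lists_of n h \<times> lists_of n h" "2 * \<beta> * real n ^ (2 * h) \<le> real (card \<F>)"
              using dense \<alpha> \<eta> by auto
          qed
          also have "\<dots> \<le> measure_pmf.prob (random_subset (part_A n \<times> part_B n) (p n))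
              {\<omega>. has_perfect_tiling (complete_bipartite h h) (graph_union (G n) (bipartite_of n \<omega>))}"
            using tiling by (intro measure_pmf.finite_measure_mono) auto
          finally show "1 - exp (- real n) \<le> measure_pmf.prob (random_bipartite n (p n))
            {R. has_perfect_tiling (complete_bipartite h h) (graph_union (G n) R)}"
            unfolding prob_random_bipartite .
        qed
      qed
    qed
  qed
qed

section \<open>Below the threshold: the extremal graph and the first moment bound\<close>

definition two_stars :: "nat \<Rightarrow> nat \<Rightarrow> (nat + nat) graph" where
  "two_stars n d = \<lparr>verts = part_A n \<union> part_B n,
     edges = {{Inl i, Inr j} | i j. i < n \<and> j < n \<and> (i < d \<or> j < d)}\<rparr>"

lemma two_stars_bipartite: "bipartite_graph (part_A n) (part_B n) (two_stars n d)"
  by (auto simp: bipartite_graph_def simple_graph_def two_stars_def part_A_def part_B_def)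

lemma edges_two_stars: "{Inl a, Inr b} \<in> edges (two_stars n d) \<longleftrightarrow> a < n \<and> b < n \<and> (a < d \<or> b < d)"
  by (auto simp: two_stars_def doubleton_eq_iff)

lemma two_stars_min_degree:
  assumes "n \<ge> 1" "d \<le> n"
  shows "d \<le> min_degree (two_stars n d)"
  unfolding min_degree_def
proof (rule Min.boundedI)
  show "finite (degree (two_stars n d) ` verts (two_stars n d))"
    by (simp add: two_stars_def part_A_def part_B_def)
  show "degree (two_stars n d) ` verts (two_stars n d) \<noteq> {}"
    using assms by (simp add: two_stars_def part_A_def lessThan_empty_iff)
  have fin: "finite (edges (two_stars n d))"
  proof (rule finite_subset)
    show "edges (two_stars n d) \<subseteq> Pow (part_A n \<union> part_B n)"
      by (auto simp: two_stars_def part_A_def part_B_def)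
  qed (simp add: part_A_def part_B_def)
  fix x assume "x \<in> degree (two_stars n d) ` verts (two_stars n d)"
  then obtain v where v: "v \<in> part_A n \<union> part_B n" "x = degree (two_stars n d) v"
    by (auto simp: two_stars_def)
  then consider a where "v = Inl a" "a < n" | b where "v = Inr b" "b < n"
    by (auto simp: part_A_def part_B_def)
  then show "d \<le> x"
  proof cases
    case 1
    have "card ((\<lambda>j. {v, Inr j}) ` {..<d}) \<le> degree (two_stars n d) v"
      unfolding degree_def using fin 1 assms by (intro card_mono) (auto simp: edges_two_stars)
    moreover have "card ((\<lambda>j. {v, Inr j}) ` {..<d}) = d"
      using 1 by (subst card_image) (auto simp: inj_on_def doubleton_eq_iff)
    ultimately show ?thesis using v by simp
  next
    case 2
    have "card ((\<lambda>i. {Inl i, v}) ` {..<d}) \<le> degree (two_stars n d) v"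
      unfolding degree_def using fin 2 assms by (intro card_mono) (auto simp: edges_two_stars)
    moreover have "card ((\<lambda>i. {Inl i, v}) ` {..<d}) = d"
      using 2 by (subst card_image) (auto simp: inj_on_def doubleton_eq_iff)
    ultimately show ?thesis using v by simp
  qed
qed

text \<open>An isomorphism may send the two sides of K_{h,h} to the parts of the host in either
  order. Since every vertex of one side is joined to every vertex of the other and all edges cross,
  each side lies within one part. The orientation of a single vertex decides between the two cases,
  and \<open>main\<close> treats one orientation for both.\<close>

lemma copy_imp_biclique:
  fixes F H :: "(nat + nat) graph"
  assumes h: "h \<ge> 1" and F: "subgraph F H" "isomorphic (complete_bipartite h h) F"
    and H: "\<And>e. e \<in> edges H \<Longrightarrow> \<exists>a<n. \<exists>b<n. e = {Inl a, Inr b}"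
  shows "\<exists>T. biclique n h (\<lambda>a b. {Inl a, Inr b} \<in> edges H) T \<and>
    verts F = Inl ` set (fst T) \<union> Inr ` set (snd T)"
proof -
  obtain f where f: "bij_betw f (part_A h \<union> part_B h) (verts F)"
    "edges F = (\<lambda>e. f ` e) ` edges (complete_bipartite h h)"
    using F(2) by (auto simp: isomorphic_def complete_bipartite_def)
  have main: ?thesis
    if u: "inj_on u {..<h}" "\<And>i. i < h \<Longrightarrow> isl (u i)" and w: "inj_on w {..<h}" "\<And>j. j < h \<Longrightarrow> \<not> isl (w j)"
      and uw: "\<And>i j. i < h \<Longrightarrow> j < h \<Longrightarrow> {u i, w j} \<in> edges H"
      and V: "verts F = u ` {..<h} \<union> w ` {..<h}" for u w :: "nat \<Rightarrow> nat + nat"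
  proof -
    define as where "as = map (projl \<circ> u) [0..<h]"
    define bs where "bs = map (projr \<circ> w) [0..<h]"
    have u_eq: "Inl (projl (u i)) = u i" and w_eq: "Inr (projr (w i)) = w i" if "i < h" for i
      using u(2)[OF that] w(2)[OF that] by simp_all
    have less: "projl (u i) < n" "projr (w j) < n" if ij: "i < h" "j < h" for i j
    proof -
      obtain a b where ab: "a < n" "b < n" "{u i, w j} = {Inl a, Inr b}"
        using H[OF uw[OF ij]] by blast
      then have "u i = Inl a" "w j = Inr b"
        using u(2)[OF ij(1)] w(2)[OF ij(2)] by (auto simp: doubleton_eq_iff)
      then show "projl (u i) < n" "projr (w j) < n"
        using ab by simp_all
    qed
    have "inj_on (projl \<circ> u) {..<h}"
    proof (rule inj_onI)
      fix x y assume xy: "x \<in> {..<h}" "y \<in> {..<h}" "(projl \<circ> u) x = (projl \<circ> u) y"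
      then have "u x = u y" by (metis comp_apply lessThan_iff u_eq)
      then show "x = y" using inj_onD[OF u(1)] xy by blast
    qed
    moreover have "inj_on (projr \<circ> w) {..<h}"
    proof (rule inj_onI)
      fix x y assume xy: "x \<in> {..<h}" "y \<in> {..<h}" "(projr \<circ> w) x = (projr \<circ> w) y"
      then have "w x = w y" by (metis comp_apply lessThan_iff w_eq)
      then show "x = y" using inj_onD[OF w(1)] xy by blast
    qed
    ultimately have "distinct as" "distinct bs"
      unfolding as_def bs_def distinct_map by (simp_all add: atLeast0LessThan)
    moreover have "set as \<subseteq> {..<n}" "set bs \<subseteq> {..<n}"
      using less h by (auto simp: as_def bs_def)
    moreover have "\<forall>a\<in>set as. \<forall>b\<in>set bs. {Inl a, Inr b} \<in> edges H"
      using uw u_eq w_eq by (auto simp: as_def bs_def)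
    moreover have "length as = h" "length bs = h"
      by (simp_all add: as_def bs_def)
    ultimately have "biclique n h (\<lambda>a b. {Inl a, Inr b} \<in> edges H) (as, bs)"
      by (simp add: biclique_def)
    moreover have "Inl ` set as = u ` {..<h}" "Inr ` set bs = w ` {..<h}"
      using u_eq w_eq by (auto simp: as_def bs_def image_image atLeast0LessThan)
    ultimately show ?thesis
      using V by (intro exI[of _ "(as, bs)"]) simp
  qed
  define u where "u i = f (Inl i)" for i
  define w where "w j = f (Inr j)" for j
  have inj: "inj_on u {..<h}" "inj_on w {..<h}"
  proof -
    have f_inj: "x = y" if "f x = f y" "x \<in> part_A h \<union> part_B h" "y \<in> part_A h \<union> part_B h" for x y
      using inj_onD[OF bij_betw_imp_inj_on[OF f(1)]] that by blast
    show "inj_on u {..<h}"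
    proof (rule inj_onI)
      fix i j assume ij: "i \<in> {..<h}" "j \<in> {..<h}" "u i = u j"
      have "(Inl i :: nat + nat) = Inl j"
        by (rule f_inj) (use ij in \<open>simp_all add: u_def part_A_def\<close>)
      then show "i = j" by simp
    qed
    show "inj_on w {..<h}"
    proof (rule inj_onI)
      fix i j assume ij: "i \<in> {..<h}" "j \<in> {..<h}" "w i = w j"
      have "(Inr i :: nat + nat) = Inr j"
        by (rule f_inj) (use ij in \<open>simp_all add: w_def part_B_def\<close>)
      then show "i = j" by simp
    qed
  qed
  have V: "verts F = u ` {..<h} \<union> w ` {..<h}"
    using bij_betw_imp_surj_on[OF f(1)] by (auto simp: u_def w_def part_A_def part_B_def image_Un image_image)
  have uw: "{u i, w j} \<in> edges H" if "i < h" "j < h" for i j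
  proof -
    have "{Inl i, Inr j} \<in> edges (complete_bipartite h h)"
      using that by (auto simp: complete_bipartite_def part_A_def part_B_def)
    then have "f ` {Inl i, Inr j} \<in> edges F"
      unfolding f(2) by (rule imageI)
    then show ?thesis
      using F(1) by (auto simp: subgraph_def u_def w_def)
  qed
  have opp: "isl (u i) \<longleftrightarrow> \<not> isl (w j)" if "i < h" "j < h" for i j
    using H[OF uw[OF that]] by (auto simp: doubleton_eq_iff)
  show ?thesis
  proof (cases "isl (u 0)")
    case True
    have wj: "\<not> isl (w j)" if "j < h" for j using opp[of 0 j] True h that by simp
    have ui: "isl (u i)" if "i < h" for i using opp[of i 0] wj[of 0] h that by simp
    show ?thesis by (rule main[of u w]) (use inj ui wj uw V in auto)
  next
    case False
    have wj: "isl (w j)" if "j < h" for j using opp[of 0 j] False h that by simp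
    have ui: "\<not> isl (u i)" if "i < h" for i using opp[of i 0] wj[of 0] h that by simp
    show ?thesis
    proof (rule main[of w u])
      show "{w i, u j} \<in> edges H" if "i < h" "j < h" for i j
        using uw[OF that(2,1)] by (simp add: insert_commute)
    qed (use inj ui wj V in auto)
  qed
qed

lemma perfect_tiling_imp_packing:
  fixes H :: "(nat + nat) graph"
  assumes h: "h \<ge> 1" and tiling: "has_perfect_tiling (complete_bipartite h h) H"
    and V: "verts H = part_A n \<union> part_B n"
    and H: "\<And>e. e \<in> edges H \<Longrightarrow> \<exists>a<n. \<exists>b<n. e = {Inl a, Inr b}"
  obtains \<Q> where "packing n h (\<lambda>a b. {Inl a, Inr b} \<in> edges H) {} {} \<Q>" "card \<Q> = n div h"
proof -
  obtain T where T0: "is_tiling (complete_bipartite h h) H T" "(\<Union>F\<in>T. verts F) = verts H"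
    using tiling unfolding has_perfect_tiling_def by blast
  have T: "subgraph F H \<and> isomorphic (complete_bipartite h h) F" if "F \<in> T" for F
    using T0(1) that by (simp add: is_tiling_def)
  have disj: "verts F \<inter> verts F' = {}" if "F \<in> T" "F' \<in> T" "F \<noteq> F'" for F F'
  proof -
    have "pairwise (\<lambda>F F'. disjnt (verts F) (verts F')) T"
      using T0(1) by (simp add: is_tiling_def)
    from pairwiseD[OF this that] show ?thesis
      by (simp add: disjnt_def)
  qed
  have "\<exists>S. biclique n h (\<lambda>a b. {Inl a, Inr b} \<in> edges H) S \<and>
    verts F = Inl ` set (fst S) \<union> Inr ` set (snd S)" if "F \<in> T" for F
    by (rule copy_imp_biclique[OF h _ _ H]) (use T[OF that] in auto)
  then obtain \<phi> where \<phi>: "\<And>F. F \<in> T \<Longrightarrow> biclique n h (\<lambda>a b. {Inl a, Inr b} \<in> edges H) (\<phi> F)"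
    "\<And>F. F \<in> T \<Longrightarrow> verts F = Inl ` set (fst (\<phi> F)) \<union> Inr ` set (snd (\<phi> F))"
    by metis
  define \<Q> where "\<Q> = \<phi> ` T"
  have pack: "packing n h (\<lambda>a b. {Inl a, Inr b} \<in> edges H) {} {} \<Q>"
    unfolding packing_def
  proof (intro conjI ballI impI)
    have "\<Q> \<subseteq> lists_of n h \<times> lists_of n h"
    proof
      fix S assume "S \<in> \<Q>"
      then obtain F where "F \<in> T" "S = \<phi> F" by (auto simp: \<Q>_def)
      then show "S \<in> lists_of n h \<times> lists_of n h"
        using \<phi>(1)[of F] by (simp add: biclique_def mem_Times_iff)
    qed
    then show "finite \<Q>"
      by (rule finite_subset) (intro finite_cartesian_product finite_lists_of)
  next
    fix S assume "S \<in> \<Q>"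
    then show "biclique n h (\<lambda>a b. {Inl a, Inr b} \<in> edges H) S"
      using \<phi>(1) by (auto simp: \<Q>_def)
  next
    fix S S' assume S: "S \<in> \<Q>" "S' \<in> \<Q>" "S \<noteq> S'"
    then obtain F F' where F: "F \<in> T" "F' \<in> T" "F \<noteq> F'" "S = \<phi> F" "S' = \<phi> F'"
      by (auto simp: \<Q>_def)
    have "verts F \<inter> verts F' = {}" by (rule disj[OF F(1-3)])
    then show "set (fst S) \<inter> set (fst S') = {}" "set (snd S) \<inter> set (snd S') = {}"
      using \<phi>(2)[OF F(1)] \<phi>(2)[OF F(2)] F(4,5) by auto
  qed auto
  have "(\<Union>S\<in>\<Q>. set (fst S)) = {..<n}"
  proof
    show "(\<Union>S\<in>\<Q>. set (fst S)) \<subseteq> {..<n}"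
      using packing_subset(1)[OF pack] by simp
    show "{..<n} \<subseteq> (\<Union>S\<in>\<Q>. set (fst S))"
    proof
      fix a assume "a \<in> {..<n}"
      then have "Inl a \<in> verts H" by (auto simp: V part_A_def)
      then obtain F where "F \<in> T" "Inl a \<in> verts F" using T0(2) by blast
      then have "\<phi> F \<in> \<Q>" "a \<in> set (fst (\<phi> F))"
        using \<phi>(2)[of F] by (auto simp: \<Q>_def)
      then show "a \<in> (\<Union>S\<in>\<Q>. set (fst S))" by blast
    qed
  qed
  then have "n = h * card \<Q>"
    using packing_card(1)[OF pack] by simp
  then have "card \<Q> = n div h"
    using h by simp
  with pack show ?thesis by (rule that)
qed

text \<open>Choosing one element below d from each set that has one is injective by
  disjointness.\<close>

lemma card_hitting_le:
  assumes "finite \<Q>" "\<And>S S'. S \<in> \<Q> \<Longrightarrow> S' \<in> \<Q> \<Longrightarrow> S \<noteq> S' \<Longrightarrow> f S \<inter> f S' = {}"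
  shows "card {S\<in>\<Q>. f S \<inter> {..<d :: nat} \<noteq> {}} \<le> d"
proof -
  define x where "x S = (SOME a. a \<in> f S \<inter> {..<d})" for S
  have x: "x S \<in> f S \<inter> {..<d}" if ne: "f S \<inter> {..<d} \<noteq> {}" for S
  proof -
    obtain a where "a \<in> f S \<inter> {..<d}" using ne by blast
    then show ?thesis unfolding x_def by (rule someI)
  qed
  have "inj_on x {S\<in>\<Q>. f S \<inter> {..<d} \<noteq> {}}"
  proof (rule inj_onI)
    fix S S' assume S: "S \<in> {S\<in>\<Q>. f S \<inter> {..<d} \<noteq> {}}" "S' \<in> {S\<in>\<Q>. f S \<inter> {..<d} \<noteq> {}}" "x S = x S'"
    then have "x S \<in> f S \<inter> f S'"
      using x[of S] x[of S'] by simp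
    then show "S = S'"
      using assms(2)[of S S'] S by blast
  qed
  moreover have "x ` {S\<in>\<Q>. f S \<inter> {..<d} \<noteq> {}} \<subseteq> {..<d}"
    using x by blast
  ultimately have "card {S\<in>\<Q>. f S \<inter> {..<d} \<noteq> {}} \<le> card {..<d}"
    by (rule card_inj_on_le) simp
  then show ?thesis by simp
qed

text \<open>A tile that avoids the first d vertices of both parts contains no edge of
  \<open>two_stars\<close>, so all its edges are random. At most d tiles are lost in each part.
  Exactly the guaranteed number is kept, so that a union bound over families of fixed size
  applies.\<close>

lemma perfect_tiling_imp_random_bicliques:
  assumes h: "h \<ge> 1"
    and tiling: "has_perfect_tiling (complete_bipartite h h) (graph_union (two_stars n d) (bipartite_of n \<omega>))"
  shows "\<exists>\<M>\<subseteq>lists_of n h \<times> lists_of n h. card \<M> = n div h - 2 * d \<and>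
    packing n h (present_edge \<omega>) {} {} \<M>"
proof -
  let ?H = "graph_union (two_stars n d) (bipartite_of n \<omega>)"
  have V: "verts ?H = part_A n \<union> part_B n"
    by (simp add: graph_union_def two_stars_def bipartite_of_def)
  have H: "\<exists>a<n. \<exists>b<n. e = {Inl a, Inr b}" if "e \<in> edges ?H" for e
    using that by (auto simp: graph_union_def two_stars_def bipartite_of_def part_A_def part_B_def)
  obtain \<Q> where \<Q>: "packing n h (\<lambda>a b. {Inl a, Inr b} \<in> edges ?H) {} {} \<Q>" "card \<Q> = n div h"
    using perfect_tiling_imp_packing[OF h tiling V H] by blast
  define A where "A = {S\<in>\<Q>. set (fst S) \<inter> {..<d} \<noteq> {}}"
  define B where "B = {S\<in>\<Q>. set (snd S) \<inter> {..<d} \<noteq> {}}"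
  have fin: "finite \<Q>" using \<Q>(1) by (simp add: packing_def)
  have disj: "set (fst S) \<inter> set (fst S') = {}" "set (snd S) \<inter> set (snd S') = {}"
    if "S \<in> \<Q>" "S' \<in> \<Q>" "S \<noteq> S'" for S S'
    using \<Q>(1) that unfolding packing_def by blast+
  have cardA: "card A \<le> d" and cardB: "card B \<le> d"
    unfolding A_def B_def by (rule card_hitting_le[OF fin disj(1)], auto) (rule card_hitting_le[OF fin disj(2)], auto)
  have "card \<Q> - card (A \<union> B) \<le> card (\<Q> - (A \<union> B))"
    using fin by (intro diff_card_le_card_Diff) (auto simp: A_def B_def)
  moreover have "card (A \<union> B) \<le> 2 * d"
    using card_Un_le[of A B] cardA cardB by linarith
  ultimately have "n div h - 2 * d \<le> card (\<Q> - (A \<union> B))"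
    using \<Q>(2) by linarith
  then obtain \<M> where \<M>: "\<M> \<subseteq> \<Q> - (A \<union> B)" "card \<M> = n div h - 2 * d"
    using obtain_subset_with_card_n by metis
  have bi: "biclique n h (present_edge \<omega>) S" if "S \<in> \<M>" for S
  proof -
    have S: "S \<in> \<Q>" "set (fst S) \<inter> {..<d} = {}" "set (snd S) \<inter> {..<d} = {}"
      using that \<M>(1) by (auto simp: A_def B_def)
    have b: "biclique n h (\<lambda>a b. {Inl a, Inr b} \<in> edges ?H) S"
      using \<Q>(1) S(1) by (simp add: packing_def)
    have "present_edge \<omega> a b" if "a \<in> set (fst S)" "b \<in> set (snd S)" for a b
    proof -
      have "{Inl a, Inr b} \<in> edges ?H"
        using b that by (simp add: biclique_def)
      moreover have "\<not> a < d" "\<not> b < d"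
        using S that by auto
      ultimately show ?thesis
        using edges_two_stars[of a b n d] edges_bipartite_of[of a b n \<omega>] by (auto simp: graph_union_def)
    qed
    then show ?thesis
      using b by (simp add: biclique_def)
  qed
  have "packing n h (present_edge \<omega>) {} {} \<M>"
    unfolding packing_def
  proof (intro conjI ballI impI)
    show "finite \<M>" using \<M>(1) fin finite_subset by blast
    show "set (fst S) \<inter> set (fst S') = {}" "set (snd S) \<inter> set (snd S') = {}"
      if "S \<in> \<M>" "S' \<in> \<M>" "S \<noteq> S'" for S S'
      using disj[of S S'] that \<M>(1) by auto
  qed (use bi in auto)
  moreover have "\<M> \<subseteq> lists_of n h \<times> lists_of n h"
  proof
    fix S assume "S \<in> \<M>"
    from bi[OF this] show "S \<in> lists_of n h \<times> lists_of n h"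
      by (simp add: biclique_def mem_Times_iff)
  qed
  ultimately show ?thesis
    using \<M>(2) by blast
qed

text \<open>A union bound over m-element sets of tuples. Disjointness makes all m h^2 required pairs
  different, so each set contributes p^(h^2 m). Counting the bicliques as an unordered set yields
  1/m!, without which the bound would be useless for m of order n.\<close>

lemma prob_packing_le:
  assumes "0 \<le> p" "p \<le> 1"
  shows "measure_pmf.prob (random_subset (part_A n \<times> part_B n) p)
      {\<omega>. \<exists>\<M>\<subseteq>lists_of n h \<times> lists_of n h. card \<M> = m \<and> packing n h (present_edge \<omega>) {} {} \<M>} \<le>
    (real n ^ (2 * h) * p ^ h\<^sup>2) ^ m / fact m"
proof -
  let ?M = "random_subset (part_A n \<times> part_B n) p" and ?L = "lists_of n h \<times> lists_of n h"
  \<comment> \<open>The packings in the complete bipartite graph: the union bound needs an index set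
    that does not depend on the random graph.\<close>
  define X where "X = {\<M>. \<M> \<subseteq> ?L \<and> card \<M> = m \<and> packing n h (\<lambda>_ _. True) {} {} \<M>}"
  have finL: "finite ?L" by (intro finite_cartesian_product finite_lists_of)
  have finX: "finite X"
    by (rule finite_subset[of _ "Pow ?L"]) (auto simp: X_def finL)
  have finE: "finite (part_A n \<times> part_B n)" by (simp add: part_A_def part_B_def)
  have cardX: "real (card X) \<le> (real n ^ (2 * h)) ^ m / fact m"
  proof -
    have "card X \<le> card {\<M>. \<M> \<subseteq> ?L \<and> card \<M> = m}"
      unfolding X_def using finL by (intro card_mono) auto
    also have "\<dots> = (n ^ (2 * h)) choose m"
      using finL by (subst n_subsets) (simp_all add: card_cartesian_product card_lists_of mult_2 power_add)
    finally have "card X * fact m \<le> ((n ^ (2 * h)) choose m) * fact m"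
      by (rule mult_le_mono1)
    also have "\<dots> \<le> (n ^ (2 * h)) ^ m"
      by (rule binomial_fact_pow)
    finally have "real (card X * fact m) \<le> real ((n ^ (2 * h)) ^ m)"
      by (simp only: of_nat_le_iff)
    then show ?thesis
      by (simp add: pos_le_divide_eq)
  qed
  define ev where "ev \<M> = {\<omega>. \<forall>e\<in>(\<Union>T\<in>\<M>. cross_pairs T). \<omega> e}"
    for \<M> :: "(nat list \<times> nat list) set"
  have prob_ev: "measure_pmf.prob ?M (ev \<M>) = (p ^ h\<^sup>2) ^ m" if "\<M> \<in> X" for \<M>
  proof -
    have \<M>: "\<M> \<subseteq> ?L" "card \<M> = m" "packing n h (\<lambda>_ _. True) {} {} \<M>"
      using that by (auto simp: X_def)
    have bi: "biclique n h (\<lambda>_ _. True) T" if "T \<in> \<M>" for T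
      using \<M>(3) that by (simp add: packing_def)
    have "card (\<Union>T\<in>\<M>. cross_pairs T) = (\<Sum>T\<in>\<M>. card (cross_pairs T))"
    proof (rule card_UN_disjoint)
      show "finite \<M>" using \<M>(3) by (simp add: packing_def)
      show "\<forall>T\<in>\<M>. finite (cross_pairs T)" by (simp add: cross_pairs_def)
      show "\<forall>T\<in>\<M>. \<forall>T'\<in>\<M>. T \<noteq> T' \<longrightarrow> cross_pairs T \<inter> cross_pairs T' = {}"
      proof (intro ballI impI)
        fix T T' assume "T \<in> \<M>" "T' \<in> \<M>" "T \<noteq> T'"
        then have "set (fst T) \<inter> set (fst T') = {}"
          using \<M>(3) by (simp add: packing_def)
        then show "cross_pairs T \<inter> cross_pairs T' = {}"
          by (auto simp: cross_pairs_def)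
      qed
    qed
    also have "\<dots> = (\<Sum>T\<in>\<M>. h\<^sup>2)"
    proof (rule sum.cong)
      fix T assume "T \<in> \<M>"
      then show "card (cross_pairs T) = h\<^sup>2"
        using biclique_card[OF bi]
        by (simp add: cross_pairs_def card_cartesian_product card_image power2_eq_square)
    qed simp
    also have "\<dots> = h\<^sup>2 * m" using \<M>(2) by simp
    finally have "card (\<Union>T\<in>\<M>. cross_pairs T) = h\<^sup>2 * m" .
    moreover have "(\<Union>T\<in>\<M>. cross_pairs T) \<subseteq> part_A n \<times> part_B n"
    proof (rule UN_least)
      fix T assume "T \<in> \<M>"
      then show "cross_pairs T \<subseteq> part_A n \<times> part_B n"
        using biclique_subset[OF bi] unfolding cross_pairs_def part_A_def part_B_def
        by (intro Sigma_mono image_mono) auto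
    qed
    ultimately show ?thesis
      unfolding ev_def using assms by (subst prob_present[OF finE]) (simp_all add: power_mult)
  qed
  have "measure_pmf.prob ?M {\<omega>. \<exists>\<M>\<subseteq>?L. card \<M> = m \<and> packing n h (present_edge \<omega>) {} {} \<M>} \<le>
      measure_pmf.prob ?M (\<Union>\<M>\<in>X. ev \<M>)"
  proof (intro measure_pmf.finite_measure_mono subsetI)
    fix \<omega> assume "\<omega> \<in> {\<omega>. \<exists>\<M>\<subseteq>?L. card \<M> = m \<and> packing n h (present_edge \<omega>) {} {} \<M>}"
    then obtain \<M> where \<M>: "\<M> \<subseteq> ?L" "card \<M> = m" "packing n h (present_edge \<omega>) {} {} \<M>"
      by blast
    have bi: "biclique n h (present_edge \<omega>) T" if "T \<in> \<M>" for T
      using \<M>(3) that by (simp add: packing_def)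
    have "packing n h (\<lambda>_ _. True) {} {} \<M>"
      using \<M>(3) biclique_mono[OF bi] by (simp add: packing_def)
    then have "\<M> \<in> X" using \<M> by (simp add: X_def)
    moreover have "\<omega> \<in> ev \<M>"
      using bi by (fastforce simp: ev_def cross_pairs_def biclique_def present_edge_def)
    ultimately show "\<omega> \<in> (\<Union>\<M>\<in>X. ev \<M>)" by blast
  qed simp
  also have "\<dots> \<le> (\<Sum>\<M>\<in>X. measure_pmf.prob ?M (ev \<M>))"
    using finX by (intro measure_pmf.finite_measure_subadditive_finite) auto
  also have "\<dots> = real (card X) * (p ^ h\<^sup>2) ^ m"
    using prob_ev by simp
  also have "\<dots> \<le> (real n ^ (2 * h)) ^ m / fact m * (p ^ h\<^sup>2) ^ m"
    using cardX assms by (intro mult_right_mono) auto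
  also have "\<dots> = (real n ^ (2 * h) * p ^ h\<^sup>2) ^ m / fact m"
    by (simp add: power_mult_distrib)
  finally show ?thesis .
qed

lemma no_perfect_tiling_whp:
  fixes h :: nat and \<alpha> :: real
  assumes h: "h \<ge> 1" and \<alpha>: "0 < \<alpha>" "\<alpha> < 1 / (2 * real h)"
  obtains c where "c > 0" and "\<And>p. (\<And>n. 0 \<le> p n \<and> p n \<le> 1) \<Longrightarrow>
    \<forall>\<^sub>F n in multiples_at_top h. p n \<le> c * real n powr (- (2 * real h - 1) / (real h)\<^sup>2) \<Longrightarrow>
    \<exists>G. dense_bipartite_seq h \<alpha> G \<and>
    whp (multiples_at_top h) (\<lambda>n. random_bipartite n (p n))
      (\<lambda>n R. \<not> has_perfect_tiling (complete_bipartite h h) (graph_union (G n) R))"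
proof -
  have hr: "real h \<ge> 1" using h by simp
  \<comment> \<open>Up to rounding, \<open>\<delta> n\<close> of the n/h tiles avoid both special
    sets of about \<open>\<alpha> n\<close> vertices.\<close>
  define \<delta> where "\<delta> = 1 / real h - 2 * \<alpha>"
  have \<delta>: "0 < \<delta>" "\<delta> \<le> 1"
  proof -
    have "2 * \<alpha> < 2 * (1 / (2 * real h))" using \<alpha> by linarith
    then show "0 < \<delta>" by (simp add: \<delta>_def)
    have "1 / real h \<le> 1" using hr by simp
    then show "\<delta> \<le> 1" using \<alpha> by (simp add: \<delta>_def)
  qed
  \<comment> \<open>Chosen so that e c n \<le> m/2 as soon as m \<ge> \<open>\<delta> n / 2\<close>,
    which makes the base of the m-th power below at most 1/2.\<close>
  define c where "c = \<delta> / (4 * exp 1)"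
  have c: "0 < c" "c \<le> 1"
  proof -
    show "0 < c" using \<delta> by (simp add: c_def)
    have "(1 :: real) \<le> 4 * exp 1" using exp_ge_add_one_self[of "1 :: real"] by linarith
    then show "c \<le> 1" using \<delta> by (simp add: c_def pos_divide_le_eq)
  qed
  define d where "d n = nat \<lceil>\<alpha> * real n\<rceil>" for n
  have d: "\<alpha> * real n \<le> real (d n)" "real (d n) < \<alpha> * real n + 1" for n
  proof -
    have "0 \<le> \<alpha> * real n" using \<alpha> by simp
    then show "\<alpha> * real n \<le> real (d n)" "real (d n) < \<alpha> * real n + 1"
      unfolding d_def by linarith+
  qed
  have d_le: "d n \<le> n" for n
  proof -
    have "1 / (2 * real h) \<le> 1" using hr by simp
    then have "\<alpha> * real n \<le> 1 * real n" using \<alpha> by (intro mult_right_mono) auto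
    then show ?thesis unfolding d_def by linarith
  qed
  show ?thesis
  proof (rule that[OF c(1)])
    fix p :: "nat \<Rightarrow> real"
    assume p01: "\<And>n. 0 \<le> p n \<and> p n \<le> 1"
      and p: "\<forall>\<^sub>F n in multiples_at_top h. p n \<le> c * real n powr (- (2 * real h - 1) / (real h)\<^sup>2)"
    define G where "G n = two_stars n (d n)" for n
    have "dense_bipartite_seq h \<alpha> G"
      unfolding dense_bipartite_seq_def
    proof (intro allI impI conjI)
      fix n assume n: "0 < n \<and> h dvd n"
      show "bipartite_graph (part_A n) (part_B n) (G n)"
        unfolding G_def by (rule two_stars_bipartite)
      have "d n \<le> min_degree (G n)"
        unfolding G_def using n by (intro two_stars_min_degree d_le) auto
      then show "\<alpha> * real n \<le> real (min_degree (G n))"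
        using d(1)[of n] by linarith
    qed
    moreover have "whp (multiples_at_top h) (\<lambda>n. random_bipartite n (p n))
      (\<lambda>n R. \<not> has_perfect_tiling (complete_bipartite h h) (graph_union (G n) R))"
    proof (rule whp_multiplesI)
      show "(\<lambda>n. 2 / (\<delta> * real n)) \<longlonglongrightarrow> 0"
        using \<delta>(1) by real_asymp
      have "\<forall>\<^sub>F n in sequentially. n \<ge> 1"
        by (rule eventually_ge_at_top)
      \<comment> \<open>Rounding \<open>\<alpha> n\<close> up in both parts loses at most 2 tiles,
        which is no more than half of \<open>\<delta> n\<close>.\<close>
      moreover have "\<forall>\<^sub>F n in sequentially. 4 \<le> \<delta> * real n"
        using \<delta>(1) by real_asymp
      moreover note p[unfolded eventually_multiples_at_top]
      ultimately show "\<forall>\<^sub>F n in multiples_at_top h. 1 - 2 / (\<delta> * real n) \<le>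
          measure_pmf.prob (random_bipartite n (p n))
            {R. \<not> has_perfect_tiling (complete_bipartite h h) (graph_union (G n) R)}"
        unfolding eventually_multiples_at_top
      proof eventually_elim
        case (elim n)
        show ?case
        proof
          assume "h dvd n"
          with elim(3) have pn: "p n \<le> c * real n powr (- (2 * real h - 1) / (real h)\<^sup>2)"
            by blast
          define m where "m = n div h - 2 * d n"
          have m: "\<delta> * real n / 2 \<le> real m"
          proof -
            have "real (n div h) = real n / real h"
              using \<open>h dvd n\<close> by (rule real_of_nat_div)
            moreover have "real (n div h) - 2 * real (d n) \<le> real m"
              unfolding m_def by linarith
            moreover have "real n / real h = \<delta> * real n + 2 * (\<alpha> * real n)"
              by (simp add: \<delta>_def algebra_simps)
            ultimately show ?thesis
              using d(2)[of n] elim(2) by linarith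
          qed
          have m0: "0 < real m" using m elim(2) by linarith
          define y where "y = real n ^ (2 * h) * p n ^ h\<^sup>2"
          have y0: "0 \<le> y" using p01 by (simp add: y_def)
          have y: "y \<le> c * real n"
          proof -
            \<comment> \<open>At the threshold function n^(2h) t^(h^2) equals n exactly, so
              \<open>y\<close>, which bounds the expected number of copies from above up to
              ordering, is at most c n.\<close>
            define t where "t = real n powr (- (2 * real h - 1) / (real h)\<^sup>2)"
            have "t ^ h\<^sup>2 = t powr real (h\<^sup>2)"
              using elim(1) by (intro powr_realpow[symmetric]) (simp add: t_def)
            also have "\<dots> = real n powr (- (2 * real h - 1) / (real h)\<^sup>2 * real (h\<^sup>2))"
              unfolding t_def by (rule powr_powr)
            also have "- (2 * real h - 1) / (real h)\<^sup>2 * real (h\<^sup>2) = 1 - real (2 * h)"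
              using h by simp
            finally have t: "t ^ h\<^sup>2 = real n powr (1 - real (2 * h))" .
            have "p n ^ h\<^sup>2 \<le> (c * t) ^ h\<^sup>2"
              using pn p01 by (intro power_mono) (auto simp: t_def)
            also have "\<dots> = c ^ h\<^sup>2 * t ^ h\<^sup>2"
              by (rule power_mult_distrib)
            also have "\<dots> \<le> c * t ^ h\<^sup>2"
            proof (intro mult_right_mono)
              have "c ^ h\<^sup>2 \<le> c ^ 1"
                using c h by (intro power_decreasing) auto
              then show "c ^ h\<^sup>2 \<le> c" by simp
            qed (simp add: t_def)
            finally have "y \<le> real n ^ (2 * h) * (c * t ^ h\<^sup>2)"
              unfolding y_def by (intro mult_left_mono) auto
            also have "\<dots> = c * (real n powr real (2 * h) * real n powr (1 - real (2 * h)))"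
              unfolding t using elim(1) by (subst powr_realpow) auto
            also have "\<dots> = c * real n"
              using elim(1) unfolding powr_add[symmetric] by simp
            finally show ?thesis .
          qed
          have "measure_pmf.prob (random_bipartite n (p n))
              {R. has_perfect_tiling (complete_bipartite h h) (graph_union (G n) R)} \<le>
            measure_pmf.prob (random_subset (part_A n \<times> part_B n) (p n))
              {\<omega>. \<exists>\<M>\<subseteq>lists_of n h \<times> lists_of n h. card \<M> = m \<and> packing n h (present_edge \<omega>) {} {} \<M>}"
            unfolding prob_random_bipartite m_def G_def
            using perfect_tiling_imp_random_bicliques[OF h, of n "d n"]
            by (intro measure_pmf.finite_measure_mono) auto
          also have "\<dots> \<le> y ^ m / fact m"
            unfolding y_def using p01 by (intro prob_packing_le) auto
          also have "\<dots> \<le> (1 / 2) ^ m"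
          proof -
            \<comment> \<open>This quotient is a single term of the exponential series at m, which
              gives the elementary bound m! \<ge> (m/e)^m.\<close>
            have "real m ^ m / fact m \<le> exp (real m)"
            proof -
              have "(\<lambda>k. real m ^ k / fact k) sums exp (real m)"
                using exp_converges[of "real m"] by (simp add: divide_inverse mult.commute)
              then show ?thesis
                using sum_le_suminf[of "\<lambda>k. real m ^ k / fact k" "{m}"]
                by (simp add: sums_iff)
            qed
            then have "(y / real m) ^ m * (real m ^ m / fact m) \<le> (y / real m) ^ m * exp 1 ^ m"
              using y0 m0 by (intro mult_left_mono) (auto simp: exp_of_nat_mult[symmetric])
            also have "\<dots> = (y * exp 1 / real m) ^ m"
              by (simp add: power_mult_distrib[symmetric])
            also have "\<dots> \<le> (1 / 2) ^ m"
            proof (rule power_mono)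
              have "y * exp 1 \<le> c * real n * exp 1"
                using y by (intro mult_right_mono) auto
              also have "\<dots> = \<delta> * real n / 4"
                by (simp add: c_def)
              also have "\<dots> \<le> real m / 2"
                using m by linarith
              finally show "y * exp 1 / real m \<le> 1 / 2"
                using m0 by (simp add: pos_divide_le_eq)
              show "0 \<le> y * exp 1 / real m" using y0 by simp
            qed
            finally show ?thesis
              using m0 by (simp add: power_divide)
          qed
          \<comment> \<open>The exponential bound is weakened to a reciprocal, which suffices for
            the limit.\<close>
          also have "\<dots> \<le> 1 / real m"
          proof -
            have "real m \<le> 2 ^ m"
              using less_exp[of m] by (metis less_imp_le of_nat_le_iff of_nat_numeral of_nat_power)
            then show ?thesis
              using m0 by (simp add: power_divide frac_le)
          qed
          also have "\<dots> \<le> 1 / (\<delta> * real n / 2)"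
            using m elim(2) by (intro divide_left_mono) auto
          also have "\<dots> = 2 / (\<delta> * real n)" by simp
          finally have "measure_pmf.prob (random_bipartite n (p n))
              {R. has_perfect_tiling (complete_bipartite h h) (graph_union (G n) R)} \<le> 2 / (\<delta> * real n)" .
          moreover have "{R. \<not> has_perfect_tiling (complete_bipartite h h) (graph_union (G n) R)} =
              UNIV - {R. has_perfect_tiling (complete_bipartite h h) (graph_union (G n) R)}"
            by auto
          ultimately show "1 - 2 / (\<delta> * real n) \<le> measure_pmf.prob (random_bipartite n (p n))
            {R. \<not> has_perfect_tiling (complete_bipartite h h) (graph_union (G n) R)}"
            using measure_pmf.prob_compl[of "{R. has_perfect_tiling (complete_bipartite h h) (graph_union (G n) R)}"
                "random_bipartite n (p n)"] by simp
        qed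
      qed
    qed
    ultimately show "\<exists>G. dense_bipartite_seq h \<alpha> G \<and>
      whp (multiples_at_top h) (\<lambda>n. random_bipartite n (p n))
        (\<lambda>n R. \<not> has_perfect_tiling (complete_bipartite h h) (graph_union (G n) R))"
      by blast
  qed
qed

theorem theorem1p1:
  fixes h :: nat and \<alpha> :: real
  assumes "h \<ge> 1" and "0 < \<alpha>" and "\<alpha> < 1 / (2 * real h)"
  defines "t \<equiv> \<lambda>n::nat. real n powr (- (2 * real h - 1) / (real h)\<^sup>2)"
  shows "\<exists>c C :: real. c > 0 \<and> C > 0 \<and>
    (\<forall>p :: nat \<Rightarrow> real. (\<forall>n. 0 \<le> p n \<and> p n \<le> 1) \<longrightarrow>
       (\<forall>\<^sub>F n in multiples_at_top h. p n \<le> c * t n) \<longrightarrow>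
       (\<exists>G. dense_bipartite_seq h \<alpha> G \<and>
          whp (multiples_at_top h) (\<lambda>n. random_bipartite n (p n))
            (\<lambda>n R. \<not> has_perfect_tiling (complete_bipartite h h) (graph_union (G n) R)))) \<and>
    (\<forall>p :: nat \<Rightarrow> real. (\<forall>n. 0 \<le> p n \<and> p n \<le> 1) \<longrightarrow>
       (\<forall>\<^sub>F n in multiples_at_top h. p n \<ge> C * t n) \<longrightarrow>
       (\<forall>G. dense_bipartite_seq h \<alpha> G \<longrightarrow>
          whp (multiples_at_top h) (\<lambda>n. random_bipartite n (p n))
            (\<lambda>n R. has_perfect_tiling (complete_bipartite h h) (graph_union (G n) R))))"
proof -
  have "1 / (2 * real h) \<le> 1" using assms(1) by simp
  then have "\<alpha> \<le> 1" using assms(3) by linarith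
  then obtain C where C: "C > 0" "\<And>p G. (\<And>n. 0 \<le> p n \<and> p n \<le> 1) \<Longrightarrow>
    \<forall>\<^sub>F n in multiples_at_top h. p n \<ge> C * t n \<Longrightarrow> dense_bipartite_seq h \<alpha> G \<Longrightarrow>
    whp (multiples_at_top h) (\<lambda>n. random_bipartite n (p n))
      (\<lambda>n R. has_perfect_tiling (complete_bipartite h h) (graph_union (G n) R))"
    unfolding t_def by (rule perfect_tiling_whp[OF assms(1,2)]) blast
  obtain c where c: "c > 0" "\<And>p. (\<And>n. 0 \<le> p n \<and> p n \<le> 1) \<Longrightarrow>
    \<forall>\<^sub>F n in multiples_at_top h. p n \<le> c * t n \<Longrightarrow>
    \<exists>G. dense_bipartite_seq h \<alpha> G \<and>
    whp (multiples_at_top h) (\<lambda>n. random_bipartite n (p n))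
      (\<lambda>n R. \<not> has_perfect_tiling (complete_bipartite h h) (graph_union (G n) R))"
    unfolding t_def by (rule no_perfect_tiling_whp[OF assms(1-3)]) blast
  show ?thesis
    by (intro exI[of _ c] exI[of _ C] conjI allI impI c C) blast+
qed

end
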